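(* Let $\lambda\in\mathbb C$ with $|\lambda|=1$, let $s\geq1$ be an integer, fix a sign $\pm$, and let $\alpha(h)=\lambda^{\frac12}e^{\pm ih^s}$. There exists a Moser–Webster triple of involutions $(\tau_1,\tau_2,\rho)$ of $(\mathbb C^2,0)$ that is formally equivalent to the triple $$\tau'_{1}(\xi)=\begin{pmatrix}0&\alpha(h)\\\alpha(h)^{-1}&0\end{pmatrix}\xi,\qquad \tau'_{2}(\xi)=\begin{pmatrix}0&\alpha(h)^{-1}\\\alpha(h)&0\end{pmatrix}\xi,\qquad \rho'(\xi)=\bar\xi,$$ with $h=\xi_1\xi_2$, but not analytically equivalent to it.
   Context: A Moser–Webster triple of involutions $(\tau_1,\tau_2,\rho)$ consists of two holomorphic reflections $\tau_1,\tau_2\in\mathrm{Diff}(\mathbb C^2,0)$ (holomorphic involutions whose linear parts have eigenvalues $\{1,-1\}$) and an antiholomorphic involution $\rho$ of $(\mathbb C^2,0)$ such that $\tau_2=\rho\circ\tau_1\circ\rho$. Two triples are formally (resp. analytically) equivalent if there is a formal (resp. holomorphic) diffeomorphism $\Psi$ of $(\mathbb C^2,0)$ conjugating them componentwise: $\Psi\circ\tau_j=\tau'_j\circ\Psi$, $\Psi\circ\rho=\rho'\circ\Psi$. *)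

theory Defs
  imports "HOL-Analysis.Analysis"
begin

type_synonym C2 = "complex \<times> complex"

text \<open>Formal power series in two variables xi1, xi2: coefficient of xi1^i xi2^j is c i j.\<close>
type_synonym fps2 = "nat \<Rightarrow> nat \<Rightarrow> complex"

definition mon :: "nat \<Rightarrow> nat \<Rightarrow> C2 \<Rightarrow> complex" where
  "mon i j z = fst z ^ i * snd z ^ j"

definition has_ps_expansion :: "(C2 \<Rightarrow> complex) \<Rightarrow> fps2 \<Rightarrow> bool" where
  "has_ps_expansion f c \<longleftrightarrow>
     (\<exists>r>0. \<forall>z. norm (fst z) < r \<and> norm (snd z) < r \<longrightarrow>
        ((\<lambda>(i,j). c i j * mon i j z) has_sum f z) UNIV)"

definition holo_germ :: "(C2 \<Rightarrow> C2) \<Rightarrow> bool" where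
  "holo_germ f \<longleftrightarrow> (\<exists>c1 c2. has_ps_expansion (\<lambda>z. fst (f z)) c1 \<and> has_ps_expansion (\<lambda>z. snd (f z)) c2)"

definition taylor :: "(C2 \<Rightarrow> complex) \<Rightarrow> fps2" where
  "taylor f = (SOME c. has_ps_expansion f c)"

definition taylor_map :: "(C2 \<Rightarrow> C2) \<Rightarrow> fps2 \<times> fps2" where
  "taylor_map f = (taylor (\<lambda>z. fst (f z)), taylor (\<lambda>z. snd (f z)))"

definition cnj2 :: "C2 \<Rightarrow> C2" where
  "cnj2 z = (cnj (fst z), cnj (snd z))"

definition germ_eq :: "(C2 \<Rightarrow> C2) \<Rightarrow> (C2 \<Rightarrow> C2) \<Rightarrow> bool" where
  "germ_eq f g \<longleftrightarrow> (\<forall>\<^sub>F z in nhds 0. f z = g z)"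

definition eigvals2 :: "complex \<Rightarrow> complex \<Rightarrow> complex \<Rightarrow> complex \<Rightarrow> complex set" where
  "eigvals2 a b c d = {m. (a - m) * (d - m) - b * c = 0}"

definition lin_eigvals :: "fps2 \<times> fps2 \<Rightarrow> complex set" where
  "lin_eigvals P = eigvals2 (fst P 1 0) (fst P 0 1) (snd P 1 0) (snd P 0 1)"

definition lin_det :: "fps2 \<times> fps2 \<Rightarrow> complex" where
  "lin_det P = fst P 1 0 * snd P 0 1 - fst P 0 1 * snd P 1 0"

definition holo_reflection :: "(C2 \<Rightarrow> C2) \<Rightarrow> bool" where
  "holo_reflection t \<longleftrightarrow> holo_germ t \<and> t 0 = 0 \<and> germ_eq (t \<circ> t) id
     \<and> lin_eigvals (taylor_map t) = {1, -1}"

definition antiholo_involution :: "(C2 \<Rightarrow> C2) \<Rightarrow> bool" where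
  "antiholo_involution r \<longleftrightarrow> holo_germ (r \<circ> cnj2) \<and> r 0 = 0 \<and> germ_eq (r \<circ> r) id"

definition MW_triple :: "(C2 \<Rightarrow> C2) \<Rightarrow> (C2 \<Rightarrow> C2) \<Rightarrow> (C2 \<Rightarrow> C2) \<Rightarrow> bool" where
  "MW_triple t1 t2 r \<longleftrightarrow> holo_reflection t1 \<and> holo_reflection t2 \<and> antiholo_involution r
     \<and> germ_eq t2 (r \<circ> t1 \<circ> r)"

definition fone :: fps2 where "fone i j = (if i = 0 \<and> j = 0 then 1 else 0)"

definition fmul :: "fps2 \<Rightarrow> fps2 \<Rightarrow> fps2" where
  "fmul a b i j = (\<Sum>k\<le>i. \<Sum>l\<le>j. a k l * b (i - k) (j - l))"

definition fpow :: "fps2 \<Rightarrow> nat \<Rightarrow> fps2" where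
  "fpow a n = (fmul a ^^ n) fone"

text \<open>Composition F o G for G with vanishing constant terms (only terms with k+l <= i+j contribute).\<close>
definition fcomp1 :: "fps2 \<Rightarrow> fps2 \<times> fps2 \<Rightarrow> fps2" where
  "fcomp1 F G i j = (\<Sum>(k,l)\<in>{(k,l). k + l \<le> i + j}.
       F k l * fmul (fpow (fst G) k) (fpow (snd G) l) i j)"

definition fcomp :: "fps2 \<times> fps2 \<Rightarrow> fps2 \<times> fps2 \<Rightarrow> fps2 \<times> fps2" where
  "fcomp F G = (fcomp1 (fst F) G, fcomp1 (snd F) G)"

definition fconj :: "fps2 \<times> fps2 \<Rightarrow> fps2 \<times> fps2" where
  "fconj P = ((\<lambda>i j. cnj (fst P i j)), (\<lambda>i j. cnj (snd P i j)))"

definition formal_diffeo :: "fps2 \<times> fps2 \<Rightarrow> bool" where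
  "formal_diffeo P \<longleftrightarrow> fst P 0 0 = 0 \<and> snd P 0 0 = 0 \<and> lin_det P \<noteq> 0"

text \<open>Formal equivalence: Psi o tau_j = tau'_j o Psi, and Psi o rho = rho' o Psi, the latter
  written for rho = g o conj, rho' = g' o conj as Psi o g = g' o conj-coefficients(Psi).\<close>
definition formally_equiv ::
  "(C2 \<Rightarrow> C2) \<Rightarrow> (C2 \<Rightarrow> C2) \<Rightarrow> (C2 \<Rightarrow> C2) \<Rightarrow> (C2 \<Rightarrow> C2) \<Rightarrow> (C2 \<Rightarrow> C2) \<Rightarrow> (C2 \<Rightarrow> C2) \<Rightarrow> bool" where
  "formally_equiv t1 t2 r t1' t2' r' \<longleftrightarrow>
     (\<exists>P. formal_diffeo P
        \<and> fcomp P (taylor_map t1) = fcomp (taylor_map t1') P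
        \<and> fcomp P (taylor_map t2) = fcomp (taylor_map t2') P
        \<and> fcomp P (taylor_map (r \<circ> cnj2)) = fcomp (taylor_map (r' \<circ> cnj2)) (fconj P))"

definition holo_diffeo_germ :: "(C2 \<Rightarrow> C2) \<Rightarrow> bool" where
  "holo_diffeo_germ f \<longleftrightarrow> holo_germ f \<and> f 0 = 0 \<and>
     (\<exists>g. holo_germ g \<and> g 0 = 0 \<and> germ_eq (g \<circ> f) id \<and> germ_eq (f \<circ> g) id)"

definition analytically_equiv ::
  "(C2 \<Rightarrow> C2) \<Rightarrow> (C2 \<Rightarrow> C2) \<Rightarrow> (C2 \<Rightarrow> C2) \<Rightarrow> (C2 \<Rightarrow> C2) \<Rightarrow> (C2 \<Rightarrow> C2) \<Rightarrow> (C2 \<Rightarrow> C2) \<Rightarrow> bool" where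
  "analytically_equiv t1 t2 r t1' t2' r' \<longleftrightarrow>
     (\<exists>f. holo_diffeo_germ f \<and> germ_eq (f \<circ> t1) (t1' \<circ> f) \<and> germ_eq (f \<circ> t2) (t2' \<circ> f)
        \<and> germ_eq (f \<circ> r) (r' \<circ> f))"

definition alpha :: "complex \<Rightarrow> nat \<Rightarrow> complex \<Rightarrow> complex \<Rightarrow> complex" where
  "alpha mu s sg h = mu * exp (sg * \<i> * h ^ s)"

definition tau1_model :: "complex \<Rightarrow> nat \<Rightarrow> complex \<Rightarrow> C2 \<Rightarrow> C2" where
  "tau1_model mu s sg xi = (let h = fst xi * snd xi in
     (alpha mu s sg h * snd xi, inverse (alpha mu s sg h) * fst xi))"

definition tau2_model :: "complex \<Rightarrow> nat \<Rightarrow> complex \<Rightarrow> C2 \<Rightarrow> C2" where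
  "tau2_model mu s sg xi = (let h = fst xi * snd xi in
     (inverse (alpha mu s sg h) * snd xi, alpha mu s sg h * fst xi))"

end

theory Submission
  imports Defs "HOL-Complex_Analysis.Complex_Analysis"
begin

text \<open>
  Write h = xy. The triple is obtained by conjugating the first model involution with a map
  g_t = (x exp a_t, y exp (-a_t)), t real, which preserves h and in which a_t is purely imaginary
  to first order: a_t = i t h^(s+1) / (1 - x) + O(t^2). A formal conjugacy back to the model is sought as
  Psi = (x exp u eta(h), y exp (-u) eta(h)) with real u and eta. This amounts to solving
  b + b o tau_1' = i kappa(h) for b = a_t + u o g_t, and the solution u is the fixed point of a
  contraction in the h-adic topology; division by the small divisors alpha^n - alpha^(-n) costs only
  a factor h^s, since these vanish at h = 0 to order at most s. The coefficients of Psi are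
  polynomials in t of linearly bounded degree.

  The model triple has only linear formal automorphisms, so an analytic equivalence would make
  Psi convergent. If Psi converged for every real t, then by Baire and a Bernstein inequality for
  polynomials its derivative at t = 0 would converge as well. But the coefficient series U(h) of y^n
  in du/dt at t = 0 satisfies (alpha^n - alpha^(-n)) U = 2 i h^(s+1), and alpha^n - alpha^(-n) has a zero
  h \<noteq> 0 tending to 0 as n grows.
\<close>

text \<open>The perturbation must be imaginary: for real a_t the map g_t would commute with rho and
  its inverse would itself be an analytic equivalence. For the same reason u must be real, so the
  components of u at x^n and y^n satisfy one equation together with its conjugate, a linear system
  of determinant alpha^n - alpha^(-n). On powers of h alone a real u reaches only the real part; the
  remaining i kappa(h) is absorbed by eta, because alpha(h eta^2) = alpha(h) exp(i kappa). The
  exponent s + 1 leaves one power of h after the loss of h^s. This gives both the contraction and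
  the bound min(i, j) for the t-degree of the coefficient of x^i y^j. The factor 1 / (1 - x) excites
  every x^n with equal strength, so all the divisors occur. The nonlinear Psi is not explicit, only
  its derivative at t = 0 is; hence divergence is obtained for some t rather than for a prescribed
  one.\<close>

unbundle no vec_syntax
unbundle fps_syntax

section \<open>Formal power series in two variables\<close>

text \<open>The outer index is the exponent of x, the inner one the exponent of y.\<close>

type_synonym ps2 = "complex fps fps"

definition cf :: "ps2 \<Rightarrow> fps2" where "cf F i j = F $ i $ j"
definition PS :: "fps2 \<Rightarrow> ps2" where "PS c = Abs_fps (\<lambda>i. Abs_fps (\<lambda>j. c i j))"

definition cst :: "complex \<Rightarrow> ps2" where "cst c = fps_const (fps_const c)"
definition X2 :: ps2 where "X2 = fps_X"
definition Y2 :: ps2 where "Y2 = fps_const fps_X"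

lemma PS_nth [simp]: "PS c $ i $ j = c i j" by (simp add: PS_def)
lemma cf_PS [simp]: "cf (PS c) = c" by (intro ext) (simp add: cf_def)
lemma PS_cf [simp]: "PS (cf F) = F" by (simp add: PS_def cf_def fps_eq_iff)

lemma ps2_eq_iff: "F = G \<longleftrightarrow> (\<forall>i j. F $ i $ j = G $ i $ j)" for F G :: ps2
  by (simp add: fps_eq_iff)

lemma ps2_mult_nth: "(F * G) $ i $ j = (\<Sum>k\<le>i. \<Sum>l\<le>j. F $ k $ l * G $ (i - k) $ (j - l))" for F G :: ps2
  by (simp add: fps_mult_nth fps_sum_nth atLeast0AtMost)

lemma cf_mult: "cf (F * G) = fmul (cf F) (cf G)"
  by (intro ext) (simp add: cf_def fmul_def ps2_mult_nth)

lemma cf_one: "cf 1 = fone"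
  by (intro ext) (simp add: cf_def fone_def)

lemma cf_power: "cf (F ^ n) = fpow (cf F) n"
  by (induction n) (simp_all add: fpow_def cf_one cf_mult)

lemma cst_nth [simp]: "cst c $ i $ j = (if i = 0 \<and> j = 0 then c else 0)" by (simp add: cst_def)
lemma X2_nth: "X2 $ i $ j = (if i = 1 \<and> j = 0 then 1 else 0)" by (simp add: X2_def fps_X_def)
lemma Y2_nth: "Y2 $ i $ j = (if i = 0 \<and> j = 1 then 1 else 0)" by (simp add: Y2_def fps_X_def)

lemma cst_mult_nth [simp]: "(cst c * F) $ i $ j = c * F $ i $ j"
  by (simp add: cst_def)

lemma cst_add: "cst (a + b) = cst a + cst b" and cst_mult: "cst (a * b) = cst a * cst b"
  and cst_minus: "cst (- a) = - cst a"
  and cst_0 [simp]: "cst 0 = 0" and cst_1 [simp]: "cst 1 = 1"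
  by (simp_all add: cst_def)

lemma cst_power: "cst (a ^ n) = cst a ^ n" by (induction n) (simp_all add: cst_mult)

lemma XY_power_mult_nth:
  "(X2 ^ a * Y2 ^ b * F) $ i $ j = (if a \<le> i \<and> b \<le> j then F $ (i - a) $ (j - b) else 0)"
  by (simp add: X2_def Y2_def mult.assoc fps_X_power_mult_nth fps_const_power)

lemma XY_power_nth: "(X2 ^ a * Y2 ^ b) $ i $ j = (if i = a \<and> j = b then 1 else 0)"
  using XY_power_mult_nth[of a b 1 i j] by auto

text \<open>For w = (+) this is vanishing to total degree n, for w = min divisibility by (xy)^n.\<close>

definition van :: "(nat \<Rightarrow> nat \<Rightarrow> nat) \<Rightarrow> nat \<Rightarrow> ps2 \<Rightarrow> bool" where
  "van w n F \<longleftrightarrow> (\<forall>i j. w i j < n \<longrightarrow> F $ i $ j = 0)"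

definition weight :: "(nat \<Rightarrow> nat \<Rightarrow> nat) \<Rightarrow> bool" where
  "weight w \<longleftrightarrow> (\<forall>i j k l. w i j + w k l \<le> w (i + k) (j + l))"

lemma weight_plus [simp]: "weight (+)" and weight_min [simp]: "weight min"
  by (auto simp: weight_def)

lemma van_0 [simp]: "van w n 0" and van_zero [simp]: "van w 0 F"
  by (auto simp: van_def)

lemma van_add: "van w n F \<Longrightarrow> van w n G \<Longrightarrow> van w n (F + G)"
  and van_diff: "van w n F \<Longrightarrow> van w n G \<Longrightarrow> van w n (F - G)"
  and van_minus: "van w n F \<Longrightarrow> van w n (- F)"
  by (auto simp: van_def)

lemma van_mono: "van w n F \<Longrightarrow> m \<le> n \<Longrightarrow> van w m F"
  by (auto simp: van_def)

lemma van_mult: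
  assumes "weight w" "van w m F" "van w n G"
  shows "van w (m + n) (F * G)"
  unfolding van_def ps2_mult_nth
proof (intro allI impI sum.neutral ballI)
  fix i j k l assume *: "w i j < m + n" "k \<in> {..i}" "l \<in> {..j}"
  then have "w k l + w (i - k) (j - l) \<le> w i j"
    using assms(1)[unfolded weight_def, rule_format, of k l "i - k" "j - l"] by auto
  with * have "w k l < m \<or> w (i - k) (j - l) < n" by linarith
  then show "F $ k $ l * G $ (i - k) $ (j - l) = 0"
    using assms(2,3) by (auto simp: van_def)
qed

lemma van_mult2: "weight w \<Longrightarrow> van w n F \<Longrightarrow> van w n (G * F)"
  using van_mult[of w 0 G n F] by simp

lemma van_mult1: "weight w \<Longrightarrow> van w n F \<Longrightarrow> van w n (F * G)"
  using van_mult[of w n F 0 G] by simp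

lemma van_power:
  assumes "weight w" "van w m F"
  shows "van w (m * n) (F ^ n)"
  using van_mult[OF assms(1) assms(2)] by (induction n) auto

lemma van_all_imp_0: "(\<And>n. van w n F) \<Longrightarrow> F = 0"
  unfolding van_def ps2_eq_iff by (metis fps_zero_nth lessI)

section \<open>Formal substitution as a homomorphism of algebras\<close>

definition sub :: "ps2 \<Rightarrow> ps2 \<Rightarrow> ps2 \<Rightarrow> ps2" where
  "sub F G H = PS (fcomp1 (cf F) (cf G, cf H))"

lemma sub_nth: "sub F G H $ i $ j = (\<Sum>(k,l)\<in>{(k,l). k + l \<le> i + j}. F $ k $ l * (G ^ k * H ^ l) $ i $ j)"
  by (simp add: sub_def fcomp1_def flip: cf_power cf_mult) (simp add: cf_def)

lemma finite_deg_le [simp]: "finite {(k,l). k + l \<le> (n::nat)}"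
  by (rule finite_subset[of _ "{..n} \<times> {..n}"]) auto

abbreviation dv :: "nat \<Rightarrow> ps2 \<Rightarrow> bool" where "dv \<equiv> van (+)"

definition nc :: "ps2 \<Rightarrow> bool" where "nc F \<longleftrightarrow> F $ 0 $ 0 = 0"

lemma nc_iff: "nc F \<longleftrightarrow> dv 1 F"
  by (auto simp: van_def nc_def)

lemma nc_simps [simp]:
  "nc 0" "nc X2" "nc Y2" "nc F \<Longrightarrow> nc G \<Longrightarrow> nc (F + G)" "nc F \<Longrightarrow> nc G \<Longrightarrow> nc (F - G)" "nc F \<Longrightarrow> nc (- F)"
  "nc F \<Longrightarrow> nc (F * G)" "nc G \<Longrightarrow> nc (F * G)" "nc F \<Longrightarrow> 0 < n \<Longrightarrow> nc (F ^ n)"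
  by (auto simp: nc_def X2_nth Y2_nth power_0_left fps_nth_power_0)

lemma dv_power_mult:
  assumes "nc G" "nc H" shows "dv (k + l) (G ^ k * H ^ l)"
  using van_mult[of "(+)" k "G ^ k" l "H ^ l"] van_power[of "(+)" 1 G k] van_power[of "(+)" 1 H l] assms
  by (simp add: nc_iff)

text \<open>The sum in \<open>sub\<close> stops at k + l <= i + j, which is genuine composition when
  the inner series have no constant term (\<open>nc\<close>): then G^k H^l starts in degree k + l.
  Enlarging the range puts a given monomial inside it, as \<open>sub_monom\<close> needs.\<close>

lemma sub_nth_le:
  assumes "nc G" "nc H" "i + j \<le> N"
  shows "sub F G H $ i $ j = (\<Sum>(k,l)\<in>{(k,l). k + l \<le> N}. F $ k $ l * (G ^ k * H ^ l) $ i $ j)"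
proof -
  have "(\<Sum>(k,l)\<in>{(k,l). k + l \<le> N}. F $ k $ l * (G ^ k * H ^ l) $ i $ j) =
        (\<Sum>(k,l)\<in>{(k,l). k + l \<le> i + j}. F $ k $ l * (G ^ k * H ^ l) $ i $ j)"
    using assms(3) dv_power_mult[OF assms(1,2), unfolded van_def, rule_format, of i j]
    by (intro sum.mono_neutral_right) (auto, meson not_le)
  then show ?thesis by (simp add: sub_nth)
qed

lemma sub_add: "sub (F + F') G H = sub F G H + sub F' G H"
  and sub_diff: "sub (F - F') G H = sub F G H - sub F' G H"
  and sub_minus: "sub (- F) G H = - sub F G H"
  and sub_0 [simp]: "sub 0 G H = 0"
  by (auto simp: ps2_eq_iff sub_nth algebra_simps sum.distrib case_prod_unfold sum_subtractf sum_negf)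

lemma sub_sum: "sub (sum f A) G H = (\<Sum>x\<in>A. sub (f x) G H)"
  by (induction A rule: infinite_finite_induct) (simp_all add: sub_add)

lemma sub_monom:
  assumes "nc G" "nc H"
  shows "sub (cst c * (X2 ^ a * Y2 ^ b)) G H = cst c * (G ^ a * H ^ b)"
proof -
  have "sub (cst c * (X2 ^ a * Y2 ^ b)) G H $ i $ j = (cst c * (G ^ a * H ^ b)) $ i $ j" for i j
  proof -
    have "sub (cst c * (X2 ^ a * Y2 ^ b)) G H $ i $ j =
      (\<Sum>(k,l)\<in>{(k,l). k + l \<le> i + j + a + b}. (if (k, l) = (a, b) then c else 0) * (G ^ k * H ^ l) $ i $ j)"
      using assms by (subst sub_nth_le[where N = "i + j + a + b"]) (auto simp: XY_power_nth intro!: sum.cong)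
    also have "\<dots> = (\<Sum>p\<in>{(k,l). k + l \<le> i + j + a + b}. if p = (a, b) then c * (G ^ a * H ^ b) $ i $ j else 0)"
      by (intro sum.cong) (auto split: if_splits)
    also have "\<dots> = c * (G ^ a * H ^ b) $ i $ j" by (subst sum.delta) auto
    finally show ?thesis by simp
  qed
  then show ?thesis by (simp add: ps2_eq_iff)
qed

definition trunc :: "nat \<Rightarrow> ps2 \<Rightarrow> ps2" where
  "trunc N F = (\<Sum>(k,l)\<in>{(k,l). k + l \<le> N}. cst (F $ k $ l) * (X2 ^ k * Y2 ^ l))"

lemma ps2_sum_nth: "sum f A $ i $ j = (\<Sum>x\<in>A. f x $ i $ j)" for f :: "'a \<Rightarrow> ps2"
  by (simp add: fps_sum_nth)

lemma trunc_nth: "trunc N F $ i $ j = (if i + j \<le> N then F $ i $ j else 0)"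
proof -
  have "trunc N F $ i $ j = (\<Sum>p\<in>{(k,l). k + l \<le> N}. if p = (i, j) then F $ i $ j else 0)"
    unfolding trunc_def ps2_sum_nth by (intro sum.cong) (auto simp: XY_power_nth split: if_splits)
  also have "\<dots> = (if i + j \<le> N then F $ i $ j else 0)" by (subst sum.delta) auto
  finally show ?thesis .
qed

lemma dv_trunc: "dv (Suc N) (F - trunc N F)"
  by (auto simp: van_def trunc_nth)

lemma sub_trunc:
  assumes "nc G" "nc H"
  shows "sub (trunc N F) G H = (\<Sum>(k,l)\<in>{(k,l). k + l \<le> N}. cst (F $ k $ l) * (G ^ k * H ^ l))"
  unfolding trunc_def sub_sum using sub_monom[OF assms] by (intro sum.cong) auto

lemma dv_sub:
  assumes "nc G" "nc H" "dv n F" shows "dv n (sub F G H)"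
  unfolding van_def sub_nth
proof (intro allI impI sum.neutral, clarify)
  fix i j k l assume "i + j < n" "k + l \<le> i + j"
  then show "F $ k $ l * (G ^ k * H ^ l) $ i $ j = 0" using assms(3) by (auto simp: van_def)
qed

lemma nc_sub [simp]: "nc F \<Longrightarrow> nc (sub F G H)"
  by (simp add: nc_def sub_nth fps_nth_power_0 case_prod_unfold)

lemma dv_eqI:
  assumes "\<And>N. dv (Suc N) (F - G)" shows "F = G"
proof -
  have "dv n (F - G)" for n using assms[of n] by (rule van_mono) auto
  then show ?thesis using van_all_imp_0[of "(+)" "F - G"] by auto
qed

text \<open>For polynomials bilinearity reduces this to monomials. Replacing F and F' by truncations
  changes both sides only in degrees above N, and N is arbitrary. \<open>sub_assoc\<close> and
  \<open>sub_XY\<close> follow the same scheme.\<close>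

lemma sub_mult:
  assumes G: "nc G" "nc H"
  shows "sub (F * F') G H = sub F G H * sub F' G H"
proof (rule dv_eqI)
  fix N
  let ?T = "trunc N"
  have 1: "sub (?T F * ?T F') G H = sub (?T F) G H * sub (?T F') G H"
  proof -
    have "sub (?T F * ?T F') G H = (\<Sum>(k,l)\<in>{(k,l). k + l \<le> N}. \<Sum>(k',l')\<in>{(k,l). k + l \<le> N}.
        sub (cst (F $ k $ l * F' $ k' $ l') * (X2 ^ (k + k') * Y2 ^ (l + l'))) G H)"
      unfolding trunc_def sum_product sub_sum
      by (intro sum.cong) (auto simp: cst_mult power_add algebra_simps sub_sum case_prod_unfold)
    also have "\<dots> = sub (?T F) G H * sub (?T F') G H"
      unfolding sub_trunc[OF G] sum_product sub_monom[OF G]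
      by (intro sum.cong) (auto simp: cst_mult power_add algebra_simps sub_sum case_prod_unfold)
    finally show ?thesis .
  qed
  have "F * F' - ?T F * ?T F' = F * (F' - ?T F') + (F - ?T F) * ?T F'" by (simp add: algebra_simps)
  then have 2: "dv (Suc N) (F * F' - ?T F * ?T F')"
    by (simp add: van_add van_mult1 van_mult2 dv_trunc)
  have "sub (F * F') G H - sub F G H * sub F' G H =
    sub (F * F' - ?T F * ?T F') G H - sub F G H * sub (F' - ?T F') G H - sub (F - ?T F) G H * sub (?T F') G H"
    by (simp add: sub_diff 1 algebra_simps)
  then show "dv (Suc N) (sub (F * F') G H - sub F G H * sub F' G H)"
    by (simp add: van_diff dv_sub[OF G] 2 van_mult1 van_mult2 dv_trunc)
qed

lemma sub_cst [simp]: "nc G \<Longrightarrow> nc H \<Longrightarrow> sub (cst c) G H = cst c"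
  using sub_monom[of G H c 0 0] by simp

lemma sub_one [simp]: "nc G \<Longrightarrow> nc H \<Longrightarrow> sub 1 G H = 1"
  using sub_cst[of G H 1] by simp

lemma sub_X2 [simp]: "nc G \<Longrightarrow> nc H \<Longrightarrow> sub X2 G H = G"
  using sub_monom[of G H 1 1 0] by simp

lemma sub_Y2 [simp]: "nc G \<Longrightarrow> nc H \<Longrightarrow> sub Y2 G H = H"
  using sub_monom[of G H 1 0 1] by simp

lemma sub_power: "nc G \<Longrightarrow> nc H \<Longrightarrow> sub (F ^ n) G H = sub F G H ^ n"
  by (induction n) (simp_all add: sub_mult)

lemma sub_assoc:
  assumes G: "nc G" "nc G'" and H: "nc H" "nc H'"
  shows "sub (sub F G G') H H' = sub F (sub G H H') (sub G' H H')"
proof (rule dv_eqI)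
  fix N
  have K: "nc (sub G H H')" "nc (sub G' H H')" by (simp_all add: assms)
  have 1: "sub (sub (trunc N F) G G') H H' = sub (trunc N F) (sub G H H') (sub G' H H')"
    unfolding sub_trunc[OF G] sub_trunc[OF K] sub_sum
    by (intro sum.cong) (auto simp: sub_mult[OF H] sub_power[OF H] sub_cst[OF H])
  have "sub (sub F G G') H H' - sub F (sub G H H') (sub G' H H') =
    sub (sub (F - trunc N F) G G') H H' - sub (F - trunc N F) (sub G H H') (sub G' H H')"
    by (simp add: sub_diff 1)
  then show "dv (Suc N) (sub (sub F G G') H H' - sub F (sub G H H') (sub G' H H'))"
    by (simp add: van_diff dv_sub G H K dv_trunc)
qed

lemma sub_XY [simp]: "sub F X2 Y2 = F"
proof (rule dv_eqI)
  fix N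
  have "sub (trunc N F) X2 Y2 = trunc N F" by (simp add: sub_trunc) (simp add: trunc_def)
  then have "sub F X2 Y2 - F = sub (F - trunc N F) X2 Y2 - (F - trunc N F)" by (simp add: sub_diff)
  then show "dv (Suc N) (sub F X2 Y2 - F)" by (simp only: van_diff dv_sub dv_trunc nc_simps)
qed

text \<open>Banach's fixed point theorem for the filtration by w. It serves twice: with w = min for
  the conjugacy, and with w = (+) to invert a substitution tangent to the identity. The
  approximation property transfers to u what is known about the iterates of 0.\<close>

lemma contraction_fixpoint:
  assumes T: "\<And>u v k. van w k (u - v) \<Longrightarrow> van w (Suc k) (T u - T v)"
  obtains u where "u = T u" "\<And>N. van w N (u - (T ^^ N) 0)"
proof -
  have step: "van w N ((T ^^ Suc N) 0 - (T ^^ N) 0)" for N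
    by (induction N) (auto intro: T)
  have step': "van w N ((T ^^ (N + k)) 0 - (T ^^ N) 0)" for N k
  proof (induction k)
    case (Suc k)
    have "(T ^^ (N + Suc k)) 0 - (T ^^ N) 0 =
      ((T ^^ Suc (N + k)) 0 - (T ^^ (N + k)) 0) + ((T ^^ (N + k)) 0 - (T ^^ N) 0)" by simp
    then show ?case using Suc van_add[OF van_mono[OF step[of "N + k"]]] by (metis le_add1)
  qed auto
  \<comment> \<open>A coefficient of weight w i j no longer changes after w i j + 1 iterations, so
    the limit is read off coefficientwise, even for w = min, where infinitely many coefficients
    share a weight.\<close>
  define u where "u = PS (\<lambda>i j. (T ^^ Suc (w i j)) 0 $ i $ j)"
  have u: "van w N (u - (T ^^ N) 0)" for N
    unfolding van_def
  proof (intro allI impI)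
    fix i j assume "w i j < N"
    then show "(u - (T ^^ N) 0) $ i $ j = 0"
      using step'[of "Suc (w i j)" "N - Suc (w i j)"] by (auto simp: van_def u_def)
  qed
  have "van w N (u - T u)" for N
  proof -
    have "u - T u = (u - (T ^^ Suc N) 0) - (T u - T ((T ^^ N) 0))" by simp
    moreover have "van w N (T u - T ((T ^^ N) 0))" using T[OF u[of N]] van_mono le_SucI order_refl by blast
    moreover have "van w N (u - (T ^^ Suc N) 0)" using u van_mono le_SucI order_refl by blast
    ultimately show ?thesis by (metis van_diff)
  qed
  then have "u = T u" using van_all_imp_0[of w "u - T u"] by simp
  with u show ?thesis using that by blast
qed

section \<open>Convergence\<close>

lemma has_sum_Times_mult:
  fixes f :: "'a \<Rightarrow> 'c::{banach,real_normed_field}" and g :: "'b \<Rightarrow> 'c"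
  assumes f: "(\<lambda>x. norm (f x)) summable_on A" and g: "(\<lambda>x. norm (g x)) summable_on B"
  shows "((\<lambda>(x,y). f x * g y) has_sum (infsum f A * infsum g B)) (A \<times> B)"
proof (rule has_sum_SigmaI)
  show "((\<lambda>y. case (x, y) of (x, y) \<Rightarrow> f x * g y) has_sum (f x * infsum g B)) B" for x
    using abs_summable_summable[OF g] by (auto intro!: has_sum_cmult_right has_sum_infsum)
  show "((\<lambda>x. f x * infsum g B) has_sum (infsum f A * infsum g B)) A"
    using abs_summable_summable[OF f] by (auto intro!: has_sum_cmult_left has_sum_infsum)
  have "(\<lambda>p. norm (case p of (x, y) \<Rightarrow> f x * g y)) summable_on (A \<times> B)"
  proof (rule summable_on_SigmaI)
    show "((\<lambda>y. norm (case (x, y) of (x, y) \<Rightarrow> f x * g y)) has_sum (norm (f x) * infsum (\<lambda>y. norm (g y)) B)) B" for x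
      using g by (auto simp: norm_mult intro!: has_sum_cmult_right has_sum_infsum)
    show "(\<lambda>x. norm (f x) * infsum (\<lambda>y. norm (g y)) B) summable_on A"
      using f by (rule summable_on_cmult_left)
  qed auto
  then show "(\<lambda>(x,y). f x * g y) summable_on (A \<times> B)" by (rule abs_summable_summable)
qed

lemma has_sum_Cauchy_product2:
  fixes f g :: "nat \<times> nat \<Rightarrow> 'c::{banach,real_normed_field}"
  assumes f: "(\<lambda>x. norm (f x)) summable_on UNIV" and g: "(\<lambda>x. norm (g x)) summable_on UNIV"
  shows "((\<lambda>(i,j). \<Sum>k\<le>i. \<Sum>l\<le>j. f (k,l) * g (i - k, j - l)) has_sum (infsum f UNIV * infsum g UNIV)) UNIV"
proof -
  let ?S = "Sigma UNIV (\<lambda>(i,j). {..i} \<times> {..j})"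
  have "((\<lambda>((i,j),(k,l)). f (k,l) * g (i - k, j - l)) has_sum (infsum f UNIV * infsum g UNIV)) ?S
    \<longleftrightarrow> ((\<lambda>(x,y). f x * g y) has_sum (infsum f UNIV * infsum g UNIV)) (UNIV \<times> UNIV)"
    by (rule has_sum_reindex_bij_witness[where j = "\<lambda>((i,j),(k,l)). ((k,l),(i - k, j - l))"
          and i = "\<lambda>((k,l),(a,b)). ((k + a, l + b), (k,l))"]) auto
  with has_sum_Times_mult[OF f g]
  have *: "((\<lambda>((i,j),(k,l)). f (k,l) * g (i - k, j - l)) has_sum (infsum f UNIV * infsum g UNIV)) ?S" by simp
  show ?thesis
    by (rule has_sum_SigmaD[OF *]) (auto simp: sum.cartesian_product intro!: has_sum_finiteI)
qed

text \<open>Absolute convergence at the corner (r, r) of a polydisc; \<open>nrm\<close> is the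
  corresponding weighted l1 norm. It is submultiplicative, so compositions can be estimated term by
  term.\<close>

definition absc :: "real \<Rightarrow> ps2 \<Rightarrow> bool" where
  "absc r F \<longleftrightarrow> (\<lambda>(i,j). norm (F $ i $ j) * r ^ (i + j)) summable_on UNIV"

definition nrm :: "real \<Rightarrow> ps2 \<Rightarrow> real" where
  "nrm r F = infsum (\<lambda>(i,j). norm (F $ i $ j) * r ^ (i + j)) UNIV"

definition val :: "ps2 \<Rightarrow> complex \<Rightarrow> complex \<Rightarrow> complex" where
  "val F x y = infsum (\<lambda>(i,j). F $ i $ j * (x ^ i * y ^ j)) UNIV"

lemma absc_norm_term:
  fixes F :: ps2
  assumes "norm x \<le> r" "norm y \<le> r"
  shows "norm (F $ i $ j * (x ^ i * y ^ j)) \<le> norm (F $ i $ j) * r ^ (i + j)"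
proof -
  have "0 \<le> r" using assms(1) norm_ge_zero order_trans by blast
  then show ?thesis
    using assms by (auto simp: norm_mult norm_power power_add intro!: mult_left_mono mult_mono power_mono)
qed

lemma absc_summable:
  assumes "absc r F" "norm x \<le> r" "norm y \<le> r"
  shows "(\<lambda>(i,j). norm (F $ i $ j * (x ^ i * y ^ j))) summable_on UNIV"
  using Infinite_Sum.abs_summable_on_comparison_test'[OF assms(1)[unfolded absc_def], of "\<lambda>(i,j). F $ i $ j * (x ^ i * y ^ j)"]
    absc_norm_term[OF assms(2,3)] by (auto simp: case_prod_unfold)

lemma absc_has_sum:
  assumes "absc r F" "norm x \<le> r" "norm y \<le> r"
  shows "((\<lambda>(i,j). F $ i $ j * (x ^ i * y ^ j)) has_sum val F x y) UNIV"
  unfolding val_def using absc_summable[OF assms]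
  by (rule_tac has_sum_infsum, rule_tac abs_summable_summable) (simp add: case_prod_unfold)

lemma absc_mono: "absc r F \<Longrightarrow> 0 \<le> q \<Longrightarrow> q \<le> r \<Longrightarrow> absc q F"
  unfolding absc_def
  by (rule summable_on_comparison_test) (auto intro!: mult_left_mono power_mono)

lemma nrm_nonneg: "0 \<le> r \<Longrightarrow> 0 \<le> nrm r F"
  unfolding nrm_def by (intro infsum_nonneg) auto

lemma norm_val_le:
  assumes "absc r F" "norm x \<le> r" "norm y \<le> r"
  shows "norm (val F x y) \<le> nrm r F"
proof -
  have "norm (val F x y) \<le> infsum (\<lambda>p. norm (case p of (i,j) \<Rightarrow> F $ i $ j * (x ^ i * y ^ j))) UNIV"
    unfolding val_def using absc_summable[OF assms] by (intro norm_infsum_bound) (simp add: case_prod_unfold)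
  also have "\<dots> \<le> nrm r F"
    unfolding nrm_def using absc_summable[OF assms] assms(1)[unfolded absc_def] absc_norm_term[OF assms(2,3)]
    by (intro infsum_mono) (auto simp: case_prod_unfold)
  finally show ?thesis .
qed

lemma absc_mult:
  assumes F: "absc r F" and G: "absc r G" and r: "0 \<le> r"
  shows "absc r (F * G)" "nrm r (F * G) \<le> nrm r F * nrm r G"
proof -
  let ?f = "\<lambda>(i,j). norm (F $ i $ j) * r ^ (i + j)"
  let ?g = "\<lambda>(i,j). norm (G $ i $ j) * r ^ (i + j)"
  have 1: "((\<lambda>(i,j). \<Sum>k\<le>i. \<Sum>l\<le>j. ?f (k,l) * ?g (i - k, j - l)) has_sum (infsum ?f UNIV * infsum ?g UNIV)) UNIV"
    using F G r unfolding absc_def by (intro has_sum_Cauchy_product2) (simp_all add: case_prod_unfold)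
  have le: "norm ((F * G) $ i $ j) * r ^ (i + j) \<le> (\<Sum>k\<le>i. \<Sum>l\<le>j. ?f (k,l) * ?g (i - k, j - l))" for i j
  proof -
    have "norm ((F * G) $ i $ j) * r ^ (i + j) \<le>
        (\<Sum>k\<le>i. \<Sum>l\<le>j. norm (F $ k $ l * G $ (i - k) $ (j - l))) * r ^ (i + j)"
      unfolding ps2_mult_nth using r by (intro mult_right_mono order_trans[OF norm_sum] sum_mono norm_sum) auto
    also have "\<dots> = (\<Sum>k\<le>i. \<Sum>l\<le>j. ?f (k,l) * ?g (i - k, j - l))"
      unfolding sum_distrib_right
    proof (intro sum.cong refl)
      fix k l assume "k \<in> {..i}" "l \<in> {..j}"
      then have "i + j = (k + l) + (i - k + (j - l))" by auto
      then have e: "r ^ (i + j) = r ^ (k + l) * r ^ (i - k + (j - l))" by (simp only: power_add)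
      show "norm (F $ k $ l * G $ (i - k) $ (j - l)) * r ^ (i + j) = ?f (k,l) * ?g (i - k, j - l)"
        unfolding e norm_mult by simp
    qed
    finally show ?thesis .
  qed
  show A: "absc r (F * G)" unfolding absc_def
    by (rule summable_on_comparison_test[OF has_sum_imp_summable[OF 1]]) (use le r in auto)
  show "nrm r (F * G) \<le> nrm r F * nrm r G"
    unfolding nrm_def infsumI[OF 1, symmetric]
    by (rule infsum_mono) (use A has_sum_imp_summable[OF 1] le in \<open>auto simp: absc_def\<close>)
qed

lemma val_mult:
  assumes F: "absc r F" and G: "absc r G" and xy: "norm x \<le> r" "norm y \<le> r"
  shows "val (F * G) x y = val F x y * val G x y"
proof -
  let ?f = "\<lambda>(i,j). F $ i $ j * (x ^ i * y ^ j)"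
  let ?g = "\<lambda>(i,j). G $ i $ j * (x ^ i * y ^ j)"
  have "((\<lambda>(i,j). \<Sum>k\<le>i. \<Sum>l\<le>j. ?f (k,l) * ?g (i - k, j - l)) has_sum (infsum ?f UNIV * infsum ?g UNIV)) UNIV"
    using absc_summable[OF F xy] absc_summable[OF G xy]
    by (intro has_sum_Cauchy_product2) (simp_all add: case_prod_unfold)
  also have "(\<lambda>(i,j). \<Sum>k\<le>i. \<Sum>l\<le>j. ?f (k,l) * ?g (i - k, j - l)) = (\<lambda>(i,j). (F * G) $ i $ j * (x ^ i * y ^ j))"
  proof (rule ext)
    fix p :: "nat \<times> nat"
    obtain i j where p: "p = (i, j)" by fastforce
    have "(\<Sum>k\<le>i. \<Sum>l\<le>j. ?f (k,l) * ?g (i - k, j - l)) =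
      (\<Sum>k\<le>i. \<Sum>l\<le>j. F $ k $ l * G $ (i - k) $ (j - l) * (x ^ i * y ^ j))"
    proof (intro sum.cong refl)
      fix k l assume "k \<in> {..i}" "l \<in> {..j}"
      then have "x ^ i = x ^ k * x ^ (i - k)" "y ^ j = y ^ l * y ^ (j - l)"
        by (simp_all flip: power_add)
      then show "?f (k,l) * ?g (i - k, j - l) = F $ k $ l * G $ (i - k) $ (j - l) * (x ^ i * y ^ j)"
        by (simp add: algebra_simps)
    qed
    then show "(case p of (i,j) \<Rightarrow> \<Sum>k\<le>i. \<Sum>l\<le>j. ?f (k,l) * ?g (i - k, j - l)) = (case p of (i,j) \<Rightarrow> (F * G) $ i $ j * (x ^ i * y ^ j))"
      by (simp add: p ps2_mult_nth sum_distrib_right)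
  qed
  finally show ?thesis unfolding val_def by (simp add: infsumI)
qed

lemma absc_add:
  assumes "absc r F" "absc r G" "0 \<le> r" shows "absc r (F + G)"
  unfolding absc_def
proof (rule summable_on_comparison_test)
  show "(\<lambda>p. (case p of (i,j) \<Rightarrow> norm (F $ i $ j) * r ^ (i + j)) + (case p of (i,j) \<Rightarrow> norm (G $ i $ j) * r ^ (i + j))) summable_on UNIV"
    using assms(1,2) unfolding absc_def by (rule summable_on_add)
  fix p :: "nat \<times> nat"
  obtain i j where p: "p = (i, j)" by fastforce
  have "norm ((F + G) $ i $ j) * r ^ (i + j) \<le> (norm (F $ i $ j) + norm (G $ i $ j)) * r ^ (i + j)"
    using assms(3) by (intro mult_right_mono) (auto intro: norm_triangle_ineq)
  then show "(case p of (i,j) \<Rightarrow> norm ((F + G) $ i $ j) * r ^ (i + j)) \<le>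
      (case p of (i,j) \<Rightarrow> norm (F $ i $ j) * r ^ (i + j)) + (case p of (i,j) \<Rightarrow> norm (G $ i $ j) * r ^ (i + j))"
    by (simp add: p distrib_right)
qed (use assms(3) in auto)

lemma val_add:
  assumes "absc r F" "absc r G" "norm x \<le> r" "norm y \<le> r"
  shows "val (F + G) x y = val F x y + val G x y"
proof -
  have "((\<lambda>p. (case p of (i,j) \<Rightarrow> F $ i $ j * (x ^ i * y ^ j)) + (case p of (i,j) \<Rightarrow> G $ i $ j * (x ^ i * y ^ j))) has_sum
     (val F x y + val G x y)) UNIV"
    using assms by (intro has_sum_add absc_has_sum)
  then show ?thesis unfolding val_def[of "F + G"]
    by (intro infsumI) (simp add: case_prod_unfold algebra_simps)
qed

lemma infsum_single2:
  fixes f :: "nat \<times> nat \<Rightarrow> 'a :: {topological_comm_monoid_add,t2_space}"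
  assumes "\<And>i j. (i, j) \<noteq> (a, b) \<Longrightarrow> f (i, j) = 0"
  shows "f summable_on UNIV" "infsum f UNIV = f (a, b)"
proof -
  have "(f has_sum f (a, b)) UNIV"
  proof -
    have "(f has_sum f (a, b)) {(a, b)}" by (rule has_sum_finiteI) auto
    then show ?thesis by (rule has_sum_cong_neutral[THEN iffD1, rotated -1]) (use assms in auto)
  qed
  then show "f summable_on UNIV" "infsum f UNIV = f (a, b)"
    by (auto intro: has_sum_imp_summable infsumI)
qed

lemma absc_monom: "absc r (cst c * (X2 ^ a * Y2 ^ b))"
  unfolding absc_def by (rule infsum_single2[of a b]) (auto simp: XY_power_nth)

lemma val_monom: "val (cst c * (X2 ^ a * Y2 ^ b)) x y = c * (x ^ a * y ^ b)"
  unfolding val_def by (subst infsum_single2[of a b]) (auto simp: XY_power_nth)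

lemma absc_cst [simp]: "absc r (cst c)" and absc_one [simp]: "absc r 1" and absc_X2 [simp]: "absc r X2" and absc_Y2 [simp]: "absc r Y2"
  using absc_monom[of r c 0 0] absc_monom[of r 1 0 0] absc_monom[of r 1 1 0] absc_monom[of r 1 0 1] by simp_all

lemma val_cst [simp]: "val (cst c) x y = c" and val_one [simp]: "val 1 x y = 1" and val_X2 [simp]: "val X2 x y = x"
  and val_Y2 [simp]: "val Y2 x y = y"
  using val_monom[of c 0 0] val_monom[of 1 0 0] val_monom[of 1 1 0] val_monom[of 1 0 1] by simp_all

lemma nrm_one [simp]: "nrm r 1 = 1"
  unfolding nrm_def by (subst infsum_single2[of 0 0]) auto

lemma absc_power:
  assumes "absc r F" "0 \<le> r" shows "absc r (F ^ n)" "nrm r (F ^ n) \<le> nrm r F ^ n"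
proof -
  have "absc r (F ^ n) \<and> nrm r (F ^ n) \<le> nrm r F ^ n"
  proof (induction n)
    case (Suc n)
    then have "nrm r F * nrm r (F ^ n) \<le> nrm r F * nrm r F ^ n"
      by (intro mult_left_mono nrm_nonneg assms(2)) auto
    with Suc show ?case using absc_mult[OF assms(1) _ assms(2), of "F ^ n"] by auto
  qed simp
  then show "absc r (F ^ n)" "nrm r (F ^ n) \<le> nrm r F ^ n" by auto
qed

lemma val_power:
  assumes "absc r F" "norm x \<le> r" "norm y \<le> r" shows "val (F ^ n) x y = val F x y ^ n"
proof (induction n)
  case (Suc n)
  have "0 \<le> r" using assms(2) norm_ge_zero order_trans by blast
  then show ?case using Suc val_mult[OF assms(1) absc_power(1)[OF assms(1)] assms(2,3)] by simp
qed simp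

lemma absc_coeff_le:
  assumes "absc r F" "0 \<le> r" shows "norm (F $ i $ j) * r ^ (i + j) \<le> nrm r F"
proof -
  have "infsum (\<lambda>(i,j). norm (F $ i $ j) * r ^ (i + j)) {(i,j)} \<le> nrm r F"
    unfolding nrm_def using assms
    by (intro infsum_mono2) (auto simp: absc_def)
  then show ?thesis by simp
qed

text \<open>The family F_kl (G^k H^l)_ij is absolutely summable because the norm of G^k H^l is at
  most R^(k + l). Summing over (k, l) first gives the coefficients of the composition, summing over
  (i, j) first gives F at the values of G and H.\<close>

lemma absc_sub:
  assumes G: "absc r G" "nc G" and H: "absc r H" "nc H" and r: "0 \<le> r"
    and F: "absc R F" and R: "nrm r G \<le> R" "nrm r H \<le> R"
  shows "absc r (sub F G H)"
    and "norm x \<le> r \<Longrightarrow> norm y \<le> r \<Longrightarrow> val (sub F G H) x y = val F (val G x y) (val H x y)"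
proof -
  have R0: "0 \<le> R" using R(1) nrm_nonneg[OF r, of G] by linarith
  let ?M = "\<lambda>k l. G ^ k * H ^ l"
  have M: "absc r (?M k l)" "nrm r (?M k l) \<le> R ^ (k + l)" for k l
  proof -
    note GH = absc_power[OF G(1) r, of k] absc_power[OF H(1) r, of l]
    show "absc r (?M k l)" by (intro absc_mult(1) GH r)
    have "nrm r (?M k l) \<le> nrm r (G ^ k) * nrm r (H ^ l)" by (intro absc_mult(2) GH r)
    also have "\<dots> \<le> R ^ k * R ^ l"
      using R0 R nrm_nonneg[OF r] by (intro mult_mono order_trans[OF GH(2)] order_trans[OF GH(4)] power_mono) auto
    finally show "nrm r (?M k l) \<le> R ^ (k + l)" by (simp add: power_add)
  qed
  let ?N = "\<lambda>((k,l),(i,j)). norm (F $ k $ l) * (norm (?M k l $ i $ j) * r ^ (i + j))"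
  have N: "?N summable_on UNIV \<times> UNIV"
  proof (rule summable_on_SigmaI)
    show "((\<lambda>q. ?N (p, q)) has_sum (case p of (k,l) \<Rightarrow> norm (F $ k $ l) * nrm r (?M k l))) UNIV" for p
    proof (cases p)
      case (Pair k l)
      have "((\<lambda>(i,j). norm (?M k l $ i $ j) * r ^ (i + j)) has_sum nrm r (?M k l)) UNIV"
        using M(1)[of k l] unfolding nrm_def absc_def by (rule has_sum_infsum)
      from has_sum_cmult_right[OF this, of "norm (F $ k $ l)"] show ?thesis
        unfolding Pair by (simp add: case_prod_unfold)
    qed
    show "(\<lambda>p. case p of (k,l) \<Rightarrow> norm (F $ k $ l) * nrm r (?M k l)) summable_on UNIV"
      by (rule summable_on_comparison_test[OF F[unfolded absc_def]])
         (use M(2) nrm_nonneg[OF r] in \<open>auto intro!: mult_left_mono\<close>)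
  qed (use r in auto)
  have N2: "(\<lambda>((i,j),(k,l)). norm (F $ k $ l) * (norm (?M k l $ i $ j) * r ^ (i + j))) summable_on UNIV \<times> UNIV"
    using N by (subst summable_on_swap) (simp add: case_prod_unfold)
  have fin: "((\<lambda>(k,l). F $ k $ l * ?M k l $ i $ j * c) has_sum (sub F G H $ i $ j * c)) UNIV" for i j c
  proof -
    have "((\<lambda>(k,l). F $ k $ l * ?M k l $ i $ j * c) has_sum (sub F G H $ i $ j * c)) {(k,l). k + l \<le> i + j}"
      by (rule has_sum_finiteI) (simp_all add: sub_nth sum_distrib_right split_def, simp add: finite_deg_le[unfolded split_def])
    moreover have "?M k l $ i $ j = 0" if "\<not> k + l \<le> i + j" for k l
      using dv_power_mult[OF G(2) H(2), of k l] that unfolding van_def by (meson not_le)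
    ultimately show ?thesis
      by (rule_tac has_sum_cong_neutral[THEN iffD1, rotated -1]) (auto, meson)
  qed
  show *: "absc r (sub F G H)"
    unfolding absc_def
  proof (rule summable_on_comparison_test)
    let ?I = "\<lambda>p. infsum (\<lambda>q. case (p, q) of ((i,j),(k,l)) \<Rightarrow> norm (F $ k $ l) * (norm (?M k l $ i $ j) * r ^ (i + j))) UNIV"
    show "?I summable_on UNIV"
      using summable_on_Sigma_banach[OF N2] by (simp add: case_prod_unfold)
    fix p :: "nat \<times> nat"
    obtain i j where p: "p = (i,j)" by fastforce
    have s: "(\<lambda>(k,l). norm (F $ k $ l) * (norm (?M k l $ i $ j) * r ^ (i + j))) summable_on UNIV"
      using summable_on_SigmaD1[of "\<lambda>p q. case (p, q) of ((i,j),(k,l)) \<Rightarrow> norm (F $ k $ l) * (norm (?M k l $ i $ j) * r ^ (i + j))" UNIV "\<lambda>_. UNIV" "(i,j)"] N2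
      by (simp add: case_prod_unfold)
    have "norm (sub F G H $ i $ j) * r ^ (i + j) = norm (infsum (\<lambda>(k,l). F $ k $ l * ?M k l $ i $ j * of_real (r ^ (i + j))) UNIV)"
      using infsumI[OF fin[of i j "of_real (r ^ (i + j))"]] r by (simp add: norm_mult norm_power)
    also have "\<dots> \<le> infsum (\<lambda>q. norm (case q of (k,l) \<Rightarrow> F $ k $ l * ?M k l $ i $ j * of_real (r ^ (i + j)))) UNIV"
      using s r by (intro norm_infsum_bound) (simp add: case_prod_unfold norm_mult norm_power mult.assoc)
    also have "\<dots> = ?I p" using r by (simp add: p case_prod_unfold norm_mult norm_power mult.assoc)
    finally show "(case p of (i,j) \<Rightarrow> norm (sub F G H $ i $ j) * r ^ (i + j)) \<le> ?I p" by (simp add: p)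
    show "0 \<le> (case p of (i,j) \<Rightarrow> norm (sub F G H $ i $ j) * r ^ (i + j))" using r by (simp add: p)
  qed
  assume xy: "norm x \<le> r" "norm y \<le> r"
  let ?T = "\<lambda>((k,l),(i,j)). F $ k $ l * (?M k l $ i $ j * (x ^ i * y ^ j))"
  have T: "?T summable_on UNIV \<times> UNIV"
  proof (rule abs_summable_summable, rule Infinite_Sum.abs_summable_on_comparison_test'[OF N], clarify)
    fix k l i j :: nat
    show "norm (F $ k $ l * (?M k l $ i $ j * (x ^ i * y ^ j))) \<le> norm (F $ k $ l) * (norm (?M k l $ i $ j) * r ^ (i + j))"
      using absc_norm_term[OF xy] unfolding norm_mult[of "F $ k $ l"] by (intro mult_left_mono) auto
  qed
  have v: "norm (val G x y) \<le> R" "norm (val H x y) \<le> R"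
    using norm_val_le[OF G(1) xy] norm_val_le[OF H(1) xy] R by auto
  have T1: "(?T has_sum val F (val G x y) (val H x y)) (UNIV \<times> UNIV)"
  proof (rule has_sum_SigmaI[OF _ absc_has_sum[OF F v] T])
    fix p :: "nat \<times> nat"
    obtain k l where p: "p = (k, l)" by fastforce
    have "val (?M k l) x y = val G x y ^ k * val H x y ^ l"
      using val_mult[OF absc_power(1) absc_power(1) xy, OF G(1) r H(1) r] val_power[OF G(1) xy] val_power[OF H(1) xy] by simp
    then show "((\<lambda>q. ?T (p, q)) has_sum (case p of (k, l) \<Rightarrow> F $ k $ l * (val G x y ^ k * val H x y ^ l))) UNIV"
      using has_sum_cmult_right[OF absc_has_sum[OF M(1)[of k l] xy], of "F $ k $ l"]
      unfolding p by (simp add: split_def)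
  qed
  have "((\<lambda>((i,j),(k,l)). F $ k $ l * ?M k l $ i $ j * (x ^ i * y ^ j)) has_sum val F (val G x y) (val H x y)) (UNIV \<times> UNIV)"
    using T1 by (rule has_sum_reindex_bij_witness[where i = prod.swap and j = prod.swap, THEN iffD1, rotated -1])
      (auto simp: mult.assoc)
  then have "((\<lambda>(i,j). sub F G H $ i $ j * (x ^ i * y ^ j)) has_sum val F (val G x y) (val H x y)) UNIV"
    by (rule has_sum_SigmaD) (use fin in \<open>auto simp: case_prod_unfold\<close>)
  then show "val (sub F G H) x y = val F (val G x y) (val H x y)"
    unfolding val_def[of "sub F G H"] by (rule infsumI)
qed

text \<open>Without a constant term every monomial has degree at least 1, so shrinking the radius
  from R to r gains a factor r / R.\<close>

lemma nrm_small:
  assumes "absc R F" "nc F" "0 < R" "0 < e"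
  obtains r where "0 < r" "r \<le> R" "nrm r F \<le> e"
proof -
  define r where "r = min R (R * e / (nrm R F + 1))"
  have n0: "0 \<le> nrm R F" using assms(3) by (simp add: nrm_nonneg)
  have r: "0 < r" "r \<le> R" using assms n0 by (auto simp: r_def)
  have "nrm r F \<le> infsum (\<lambda>p. (r / R) * (case p of (i,j) \<Rightarrow> norm (F $ i $ j) * R ^ (i + j))) UNIV"
    unfolding nrm_def
  proof (rule infsum_mono)
    show "(\<lambda>(i,j). norm (F $ i $ j) * r ^ (i + j)) summable_on UNIV"
      using absc_mono[OF assms(1)] r by (simp add: absc_def)
    show "(\<lambda>p. (r / R) * (case p of (i,j) \<Rightarrow> norm (F $ i $ j) * R ^ (i + j))) summable_on UNIV"
      using assms(1) unfolding absc_def by (rule summable_on_cmult_right)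
    fix p :: "nat \<times> nat"
    obtain i j where p: "p = (i,j)" by fastforce
    show "(case p of (i,j) \<Rightarrow> norm (F $ i $ j) * r ^ (i + j)) \<le> (r / R) * (case p of (i,j) \<Rightarrow> norm (F $ i $ j) * R ^ (i + j))"
    proof (cases "i + j = 0")
      case True
      then show ?thesis using assms(2) by (simp add: p nc_def)
    next
      case False
      then obtain m where m: "i + j = Suc m" using not0_implies_Suc by blast
      have "r ^ m \<le> R ^ m" using r by (intro power_mono) auto
      then have "r ^ (i + j) \<le> r / R * R ^ (i + j)" using r assms(3) by (simp add: m)
      then have "norm (F $ i $ j) * r ^ (i + j) \<le> norm (F $ i $ j) * (r / R * R ^ (i + j))" by (intro mult_left_mono) auto
      then show ?thesis by (simp add: p mult_ac)
    qed
  qed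
  also have "\<dots> = (r / R) * nrm R F" unfolding nrm_def by (rule infsum_cmult_right')
  also have "\<dots> \<le> e"
  proof -
    have "r \<le> R * e / (nrm R F + 1)" by (simp add: r_def)
    then have "r * (nrm R F + 1) \<le> R * e" using n0 by (simp add: pos_le_divide_eq)
    then have "r * nrm R F \<le> R * e" using r by (simp add: algebra_simps)
    then show ?thesis using assms(3) by (simp add: field_simps)
  qed
  finally show ?thesis using that r by blast
qed

section \<open>Germs and their power series expansions\<close>

definition expands :: "(C2 \<Rightarrow> complex) \<Rightarrow> ps2 \<Rightarrow> bool" where
  "expands f F \<longleftrightarrow> has_ps_expansion f (cf F)"

text \<open>Summability in the sense of \<open>has_sum\<close> is unconditional, hence absolute over
  the complex numbers; the single point (R / 2, R / 2) therefore controls a closed polydisc.\<close>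

lemma expands_iff:
  "expands f F \<longleftrightarrow> (\<exists>r>0. absc r F \<and> (\<forall>x y. norm x \<le> r \<longrightarrow> norm y \<le> r \<longrightarrow> f (x, y) = val F x y))"
proof
  assume "expands f F"
  then obtain R where R: "R > 0" and *: "\<And>x y. norm x < R \<Longrightarrow> norm y < R \<Longrightarrow>
      ((\<lambda>(i,j). F $ i $ j * (x ^ i * y ^ j)) has_sum f (x, y)) UNIV"
    unfolding expands_def has_ps_expansion_def cf_def mon_def by fastforce
  let ?r = "complex_of_real (R / 2)"
  have r: "norm ?r < R" "norm ?r = R / 2" using R by (auto simp: norm_divide)
  have "(\<lambda>(i,j). F $ i $ j * (?r ^ i * ?r ^ j)) summable_on UNIV"
    using *[OF r(1) r(1)] by (rule has_sum_imp_summable)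
  then have "(\<lambda>p. norm (case p of (i,j) \<Rightarrow> F $ i $ j * (?r ^ i * ?r ^ j))) summable_on UNIV"
    by (simp add: summable_on_iff_abs_summable_on_complex)
  also have "(\<lambda>p. norm (case p of (i,j) \<Rightarrow> F $ i $ j * (?r ^ i * ?r ^ j))) = (\<lambda>(i,j). norm (F $ i $ j) * (R / 2) ^ (i + j))"
    using r(2) by (intro ext) (auto simp del: of_real_divide simp: norm_mult norm_power power_add)
  finally have "absc (R / 2) F" unfolding absc_def .
  moreover have "f (x, y) = val F x y" if "norm x \<le> R / 2" "norm y \<le> R / 2" for x y
    using *[of x y] that R unfolding val_def by (simp add: infsumI)
  ultimately show "\<exists>r>0. absc r F \<and> (\<forall>x y. norm x \<le> r \<longrightarrow> norm y \<le> r \<longrightarrow> f (x, y) = val F x y)"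
    using R by (intro exI[of _ "R / 2"]) auto
next
  assume "\<exists>r>0. absc r F \<and> (\<forall>x y. norm x \<le> r \<longrightarrow> norm y \<le> r \<longrightarrow> f (x, y) = val F x y)"
  then obtain r where "r > 0" "absc r F" and *: "\<And>x y. norm x \<le> r \<Longrightarrow> norm y \<le> r \<Longrightarrow> f (x, y) = val F x y" by blast
  then show "expands f F"
    unfolding expands_def has_ps_expansion_def cf_def mon_def
    by (intro exI[of _ r]) (auto simp: absc_has_sum)
qed

lemma expandsE:
  assumes "expands f F"
  obtains r where "r > 0" "\<And>q. 0 \<le> q \<Longrightarrow> q \<le> r \<Longrightarrow> absc q F"
    "\<And>x y. norm x \<le> r \<Longrightarrow> norm y \<le> r \<Longrightarrow> f (x, y) = val F x y"
  using assms absc_mono unfolding expands_iff by (metis order_refl)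

lemma expandsI:
  assumes "r > 0" "absc r F" "\<And>x y. norm x \<le> r \<Longrightarrow> norm y \<le> r \<Longrightarrow> f (x, y) = val F x y"
  shows "expands f F"
  using assms unfolding expands_iff by blast

lemma expands_mult:
  assumes "expands f F" "expands g G" shows "expands (\<lambda>z. f z * g z) (F * G)"
proof -
  from assms(1) obtain r where r: "r > 0" "\<And>q. 0 \<le> q \<Longrightarrow> q \<le> r \<Longrightarrow> absc q F" "\<And>x y. norm x \<le> r \<Longrightarrow> norm y \<le> r \<Longrightarrow> f (x, y) = val F x y"
    by (rule expandsE) blast
  from assms(2) obtain r' where r': "r' > 0" "\<And>q. 0 \<le> q \<Longrightarrow> q \<le> r' \<Longrightarrow> absc q G" "\<And>x y. norm x \<le> r' \<Longrightarrow> norm y \<le> r' \<Longrightarrow> g (x, y) = val G x y"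
    by (rule expandsE) blast
  show ?thesis
    by (rule expandsI[of "min r r'"]) (use r r' in \<open>auto intro!: absc_mult simp: val_mult[of "min r r'"]\<close>)
qed

lemma expands_add:
  assumes "expands f F" "expands g G" shows "expands (\<lambda>z. f z + g z) (F + G)"
proof -
  from assms(1) obtain r where r: "r > 0" "\<And>q. 0 \<le> q \<Longrightarrow> q \<le> r \<Longrightarrow> absc q F" "\<And>x y. norm x \<le> r \<Longrightarrow> norm y \<le> r \<Longrightarrow> f (x, y) = val F x y"
    by (rule expandsE) blast
  from assms(2) obtain r' where r': "r' > 0" "\<And>q. 0 \<le> q \<Longrightarrow> q \<le> r' \<Longrightarrow> absc q G" "\<And>x y. norm x \<le> r' \<Longrightarrow> norm y \<le> r' \<Longrightarrow> g (x, y) = val G x y"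
    by (rule expandsE) blast
  show ?thesis
    by (rule expandsI[of "min r r'"]) (use r r' in \<open>auto intro!: absc_add simp: val_add[of "min r r'"]\<close>)
qed

lemma expands_cst: "expands (\<lambda>z. c) (cst c)" and expands_fst: "expands fst X2" and expands_snd: "expands snd Y2"
  by (auto intro!: expandsI[of 1])

lemma expands_minus: "expands f F \<Longrightarrow> expands (\<lambda>z. - f z) (- F)"
  using expands_mult[OF expands_cst[of "-1"], of f F] by (simp add: cst_minus)

lemma expands_diff: "expands f F \<Longrightarrow> expands g G \<Longrightarrow> expands (\<lambda>z. f z - g z) (F - G)"
  using expands_add[of f F "\<lambda>z. - g z" "- G"] by (simp add: expands_minus)

lemma expands_power: "expands f F \<Longrightarrow> expands (\<lambda>z. f z ^ n) (F ^ n)"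
  using expands_cst[of 1] by (induction n) (auto intro: expands_mult)

lemma expands_comp:
  fixes f g k :: "C2 \<Rightarrow> complex"
  assumes f: "expands f F" and g: "expands g G" "nc G" and k: "expands k H" "nc H"
  shows "expands (\<lambda>z. f (g z, k z)) (sub F G H)"
proof -
  from f obtain R where R: "R > 0" "\<And>q. 0 \<le> q \<Longrightarrow> q \<le> R \<Longrightarrow> absc q F" "\<And>x y. norm x \<le> R \<Longrightarrow> norm y \<le> R \<Longrightarrow> f (x, y) = val F x y"
    by (rule expandsE) blast
  from g(1) obtain r where r: "r > 0" "\<And>q. 0 \<le> q \<Longrightarrow> q \<le> r \<Longrightarrow> absc q G" "\<And>x y. norm x \<le> r \<Longrightarrow> norm y \<le> r \<Longrightarrow> g (x, y) = val G x y"
    by (rule expandsE) blast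
  from k(1) obtain r' where r': "r' > 0" "\<And>q. 0 \<le> q \<Longrightarrow> q \<le> r' \<Longrightarrow> absc q H" "\<And>x y. norm x \<le> r' \<Longrightarrow> norm y \<le> r' \<Longrightarrow> k (x, y) = val H x y"
    by (rule expandsE) blast
  obtain a where a: "0 < a" "a \<le> r" "nrm a G \<le> R" using nrm_small[OF _ g(2), of r R] r R by auto
  obtain b where b: "0 < b" "b \<le> r'" "nrm b H \<le> R" using nrm_small[OF _ k(2), of r' R] r' R by auto
  have mono: "nrm p E \<le> nrm q E" if "absc q E" "0 \<le> p" "p \<le> q" for p q E
    unfolding nrm_def using absc_mono[OF that] that
    by (intro infsum_mono) (auto simp: absc_def intro!: mult_left_mono power_mono)
  define m where "m = min a b"
  have m: "0 < m" "m \<le> r" "m \<le> r'" using a b by (auto simp: m_def)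
  have n: "nrm m G \<le> R" "nrm m H \<le> R"
    using mono[of a G m] mono[of b H m] a b r r' by (auto simp: m_def)
  have s: "absc m (sub F G H)" "\<And>x y. norm x \<le> m \<Longrightarrow> norm y \<le> m \<Longrightarrow> val (sub F G H) x y = val F (val G x y) (val H x y)"
    using absc_sub[OF r(2) g(2) r'(2) k(2) _ R(2) n] m R by auto
  show ?thesis
  proof (rule expandsI[OF m(1) s(1)])
    fix x y :: complex assume xy: "norm x \<le> m" "norm y \<le> m"
    then have "norm (val G x y) \<le> R" "norm (val H x y) \<le> R"
      using norm_val_le[of m G x y] norm_val_le[of m H x y] n m r r' by auto
    then show "f (g (x, y), k (x, y)) = val (sub F G H) x y"
      using s(2)[OF xy] xy r(3)[of x y] r'(3)[of x y] m R(3) by auto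
  qed
qed

lemma powser_eq_0_imp:
  fixes a :: "nat \<Rightarrow> complex"
  assumes "r > 0" "\<And>x. norm x \<le> r \<Longrightarrow> (\<lambda>n. a n * x ^ n) sums 0"
  shows "a n = 0"
proof -
  let ?F = "Abs_fps a"
  have "summable (\<lambda>n. a n * complex_of_real r ^ n)" using assms(2)[of "of_real r"] assms(1) by (auto simp: sums_iff)
  then have "ereal (norm (complex_of_real r)) \<le> conv_radius a" by (rule conv_radius_geI)
  then have "fps_conv_radius ?F > 0" using assms(1) unfolding fps_conv_radius_def
    by (simp add: order_less_le_trans[of 0 "ereal r"])
  moreover have "\<forall>\<^sub>F z in nhds 0. eval_fps ?F z = 0"
    using assms unfolding eventually_nhds_metric eval_fps_def
    by (intro exI[of _ r]) (auto simp: sums_iff dist_norm)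
  ultimately have "(\<lambda>_. 0) has_fps_expansion ?F" by (simp add: has_fps_expansion_def)
  then have "?F = 0" using fps_expansion_unique_complex has_fps_expansion_0 by blast
  then show ?thesis by (metis fps_nth_Abs_fps fps_zero_nth)
qed

text \<open>One-variable uniqueness is used twice: for fixed y in powers of x, whose coefficients
  are power series in y, and then for each of these.\<close>

lemma val_eq_0_imp:
  assumes "r > 0" "absc r F" "\<And>x y. norm x \<le> r \<Longrightarrow> norm y \<le> r \<Longrightarrow> val F x y = 0"
  shows "F = 0"
proof -
  have "F $ i $ j = 0" for i j
  proof -
    have inner: "(\<lambda>j. norm (F $ i $ j * y ^ j)) summable_on UNIV" if y: "norm y \<le> r" for y i
    proof -
      have "(\<lambda>(i,j). norm (F $ i $ j) * r ^ (i + j)) summable_on (UNIV \<times> UNIV)" using assms(2) by (simp add: absc_def)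
      then have "(\<lambda>j. norm (F $ i $ j) * r ^ (i + j)) summable_on UNIV"
        using summable_on_SigmaD1[of "\<lambda>i j. norm (F $ i $ j) * r ^ (i + j)" UNIV "\<lambda>_. UNIV" i] by simp
      from summable_on_cmult_right[OF this, of "inverse (r ^ i)"]
      have "(\<lambda>j. norm (F $ i $ j) * r ^ j) summable_on UNIV" using assms(1) by (simp add: power_add field_simps)
      then show ?thesis
        by (rule Infinite_Sum.abs_summable_on_comparison_test')
           (use y in \<open>auto simp: norm_mult norm_power intro!: mult_left_mono power_mono\<close>)
    qed
    define c where "c i y = infsum (\<lambda>j. F $ i $ j * y ^ j) UNIV" for i y
    have c: "((\<lambda>j. F $ i $ j * y ^ j) has_sum c i y) UNIV" if "norm y \<le> r" for i y
      unfolding c_def using inner[OF that] by (rule_tac has_sum_infsum, rule_tac abs_summable_summable)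
    have c0: "c i y = 0" if y: "norm y \<le> r" for y
    proof (rule powser_eq_0_imp[OF assms(1), of "\<lambda>i. c i y"])
      fix x :: complex assume x: "norm x \<le> r"
      have "((\<lambda>(i,j). F $ i $ j * (x ^ i * y ^ j)) has_sum 0) (UNIV \<times> UNIV)"
        using absc_has_sum[OF assms(2) x y] assms(3)[OF x y] by simp
      then have "((\<lambda>i. c i y * x ^ i) has_sum 0) UNIV"
      proof (rule has_sum_SigmaD)
        fix i
        show "((\<lambda>j. case (i, j) of (i, j) \<Rightarrow> F $ i $ j * (x ^ i * y ^ j)) has_sum c i y * x ^ i) UNIV"
          using has_sum_cmult_left[OF c[OF y, of i], of "x ^ i"] by (simp add: mult_ac)
      qed
      then show "(\<lambda>i. c i y * x ^ i) sums 0" by (rule has_sum_imp_sums)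
    qed
    show ?thesis
    proof (rule powser_eq_0_imp[OF assms(1), of "\<lambda>j. F $ i $ j"])
      fix y :: complex assume "norm y \<le> r"
      then show "(\<lambda>j. F $ i $ j * y ^ j) sums 0" using c[of y i] c0[of y] by (auto intro: has_sum_imp_sums)
    qed
  qed
  then show ?thesis by (simp add: ps2_eq_iff)
qed

lemma eventually_nhds_0_C2:
  "eventually P (nhds (0::C2)) \<longleftrightarrow> (\<exists>r>0. \<forall>x y. norm x \<le> r \<longrightarrow> norm y \<le> r \<longrightarrow> P (x, y))"
proof
  assume "eventually P (nhds (0::C2))"
  then obtain d where d: "d > 0" "\<And>z. dist z 0 < d \<Longrightarrow> P z" unfolding eventually_nhds_metric by auto
  show "\<exists>r>0. \<forall>x y. norm x \<le> r \<longrightarrow> norm y \<le> r \<longrightarrow> P (x, y)"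
  proof (intro exI[of _ "d / 3"] conjI allI impI)
    fix x y :: complex assume "norm x \<le> d / 3" "norm y \<le> d / 3"
    moreover have "norm (x, y) \<le> norm x + norm y" by (rule norm_Pair_le)
    ultimately show "P (x, y)" using d(1) by (intro d(2)) (simp add: dist_norm)
  qed (use d in auto)
next
  assume "\<exists>r>0. \<forall>x y. norm x \<le> r \<longrightarrow> norm y \<le> r \<longrightarrow> P (x, y)"
  then obtain r where r: "r > 0" "\<And>x y. norm x \<le> r \<Longrightarrow> norm y \<le> r \<Longrightarrow> P (x, y)" by auto
  have "P z" if "dist z 0 < r" for z
    using r(2)[of "fst z" "snd z"] that norm_fst_le[of "fst z" "snd z"] norm_snd_le[of "snd z" "fst z"] by (auto simp: dist_norm)
  then show "eventually P (nhds (0::C2))" unfolding eventually_nhds_metric using r(1) by auto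
qed

lemma expands_unique:
  assumes "expands f F" "expands g G" "eventually (\<lambda>z. f z = g z) (nhds 0)"
  shows "F = G"
proof -
  from expands_diff[OF assms(1,2)]
  obtain r where r: "r > 0" "\<And>q. 0 \<le> q \<Longrightarrow> q \<le> r \<Longrightarrow> absc q (F - G)"
    "\<And>x y. norm x \<le> r \<Longrightarrow> norm y \<le> r \<Longrightarrow> f (x, y) - g (x, y) = val (F - G) x y"
    by (rule expandsE) blast
  obtain d where d: "d > 0" "\<And>x y. norm x \<le> d \<Longrightarrow> norm y \<le> d \<Longrightarrow> f (x, y) = g (x, y)"
    using assms(3) unfolding eventually_nhds_0_C2 by blast
  have "F - G = 0"
    by (rule val_eq_0_imp[of "min r d"]) (use r d in \<open>auto simp flip: r(3)\<close>)
  then show ?thesis by simp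
qed

lemma expands_unique': "expands f F \<Longrightarrow> expands f G \<Longrightarrow> F = G"
  by (rule expands_unique) auto

lemma expands_eventually_eq:
  assumes "expands f F" "expands g F" shows "eventually (\<lambda>z. f z = g z) (nhds 0)"
proof -
  from assms(1) obtain r where r: "r > 0" "\<And>x y. norm x \<le> r \<Longrightarrow> norm y \<le> r \<Longrightarrow> f (x, y) = val F x y"
    by (rule expandsE) blast
  from assms(2) obtain r' where r': "r' > 0" "\<And>x y. norm x \<le> r' \<Longrightarrow> norm y \<le> r' \<Longrightarrow> g (x, y) = val F x y"
    by (rule expandsE) blast
  show ?thesis unfolding eventually_nhds_0_C2
    by (rule exI[of _ "min r r'"]) (use r r' in auto)
qed

lemma val_00 [simp]: "val F 0 0 = F $ 0 $ 0"
  unfolding val_def by (subst infsum_single2[of 0 0]) auto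

lemma expands_at_0: "expands f F \<Longrightarrow> f 0 = F $ 0 $ 0"
  by (erule expandsE) (metis val_00 norm_zero less_imp_le zero_prod_def)

lemma expands_nc: "expands f F \<Longrightarrow> f 0 = 0 \<Longrightarrow> nc F"
  using expands_at_0 nc_def by metis

lemma has_sum_fst_UNIV:
  fixes c :: "nat \<Rightarrow> 'a::{topological_comm_monoid_add,t2_space}"
  assumes "(c has_sum S) UNIV"
  shows "((\<lambda>(i,j). if j = (0::nat) then c i else 0) has_sum S) UNIV"
proof -
  have "((\<lambda>p. c (fst p)) has_sum S) (UNIV \<times> {0::nat})"
    by (rule has_sum_reindex_bij_witness[where i = "\<lambda>i. (i,0)" and j = fst, THEN iffD2, OF _ _ _ _ _ refl assms]) auto
  then show ?thesis by (rule has_sum_cong_neutral[THEN iffD1, rotated -1]) (auto split: if_splits)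
qed

lemma expands_fst_powser:
  assumes "R > 0" "\<And>x. norm x < R \<Longrightarrow> (\<lambda>n. a n * x ^ n) sums f x"
  shows "expands (\<lambda>z. f (fst z)) (PS (\<lambda>i j. if j = 0 then a i else 0))"
proof (rule expandsI[of "R / 2"])
  let ?F = "PS (\<lambda>i j. if j = 0 then a i else 0)"
  note emb = has_sum_fst_UNIV
  \<comment> \<open>The point 3R/4 lies strictly between R/2, where absolute convergence is wanted,
    and R, below which convergence is known.\<close>
  have "summable (\<lambda>n. norm (a n * complex_of_real (R / 2) ^ n))"
    by (rule powser_insidea[of _ "of_real (R * 3 / 4)"]) (use assms(1) assms(2)[of "of_real (R * 3 / 4)"] in \<open>auto simp: sums_iff norm_divide norm_mult\<close>)
  then have "(\<lambda>n. norm (a n) * (R / 2) ^ n) summable_on UNIV"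
    using assms(1) by (intro norm_summable_imp_summable_on) (auto simp: norm_mult norm_power norm_divide)
  from emb[OF has_sum_infsum[OF this]] show A: "absc (R / 2) ?F"
    unfolding absc_def by (rule_tac has_sum_imp_summable) (auto simp: case_prod_unfold if_distrib cong: if_cong elim!: has_sum_cong[THEN iffD1, rotated])
  fix x y :: complex assume xy: "norm x \<le> R / 2" "norm y \<le> R / 2"
  have "summable (\<lambda>n. norm (a n * x ^ n))"
    by (rule powser_insidea[of _ "of_real (R * 3 / 4)"]) (use assms(1) assms(2)[of "of_real (R * 3 / 4)"] xy in \<open>auto simp: sums_iff norm_divide norm_mult\<close>)
  then have "((\<lambda>n. a n * x ^ n) has_sum f x) UNIV"
    using assms xy by (intro norm_summable_imp_has_sum) auto
  from emb[OF this] have "((\<lambda>(i,j). ?F $ i $ j * (x ^ i * y ^ j)) has_sum f x) UNIV"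
    by (rule has_sum_cong[THEN iffD1, rotated]) auto
  then show "f (fst (x, y)) = val ?F x y" unfolding val_def by (simp add: infsumI)
qed (use assms in auto)

lemma expands_fst_holomorphic:
  assumes "f holomorphic_on ball 0 R" "R > 0"
  obtains F where "expands (\<lambda>z. f (fst z)) F"
  using expands_fst_powser[of R "\<lambda>n. (deriv ^^ n) f 0 / fact n" f] holomorphic_power_series[OF assms(1)] assms(2) that
  by (auto simp: dist_norm)

section \<open>The formal exponential\<close>

definition Eser :: ps2 where "Eser = PS (\<lambda>i j. if j = 0 then 1 / fact i else 0)"
definition E :: "ps2 \<Rightarrow> ps2" where "E u = sub Eser u 0"

lemma expands_Eser: "expands (\<lambda>z. exp (fst z)) Eser"
  unfolding Eser_def
proof (rule expands_fst_powser[of 1])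
  fix x :: complex
  show "(\<lambda>n. 1 / fact n * x ^ n) sums exp x"
    using exp_converges[of x] by (simp add: scaleR_conv_of_real field_simps)
qed auto

lemma expands_E: "expands f u \<Longrightarrow> nc u \<Longrightarrow> expands (\<lambda>z. exp (f z)) (E u)"
  unfolding E_def using expands_comp[OF expands_Eser, of f u "\<lambda>_. 0" 0] expands_cst[of 0] by simp

lemma sub_E:
  assumes "nc u" "nc G" "nc H" shows "sub (E u) G H = E (sub u G H)"
  unfolding E_def using sub_assoc[of u 0 G H Eser] assms by simp

text \<open>The functional equation is taken from the analytic exponential for the convergent series
  \<open>X2\<close> and \<open>Y2\<close>, through uniqueness of expansions. Substituting u and v
  extends it to arbitrary, possibly divergent series.\<close>

lemma E_add:
  assumes "nc u" "nc v" shows "E (u + v) = E u * E v"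
proof -
  have dv: "nc (X2 + Y2)" by simp
  have "E (X2 + Y2) = E X2 * E Y2"
    by (rule expands_unique'[of "\<lambda>z. exp (fst z + snd z)"])
       (use expands_E[OF expands_add[OF expands_fst expands_snd] dv] expands_mult[OF expands_E[OF expands_fst] expands_E[OF expands_snd]]
         in \<open>simp_all add: exp_add\<close>)
  then have "sub (E (X2 + Y2)) u v = sub (E X2 * E Y2) u v" by simp
  then show ?thesis using assms by (simp add: sub_mult sub_E sub_add)
qed

lemma E_0 [simp]: "E 0 = 1"
proof -
  have "E 0 $ i $ j = (1::ps2) $ i $ j" for i j
  proof -
    have "E 0 $ i $ j = (\<Sum>p\<in>{(k,l). k + l \<le> i + j}. if p = (0,0) then (1::ps2) $ i $ j else 0)"
      unfolding E_def sub_nth by (intro sum.cong) (auto simp: Eser_def power_0_left split: if_splits)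
    also have "\<dots> = (1::ps2) $ i $ j" by (subst sum.delta) auto
    finally show ?thesis .
  qed
  then show ?thesis by (simp add: ps2_eq_iff)
qed

lemma E_minus: "nc u \<Longrightarrow> E u * E (- u) = 1"
  using E_add[of u "- u"] by simp

lemma Eser_decomp: "Eser = 1 + X2 + X2 ^ 2 * PS (\<lambda>i j. Eser $ (i + 2) $ j)"
proof -
  have "(X2 ^ 2 * F) $ i $ j = (if 2 \<le> i then F $ (i - 2) $ j else 0)" for F :: ps2 and i j
    using XY_power_mult_nth[of 2 0 F i j] by simp
  then have "(1 + X2 + X2 ^ 2 * PS (\<lambda>i j. Eser $ (i + 2) $ j)) $ i $ j = Eser $ i $ j" for i j
    unfolding fps_add_nth by (simp only:) (cases i; cases "i - 1"; auto simp: Eser_def X2_nth)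
  then show ?thesis by (simp add: ps2_eq_iff)
qed

text \<open>A second-order Taylor formula with unspecified remainder. It is all that is used to
  divide E u - 1 by u, to see that \<open>E\<close> is injective, and to read off low
  coefficients.\<close>

lemma E_decomp:
  assumes "nc u" obtains R where "E u = 1 + u + u ^ 2 * R"
proof -
  have "E u = sub (1 + X2 + X2 ^ 2 * PS (\<lambda>i j. Eser $ (i + 2) $ j)) u 0"
    unfolding E_def by (subst Eser_decomp) simp
  also have "\<dots> = 1 + u + u ^ 2 * sub (PS (\<lambda>i j. Eser $ (i + 2) $ j)) u 0"
    using assms by (simp add: sub_add sub_mult sub_power)
  finally show ?thesis using that by blast
qed

lemma E_nth_0: assumes "nc u" shows "E u $ 0 $ 0 = 1"
  by (rule E_decomp[OF assms]) (use assms in \<open>simp add: nc_def fps_nth_power_0\<close>)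

lemma E_minus_1_factor:
  assumes "nc u" obtains R where "E u - 1 = u * R"
proof -
  from assms obtain R where "E u = 1 + u + u ^ 2 * R" by (rule E_decomp)
  then show ?thesis by (intro that[of "1 + u * R"]) (simp add: algebra_simps power2_eq_square)
qed

lemma E_power: "nc u \<Longrightarrow> E u ^ n = E (of_nat n * u)"
  by (induction n) (simp_all add: algebra_simps E_add)

lemma E_inj:
  assumes "nc u" "nc v" "E u = E v" shows "u = v"
proof -
  obtain R where R: "E (u - v) = 1 + (u - v) + (u - v) ^ 2 * R"
    using E_decomp[of "u - v"] assms by auto
  have "E (u - v) = E u * E (- v)" using E_add[of u "- v"] assms by simp
  also have "\<dots> = 1" using E_minus[OF assms(2)] assms(3) by simp
  finally have "(u - v) * (1 + (u - v) * R) = 0" using R by (simp add: algebra_simps power2_eq_square)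
  moreover have "(1 + (u - v) * R) $ 0 $ 0 = 1" using assms(1,2) by (simp add: nc_def)
  then have "1 + (u - v) * R \<noteq> 0" by (metis fps_zero_nth zero_neq_one)
  ultimately show ?thesis by simp
qed

section \<open>Conjugation and the grading by powers of x and y modulo h\<close>

definition cj :: "ps2 \<Rightarrow> ps2" where "cj F = PS (\<lambda>i j. cnj (F $ i $ j))"

lemma cj_nth [simp]: "cj F $ i $ j = cnj (F $ i $ j)" by (simp add: cj_def)

lemma cj_simps [simp]: "cj (F + G) = cj F + cj G" "cj (F - G) = cj F - cj G" "cj (- F) = - cj F"
  "cj (F * G) = cj F * cj G" "cj (cj F) = F" "cj X2 = X2" "cj Y2 = Y2" "cj (cst c) = cst (cnj c)"
  "cj 0 = 0" "cj 1 = 1"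
  by (auto simp: ps2_eq_iff ps2_mult_nth X2_nth Y2_nth)

lemma cj_power [simp]: "cj (F ^ n) = cj F ^ n" by (induction n) simp_all

lemma nc_cj [simp]: "nc (cj F) \<longleftrightarrow> nc F" by (simp add: nc_def)

lemma cj_sub: "cj (sub F G H) = sub (cj F) (cj G) (cj H)"
proof -
  have "cnj ((G ^ k * H ^ l) $ i $ j) = (cj G ^ k * cj H ^ l) $ i $ j" for k l i j
    by (metis cj_nth cj_power cj_simps(4))
  then show ?thesis by (simp add: ps2_eq_iff sub_nth case_prod_unfold)
qed

lemma cj_E: "cj (E u) = E (cj u)"
proof -
  have "cj Eser = Eser" by (simp add: ps2_eq_iff Eser_def)
  then show ?thesis by (simp add: E_def cj_sub)
qed

lemma expands_cj:
  assumes "expands f F" shows "expands (\<lambda>z. cnj (f (cnj2 z))) (cj F)"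
proof -
  from assms obtain r where r: "r > 0" "\<And>q. 0 \<le> q \<Longrightarrow> q \<le> r \<Longrightarrow> absc q F" "\<And>x y. norm x \<le> r \<Longrightarrow> norm y \<le> r \<Longrightarrow> f (x, y) = val F x y"
    by (rule expandsE) blast
  have "val (cj F) x y = cnj (val F (cnj x) (cnj y))" for x y
    unfolding val_def by (simp add: case_prod_unfold flip: infsum_cnj)
  then show ?thesis
    using r by (intro expandsI[of r]) (auto simp: absc_def cnj2_def)
qed

text \<open>A series is encoded by its components in C[[h]]: iota embeds C[[h]], and pp n and pm n are the
  coefficients of x^n and of y^n.\<close>

definition iota :: "complex fps \<Rightarrow> ps2" where "iota f = PS (\<lambda>i j. if i = j then f $ i else 0)"
definition pp :: "nat \<Rightarrow> ps2 \<Rightarrow> complex fps" where "pp n F = Abs_fps (\<lambda>k. F $ (k + n) $ k)"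
definition pm :: "nat \<Rightarrow> ps2 \<Rightarrow> complex fps" where "pm n F = Abs_fps (\<lambda>k. F $ k $ (k + n))"
definition hh :: ps2 where "hh = X2 * Y2"

lemma iota_nth [simp]: "iota f $ i $ j = (if i = j then f $ i else 0)" by (simp add: iota_def)
lemma pp_nth [simp]: "pp n F $ k = F $ (k + n) $ k" by (simp add: pp_def)
lemma pm_nth [simp]: "pm n F $ k = F $ k $ (k + n)" by (simp add: pm_def)

lemma hh_power_nth: "(hh ^ k) $ i $ j = (if i = k \<and> j = k then 1 else 0)"
  by (simp add: hh_def power_mult_distrib XY_power_nth)

lemma hh_power_mult_nth: "(hh ^ k * F) $ i $ j = (if k \<le> i \<and> k \<le> j then F $ (i - k) $ (j - k) else 0)"
  by (simp add: hh_def power_mult_distrib XY_power_mult_nth)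

lemma nc_hh [simp]: "nc hh" by (simp add: hh_def)
lemma cj_hh [simp]: "cj hh = hh" by (simp add: hh_def)

lemma pp_simps [simp]: "pp n (F + G) = pp n F + pp n G" "pp n (F - G) = pp n F - pp n G" "pp n 0 = 0" "pp n (- F) = - pp n F"
  "pm n (F + G) = pm n F + pm n G" "pm n (F - G) = pm n F - pm n G" "pm n 0 = 0" "pm n (- F) = - pm n F"
  by (auto simp: fps_eq_iff)

lemma ps2_eq_ppI:
  assumes "\<And>n. pp n F = pp n G" "\<And>n. pm n F = pm n G" shows "F = G"
proof -
  have "F $ i $ j = G $ i $ j" for i j
  proof (cases "i \<le> j")
    case True
    then show ?thesis using arg_cong[OF assms(2)[of "j - i"], of "\<lambda>f. f $ i"] by simp
  next
    case False
    then show ?thesis using arg_cong[OF assms(1)[of "i - j"], of "\<lambda>f. f $ j"] by simp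
  qed
  then show ?thesis by (simp add: ps2_eq_iff)
qed

lemma pp_iota_mult [simp]: "pp n (iota f * F) = f * pp n F"
proof -
  have "(iota f * F) $ (k + n) $ k = (\<Sum>a\<le>k. f $ a * F $ (k - a + n) $ (k - a))" for k
  proof -
    have "(iota f * F) $ (k + n) $ k = (\<Sum>a\<le>k+n. \<Sum>b\<le>k. if b = a then f $ a * F $ (k + n - a) $ (k - a) else 0)"
      unfolding ps2_mult_nth by (intro sum.cong) auto
    also have "\<dots> = (\<Sum>a\<le>k+n. if a \<le> k then f $ a * F $ (k + n - a) $ (k - a) else 0)"
      by (simp add: sum.delta)
    also have "\<dots> = (\<Sum>a\<le>k. f $ a * F $ (k + n - a) $ (k - a))"
      by (rule sum.mono_neutral_cong_right) auto
    finally show ?thesis by (simp add: add.commute)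
  qed
  then show ?thesis by (simp add: fps_eq_iff fps_mult_nth atLeast0AtMost)
qed

lemma pm_iota_mult [simp]: "pm n (iota f * F) = f * pm n F"
proof -
  have "(iota f * F) $ k $ (k + n) = (\<Sum>a\<le>k. f $ a * F $ (k - a) $ (k - a + n))" for k
  proof -
    have "(iota f * F) $ k $ (k + n) = (\<Sum>a\<le>k. \<Sum>b\<le>k+n. if b = a then f $ a * F $ (k - a) $ (k + n - a) else 0)"
      unfolding ps2_mult_nth by (intro sum.cong) auto
    also have "\<dots> = (\<Sum>a\<le>k. f $ a * F $ (k - a) $ (k + n - a))"
      by (simp add: sum.delta)
    finally show ?thesis by (simp add: add.commute)
  qed
  then show ?thesis by (simp add: fps_eq_iff fps_mult_nth atLeast0AtMost)
qed

lemma pp_iota: "pp n (iota f) = (if n = 0 then f else 0)" and pm_iota: "pm n (iota f) = (if n = 0 then f else 0)"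
  by (auto simp: fps_eq_iff)

lemma iota_mult: "iota (f * g) = iota f * iota g"
  by (rule ps2_eq_ppI) (auto simp: pp_iota pm_iota)

lemma iota_1 [simp]: "iota 1 = 1" and iota_add: "iota (f + g) = iota f + iota g" and iota_diff: "iota (f - g) = iota f - iota g"
  and iota_minus: "iota (- f) = - iota f" and iota_0 [simp]: "iota 0 = 0" and iota_const: "iota (fps_const c) = cst c"
  by (auto simp: ps2_eq_iff)

lemma iota_power: "iota (f ^ n) = iota f ^ n" by (induction n) (simp_all add: iota_mult)

lemma iota_X: "iota fps_X = hh" using hh_power_nth[of 1] by (auto simp: ps2_eq_iff fps_X_def)

lemma iota_inj: "iota f = iota g \<longleftrightarrow> f = g" using pp_iota[of 0] by metis

lemma nc_iota [simp]: "nc (iota f) \<longleftrightarrow> f $ 0 = 0" by (simp add: nc_def)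

lemma sub_iota:
  assumes "nc G" "nc H" "G * H = hh" shows "sub (iota f) G H = iota f"
proof -
  have "sub (iota f) G H $ i $ j = sub (iota f) X2 Y2 $ i $ j" for i j
    unfolding sub_nth
  proof (intro sum.cong refl, clarify)
    fix k l
    show "iota f $ k $ l * (G ^ k * H ^ l) $ i $ j = iota f $ k $ l * (X2 ^ k * Y2 ^ l) $ i $ j"
      using assms(3) by (cases "k = l") (simp_all add: hh_def flip: power_mult_distrib)
  qed
  then show ?thesis by (simp add: ps2_eq_iff)
qed

lemma iota_sub:
  assumes "f $ 0 = 0" shows "sub F (iota f) 0 = iota (pp 0 (sub F (iota f) 0))"
proof -
  have "sub F (iota f) 0 $ i $ j = 0" if "i \<noteq> j" for i j
    unfolding sub_nth
  proof (intro sum.neutral, clarify)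
    fix k l
    show "F $ k $ l * (iota f ^ k * 0 ^ l) $ i $ j = 0"
      using that by (cases "l = 0") (simp_all add: power_0_left flip: iota_power)
  qed
  then show ?thesis by (auto simp: ps2_eq_iff)
qed

text \<open>Composition with an involution (x, y) |-> (a(h) y, b(h) x), where ab = 1.\<close>

definition tw :: "complex fps \<Rightarrow> complex fps \<Rightarrow> ps2 \<Rightarrow> ps2" where
  "tw a b F = sub F (iota a * Y2) (iota b * X2)"

text \<open>Collapses the sum in \<open>sub_nth\<close> when only the monomials x^(b + n) y^b, or
  their mirror images, contribute, as in \<open>pm_tw\<close> and \<open>pp_tw\<close>.\<close>

lemma sum_pairs_diagonal:
  fixes g :: "nat \<Rightarrow> nat \<Rightarrow> complex"
  assumes "\<And>a b. g a b \<noteq> 0 \<Longrightarrow> a = b + n \<and> b \<le> k"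
  shows "(\<Sum>(a,b)\<in>{(a,b). a + b \<le> k + (k + n)}. g a b) = (\<Sum>b\<le>k. g (b + n) b)"
    and "(\<Sum>(b,a)\<in>{(b,a). b + a \<le> (k + n) + k}. g a b) = (\<Sum>b\<le>k. g (b + n) b)"
proof -
  have "(\<Sum>(a,b)\<in>{(a,b). a + b \<le> k + (k + n)}. g a b) = (\<Sum>(a,b)\<in>(\<lambda>b. (b + n, b)) ` {..k}. g a b)"
    using assms by (intro sum.mono_neutral_right) force+
  also have "\<dots> = (\<Sum>b\<le>k. g (b + n) b)" by (subst sum.reindex) (auto simp: inj_on_def)
  finally show "(\<Sum>(a,b)\<in>{(a,b). a + b \<le> k + (k + n)}. g a b) = (\<Sum>b\<le>k. g (b + n) b)" .
  have "(\<Sum>(b,a)\<in>{(b,a). b + a \<le> (k + n) + k}. g a b) = (\<Sum>(b,a)\<in>(\<lambda>b. (b, b + n)) ` {..k}. g a b)"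
    using assms by (intro sum.mono_neutral_right) force+
  also have "\<dots> = (\<Sum>b\<le>k. g (b + n) b)" by (subst sum.reindex) (auto simp: inj_on_def)
  finally show "(\<Sum>(b,a)\<in>{(b,a). b + a \<le> (k + n) + k}. g a b) = (\<Sum>b\<le>k. g (b + n) b)" .
qed

lemma tw_coeff:
  "((iota a * Y2) ^ k * (iota b * X2) ^ l) $ i $ j =
     (if l \<le> i \<and> k \<le> j then iota (a ^ k * b ^ l) $ (i - l) $ (j - k) else 0)"
proof -
  have "(iota a * Y2) ^ k * (iota b * X2) ^ l = X2 ^ l * Y2 ^ k * iota (a ^ k * b ^ l)"
    by (simp add: iota_mult iota_power power_mult_distrib mult_ac)
  then show ?thesis by (simp only: XY_power_mult_nth)
qed

text \<open>The monomial x^(m + n) y^m goes to (a y)^(m + n) (b x)^m = a^n h^m y^n. So the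
  involution exchanges the components at x^n and y^n, up to a power of a or b in C[[h]].\<close>

lemma pm_tw:
  assumes "a * b = 1" shows "pm n (tw a b F) = a ^ n * pp n F"
proof -
  have ab: "a ^ (m + n) * b ^ m = a ^ n" for m
    using assms by (simp add: power_add mult_ac flip: power_mult_distrib)
  have "tw a b F $ k $ (k + n) = (\<Sum>m\<le>k. F $ (m + n) $ m * (a ^ n) $ (k - m))" for k
  proof -
    have "tw a b F $ k $ (k + n) = (\<Sum>(c,d)\<in>{(c,d). c + d \<le> k + (k + n)}. F $ c $ d *
       (if d \<le> k \<and> c \<le> k + n then iota (a ^ c * b ^ d) $ (k - d) $ (k + n - c) else 0))"
      unfolding tw_def sub_nth tw_coeff ..
    also have "\<dots> = (\<Sum>m\<le>k. F $ (m + n) $ m *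
       (if m \<le> k \<and> m + n \<le> k + n then iota (a ^ (m + n) * b ^ m) $ (k - m) $ (k + n - (m + n)) else 0))"
      by (rule sum_pairs_diagonal(1)) (auto split: if_splits)
    finally show ?thesis by (simp add: ab)
  qed
  then show ?thesis by (simp add: fps_eq_iff mult.commute[of "a ^ n"] fps_mult_nth[of "pp n F"] atLeast0AtMost)
qed

lemma pp_tw:
  assumes "a * b = 1" shows "pp n (tw a b F) = b ^ n * pm n F"
proof -
  have ab: "a ^ m * b ^ (m + n) = b ^ n" for m
    using assms by (simp add: power_add mult.assoc[symmetric] flip: power_mult_distrib)
  have "tw a b F $ (k + n) $ k = (\<Sum>m\<le>k. F $ m $ (m + n) * (b ^ n) $ (k - m))" for k
  proof -
    have "tw a b F $ (k + n) $ k = (\<Sum>(d,c)\<in>{(d,c). d + c \<le> (k + n) + k}. F $ d $ c *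
       (if c \<le> k + n \<and> d \<le> k then iota (a ^ d * b ^ c) $ (k + n - c) $ (k - d) else 0))"
      unfolding tw_def sub_nth tw_coeff ..
    also have "\<dots> = (\<Sum>m\<le>k. F $ m $ (m + n) *
       (if m + n \<le> k + n \<and> m \<le> k then iota (a ^ m * b ^ (m + n)) $ (k + n - (m + n)) $ (k - m) else 0))"
      by (rule sum_pairs_diagonal(2)) (auto split: if_splits)
    finally show ?thesis by (simp add: ab)
  qed
  then show ?thesis by (simp add: fps_eq_iff mult.commute[of "b ^ n"] fps_mult_nth[of "pm n F"] atLeast0AtMost)
qed

lemma tw_simps [simp]: "tw a b (F + G) = tw a b F + tw a b G" "tw a b (F - G) = tw a b F - tw a b G"
  "tw a b (- F) = - tw a b F" "tw a b 0 = 0" "tw a b 1 = 1" "tw a b (F * G) = tw a b F * tw a b G" "tw a b (cst c) = cst c"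
  "tw a b X2 = iota a * Y2" "tw a b Y2 = iota b * X2" "nc F \<Longrightarrow> nc (tw a b F)" "nc F \<Longrightarrow> tw a b (E F) = E (tw a b F)"
  by (simp_all add: tw_def sub_add sub_diff sub_minus sub_mult sub_E)

lemma tw_iota [simp]: "a * b = 1 \<Longrightarrow> tw a b (iota f) = iota f"
  unfolding tw_def by (rule sub_iota) (simp_all add: hh_def mult_ac flip: iota_mult mult.assoc[of "iota a" "iota b"])

lemma tw_tw: "a * b = 1 \<Longrightarrow> tw a b (tw a b F) = F"
proof -
  assume "a * b = 1"
  have "tw a b (tw a b F) = sub F (tw a b (iota a * Y2)) (tw a b (iota b * X2))"
    unfolding tw_def by (rule sub_assoc) simp_all
  moreover have "iota a * (iota b * X2) = X2" "iota b * (iota a * Y2) = Y2"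
    using \<open>a * b = 1\<close> by (simp_all flip: mult.assoc iota_mult add: mult.commute[of b])
  ultimately show ?thesis
    using \<open>a * b = 1\<close> by (simp del: mult_cancel_right1)
qed

lemma van_min_tw:
  assumes "a * b = 1" "van min k F" shows "van min k (tw a b F)"
proof -
  have 1: "pm n (tw a b F) $ m = 0" "pp n (tw a b F) $ m = 0" if "m < k" for n m
    unfolding pm_tw[OF assms(1)] pp_tw[OF assms(1)] fps_mult_nth
    using that assms(2) by (auto simp: van_def intro!: sum.neutral)
  show ?thesis unfolding van_def
  proof (intro allI impI)
    fix i j assume "min i j < k"
    then show "tw a b F $ i $ j = 0" using 1(1)[of i "j - i"] 1(2)[of j "i - j"] by (cases "i \<le> j") auto
  qed
qed

section \<open>Families depending polynomially on a real parameter\<close>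

definition tp :: "nat \<Rightarrow> (real \<Rightarrow> complex) \<Rightarrow> bool" where
  "tp d f \<longleftrightarrow> (\<exists>p. degree p \<le> d \<and> (\<forall>t. f t = poly p (of_real t)))"

lemma tp_const [simp]: "tp d (\<lambda>t. c)"
  unfolding tp_def by (intro exI[of _ "[:c:]"]) auto

lemma tp_of_real: "1 \<le> d \<Longrightarrow> tp d of_real"
  unfolding tp_def by (intro exI[of _ "[:0, 1:]"]) auto

lemma tp_mono: "tp d f \<Longrightarrow> d \<le> e \<Longrightarrow> tp e f"
  unfolding tp_def using order_trans by blast

lemma tp_add: "tp d f \<Longrightarrow> tp d g \<Longrightarrow> tp d (\<lambda>t. f t + g t)"
  unfolding tp_def by (metis degree_add_le poly_add)

lemma tp_mult: "tp d f \<Longrightarrow> tp e g \<Longrightarrow> d + e \<le> m \<Longrightarrow> tp m (\<lambda>t. f t * g t)"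
  unfolding tp_def by (metis degree_mult_le poly_mult add_mono order_trans)

lemma tp_cmult: "tp d f \<Longrightarrow> tp d (\<lambda>t. c * f t)"
  using tp_mult[OF tp_const[of 0 c]] by simp

lemma tp_minus: "tp d f \<Longrightarrow> tp d (\<lambda>t. - f t)"
  using tp_cmult[of d f "-1"] by simp

lemma tp_diff: "tp d f \<Longrightarrow> tp d g \<Longrightarrow> tp d (\<lambda>t. f t - g t)"
  using tp_add[of d f "\<lambda>t. - g t"] tp_minus by simp

lemma tp_sum: "(\<And>x. x \<in> A \<Longrightarrow> tp d (f x)) \<Longrightarrow> tp d (\<lambda>t. \<Sum>x\<in>A. f x t)"
  by (induction A rule: infinite_finite_induct) (auto intro: tp_add)

lemma tp_cnj: "tp d f \<Longrightarrow> tp d (\<lambda>t. cnj (f t))"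
proof -
  assume "tp d f"
  then obtain p where p: "degree p \<le> d" "\<And>t. f t = poly p (of_real t)" unfolding tp_def by blast
  have "cnj (poly p (of_real t)) = poly (map_poly cnj p) (of_real t)" for t
    by (subst poly_cnj) simp
  then show ?thesis unfolding tp_def
    by (intro exI[of _ "map_poly cnj p"]) (use p in \<open>auto simp: degree_map_poly\<close>)
qed

text \<open>The bound says that t never occurs without a factor h^q.\<close>

definition cls :: "nat \<Rightarrow> (real \<Rightarrow> ps2) \<Rightarrow> bool" where
  "cls q F \<longleftrightarrow> (\<forall>i j. tp (min i j div q) (\<lambda>t. F t $ i $ j))"

lemma cls_const [simp]: "cls q (\<lambda>t. F)" by (simp add: cls_def)

lemma cls_diff: "cls q F \<Longrightarrow> cls q G \<Longrightarrow> cls q (\<lambda>t. F t - G t)"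
  and cls_minus: "cls q F \<Longrightarrow> cls q (\<lambda>t. - F t)"
  by (auto simp: cls_def tp_diff tp_minus)

lemma div_add_le: "a div q + b div q \<le> (a + b) div (q::nat)"
  by (cases "q = 0") (auto simp: less_eq_div_iff_mult_less_eq algebra_simps add_mono div_times_less_eq_dividend)

text \<open>Degrees add, and both min and floor division are superadditive, so the bound is stable
  under products.\<close>

lemma cls_mult:
  assumes "cls q F" "cls q G" shows "cls q (\<lambda>t. F t * G t)"
  unfolding cls_def ps2_mult_nth
proof (intro allI tp_sum)
  fix i j k l :: nat assume kl: "k \<in> {..i}" "l \<in> {..j}"
  have "min k l div q + min (i - k) (j - l) div q \<le> (min k l + min (i - k) (j - l)) div q" by (rule div_add_le)
  also have "\<dots> \<le> min i j div q" using kl by (intro div_le_mono) auto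
  finally show "tp (min i j div q) (\<lambda>t. F t $ k $ l * G t $ (i - k) $ (j - l))"
    using assms by (intro tp_mult) (auto simp: cls_def)
qed

lemma cls_power: "cls q F \<Longrightarrow> cls q (\<lambda>t. F t ^ n)"
  by (induction n) (auto intro: cls_mult)

lemma cls_sub: "cls q G \<Longrightarrow> cls q H \<Longrightarrow> cls q (\<lambda>t. sub F (G t) (H t))"
  using cls_mult[OF cls_power cls_power, of q G H] unfolding cls_def sub_nth case_prod_unfold
  by (intro allI tp_sum tp_cmult) auto

lemma cls_E: "cls q u \<Longrightarrow> cls q (\<lambda>t. E (u t))"
  unfolding E_def by (intro cls_sub) auto

text \<open>A Bernstein-Walsh inequality. The Joukowski map w -> c + (r/2) (w + 1/w) sends the unit
  circle onto the interval of radius r about c; w^d times p of this expression is a polynomial in w,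
  and the maximum principle on the disc applies to it.\<close>

lemma poly_bound_outside_interval:
  fixes p :: "complex poly" and c r M :: real
  assumes d: "degree p \<le> d" and r: "r > 0"
    and M: "\<And>t. \<bar>t - c\<bar> \<le> r \<Longrightarrow> norm (poly p (of_real t)) \<le> M"
  shows "norm (poly p z) \<le> M * (1 + 2 * norm (z - of_real c) / r) ^ d"
proof -
  \<comment> \<open>The product of w^d and p at the Joukowski image, written as an explicit
    polynomial so that it is holomorphic at w = 0 as well.\<close>
  define q where "q w = (\<Sum>k\<le>d. coeff p k * w ^ (d - k) * (of_real c * w + of_real (r / 2) * (w ^ 2 + 1)) ^ k)" for w :: complex
  have q: "q w = w ^ d * poly p (of_real c + of_real (r / 2) * (w + 1 / w))" if "w \<noteq> 0" for w
  proof -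
    have p_sum: "poly p x = (\<Sum>k\<le>d. coeff p k * x ^ k)" for x
      using poly_altdef[of p x] d coeff_eq_0[of p]
      by (simp, intro sum.mono_neutral_left) (auto simp: not_le)
    have "coeff p k * w ^ (d - k) * (of_real c * w + of_real (r / 2) * (w ^ 2 + 1)) ^ k =
       w ^ d * (coeff p k * (of_real c + of_real (r / 2) * (w + 1 / w)) ^ k)" if "k \<le> d" for k
    proof -
      have "of_real c * w + of_real (r / 2) * (w ^ 2 + 1) = w * (of_real c + of_real (r / 2) * (w + 1 / w))"
        using \<open>w \<noteq> 0\<close> by (simp add: field_simps power2_eq_square)
      moreover have "w ^ d = w ^ (d - k) * w ^ k" using that by (simp flip: power_add)
      ultimately show ?thesis by (simp only: power_mult_distrib mult_ac)
    qed
    then show ?thesis unfolding q_def p_sum sum_distrib_left by (intro sum.cong) (simp_all only: atMost_iff)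
  qed
  have circ: "norm (q w) \<le> M" if "norm w = 1" for w
  proof -
    have w0: "w \<noteq> 0" using that by auto
    have "w * cnj w = 1" using complex_norm_square[of w] that by simp
    then have "1 / w = cnj w" using w0 by (simp add: field_simps)
    then have "w + 1 / w = of_real (2 * Re w)" by (simp add: complex_add_cnj)
    then have "of_real c + of_real (r / 2) * (w + 1 / w) = complex_of_real (c + r * Re w)" by simp
    moreover have "\<bar>r * Re w\<bar> \<le> r" using abs_Re_le_cmod[of w] that r by (simp add: abs_mult)
    ultimately show ?thesis using q[OF w0] that M[of "c + r * Re w"] by (simp only: norm_mult norm_power) simp
  qed
  have disc: "norm (q w) \<le> M" if "norm w \<le> 1" for w
  proof (rule maximum_modulus_frontier[of q "cball 0 1"])
    show "q holomorphic_on interior (cball 0 1)" unfolding q_def by (intro holomorphic_intros)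
    show "continuous_on (closure (cball 0 1)) q" unfolding q_def by (intro continuous_intros)
  qed (use that circ in auto)
  \<comment> \<open>The Joukowski preimages of z are the roots of w^2 - b w + 1. Their product is 1,
    so one lies in the closed unit disc, and the other has norm at most 1 + norm b because their sum
    is b.\<close>
  define b where "b = 2 * (z - of_real c) / of_real r"
  define e where "e = csqrt (b ^ 2 - 4)"
  have e: "e ^ 2 = b ^ 2 - 4" by (simp add: e_def)
  define w1 where "w1 = (b + e) / 2"
  define w2 where "w2 = (b - e) / 2"
  have w12: "w1 * w2 = 1" "w1 + w2 = b" using e by (auto simp: w1_def w2_def field_simps power2_eq_square)
  obtain w v where w: "w * v = 1" "w + v = b" "norm w \<le> 1"
  proof (cases "norm w1 \<le> 1")
    case False
    have "norm w1 * norm w2 = 1" using w12(1) by (metis norm_mult norm_one)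
    then have "norm w2 \<le> 1" using False
      by (smt (verit) mult_le_cancel_right1 norm_ge_zero)
    then show ?thesis using that[of w2 w1] w12 by (simp add: mult.commute add.commute)
  qed (use that w12 in blast)
  have w0: "w \<noteq> 0" using w(1) by auto
  have v: "v = 1 / w" using w0 w(1) by (simp add: eq_divide_eq mult.commute)
  have nv: "norm v \<le> 1 + norm b"
  proof -
    have "norm v = norm (b - w)" using w(2) by (metis add_diff_cancel_left')
    also have "\<dots> \<le> norm b + norm w" by (rule norm_triangle_ineq4)
    finally show ?thesis using w(3) by simp
  qed
  have e: "of_real (r / 2) * b = z - of_real c" using r by (simp add: b_def)
  have "of_real c + of_real (r / 2) * (w + 1 / w) = z"
    unfolding v[symmetric] w(2) e by simp
  then have "q w = w ^ d * poly p z" using q[OF w0] by simp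
  moreover have "v ^ d * w ^ d = 1" using w(1) by (simp add: mult.commute flip: power_mult_distrib)
  ultimately have "poly p z = v ^ d * q w" by (simp flip: mult.assoc)
  then have "norm (poly p z) = norm v ^ d * norm (q w)" by (simp add: norm_mult norm_power)
  also have "\<dots> \<le> (1 + norm b) ^ d * M"
    using nv disc[OF w(3)] by (intro mult_mono power_mono) auto
  also have "norm b = 2 * norm (z - of_real c) / r" using r unfolding b_def norm_mult norm_divide by simp
  finally show ?thesis by (simp add: mult.commute)
qed

text \<open>Cauchy's inequality on the unit circle, where the distance to c is at most 1 + |c|. The
  base of the power depends on the interval alone, so geometric bounds for values become geometric
  bounds for the derivative at 0.\<close>

lemma coeff_1_bound:
  fixes p :: "complex poly" and c r M :: real
  assumes "degree p \<le> d" "r > 0" "\<And>t. \<bar>t - c\<bar> \<le> r \<Longrightarrow> norm (poly p (of_real t)) \<le> M"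
  shows "norm (coeff p 1) \<le> M * (1 + 2 * (1 + \<bar>c\<bar>) / r) ^ d"
proof -
  have "norm (poly p (of_real c)) \<le> M" using assms(2) by (intro assms(3)) simp
  then have M0: "0 \<le> M" by (rule order_trans[OF norm_ge_zero])
  have "norm ((deriv ^^ 1) (poly p) 0) \<le> fact 1 * (M * (1 + 2 * (1 + \<bar>c\<bar>) / r) ^ d) / 1 ^ 1"
  proof (rule Cauchy_inequality)
    fix x :: complex assume "norm (0 - x) = 1"
    then have "norm (x - of_real c) \<le> 1 + \<bar>c\<bar>" using norm_triangle_ineq4[of x "of_real c"] by simp
    then have "M * (1 + 2 * norm (x - of_real c) / r) ^ d \<le> M * (1 + 2 * (1 + \<bar>c\<bar>) / r) ^ d"
      using M0 assms(2) by (intro mult_left_mono power_mono add_left_mono divide_right_mono) auto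
    then show "norm (poly p x) \<le> M * (1 + 2 * (1 + \<bar>c\<bar>) / r) ^ d"
      using poly_bound_outside_interval[OF assms(1,2), where c = c and M = M and z = x] assms(3) by fastforce
  qed (auto intro!: holomorphic_intros continuous_intros)
  moreover have "deriv (poly p) 0 = coeff p 1"
    by (subst DERIV_imp_deriv[OF poly_DERIV]) (simp add: poly_0_coeff_0 coeff_pderiv)
  ultimately show ?thesis by simp
qed

lemma Baire_interval:
  fixes A :: "nat \<Rightarrow> real set"
  assumes "\<And>m. closed (A m)" "(\<Union>m. A m) = UNIV"
  obtains m c r where "r > 0" "{c - r..c + r} \<subseteq> A m"
proof -
  have "\<exists>m. interior (A m) \<noteq> {}"
  proof (rule ccontr)
    assume "\<not> ?thesis"
    then have "UNIV \<subseteq> closure (\<Inter> (range (\<lambda>m. - A m)))"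
      using assms(1) by (intro Baire) (auto simp: closure_complement)
    then show False using assms(2) by (auto simp flip: Compl_UN)
  qed
  then obtain m c where "c \<in> interior (A m)" by blast
  then obtain r where "r > 0" "cball c r \<subseteq> A m" by (meson mem_interior_cball)
  then show ?thesis using that[of r c m] by (simp add: cball_eq_atLeastAtMost)
qed

section \<open>The flow of x / (1 - x) d/dx\<close>

lemma sub_X0_nth: "sub F X2 0 $ i $ j = (if j = 0 then F $ i $ 0 else 0)"
proof -
  have "sub F X2 0 $ i $ j = (\<Sum>p\<in>{(k,l). k + l \<le> i + j}. if p = (i, 0) then (if j = 0 then F $ i $ 0 else 0) else 0)"
    unfolding sub_nth
  proof (intro sum.cong refl, clarify)
    fix k l
    show "F $ k $ l * (X2 ^ k * 0 ^ l) $ i $ j = (if (k, l) = (i, 0) then (if j = 0 then F $ i $ 0 else 0) else 0)"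
      using XY_power_nth[of k 0 i j] by (auto simp: power_0_left)
  qed
  also have "\<dots> = (if j = 0 then F $ i $ 0 else 0)" by (subst sum.delta) auto
  finally show ?thesis .
qed

lemma unit_mult_eq_0: "nc R \<Longrightarrow> u * (1 - R) = 0 \<Longrightarrow> u = 0" for u R :: ps2
proof -
  assume "nc R" "u * (1 - R) = 0"
  moreover have "(1 - R) $ 0 $ 0 = 1" using \<open>nc R\<close> by (simp add: nc_def)
  then have "1 - R \<noteq> 0" by (metis fps_zero_nth zero_neq_one)
  ultimately show "u = 0" by simp
qed

text \<open>The time-e map x |-> x exp A(x, e) of the vector field x / (1 - x) d/dx. It is T(e^e x e^(-x)), where T
  inverts x e^(-x), so its inverse comes for free as the time-(-e) map.\<close>

lemma exists_flow_series:
  obtains A f where "expands f A" "nc A" "A = Y2 + X2 * (E A - 1)"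
proof -
  let ?f = "\<lambda>x::complex. x * exp (- x)"
  have hol: "?f holomorphic_on UNIV" by (intro holomorphic_intros)
  have "(?f has_field_derivative 1) (at 0)" by (auto intro!: derivative_eq_intros)
  then have d: "deriv ?f 0 \<noteq> 0" by (simp add: DERIV_imp_deriv)
  obtain r where r: "r > 0" "open (?f ` ball 0 r)" "inj_on ?f (ball 0 r)"
    using has_complex_derivative_locally_invertible[OF hol _ open_UNIV d] by auto
  obtain T where T: "T holomorphic_on (?f ` ball 0 r)" "\<And>z. z \<in> ball 0 r \<Longrightarrow> T (?f z) = z"
    by (rule holomorphic_has_inverse[OF holomorphic_on_subset[OF hol subset_UNIV] open_ball r(3)]) blast
  have "0 \<in> ?f ` ball 0 r" using r(1) by (intro image_eqI[of _ _ 0]) auto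
  then obtain R where R: "R > 0" "ball 0 R \<subseteq> ?f ` ball 0 r" using r(2) open_contains_ball by blast
  have Tf: "?f (T w) = w" if "norm w < R" for w
  proof -
    have "w \<in> ?f ` ball 0 r" using R(2) that by auto
    then show ?thesis using T(2) by auto
  qed
  have T0: "T 0 = 0" using T(2)[of 0] r(1) by simp
  obtain Ts where Ts: "expands (\<lambda>z. T (fst z)) Ts"
    using expands_fst_holomorphic[of T R] holomorphic_on_subset[OF T(1) R(2)] R(1) by auto
  have ncT: "nc Ts" using expands_nc[OF Ts] T0 by simp
  have TsE: "Ts * E (- Ts) = X2"
  proof (rule expands_unique[OF expands_mult[OF Ts expands_E[OF expands_minus[OF Ts]]] expands_fst])
    show "\<forall>\<^sub>F z in nhds (0::C2). T (fst z) * exp (- T (fst z)) = fst z"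
      unfolding eventually_nhds_0_C2 using Tf R(1) by (intro exI[of _ "R / 2"]) auto
  qed (simp add: ncT)
  \<comment> \<open>With e = \<open>Y2\<close>: the flow multiplies x exp(-x) by exp e, so W = T(w)
    is the flowed point x exp A. Taking logarithms in W exp(-W) = w suggests A = e + W - x.\<close>
  define w where "w = E Y2 * (X2 * E (- X2))"
  define W where "W = sub Ts w 0"
  have ncw: "nc w" "nc W" by (simp_all add: w_def W_def ncT)
  have ew: "expands (\<lambda>z. exp (snd z) * (fst z * exp (- fst z))) w"
    unfolding w_def by (intro expands_mult expands_E expands_minus expands_fst expands_snd) auto
  have "expands (\<lambda>z. T (fst (exp (snd z) * (fst z * exp (- fst z)), 0::complex))) W"
    unfolding W_def by (rule expands_comp[OF Ts ew ncw(1)]) (use expands_cst[of 0] in auto)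
  then have eA: "expands (\<lambda>z. snd z + T (exp (snd z) * (fst z * exp (- fst z))) - fst z) (Y2 + W - X2)"
    by (intro expands_diff expands_add expands_fst expands_snd) auto
  have "sub (Ts * E (- Ts)) w 0 = w" using TsE ncw by simp
  then have "W * E (- W) = w" using ncw ncT by (simp add: sub_mult sub_E sub_minus W_def)
  then have "w * E W = W * (E W * E (- W))" by (simp add: mult_ac)
  also have "\<dots> = W" by (simp add: E_minus ncw)
  finally have wW: "w * E W = W" .
  have "E (Y2 + W - X2) = E Y2 * E W * E (- X2)" using E_add[of "Y2 + W" "- X2"] E_add[of Y2 W] ncw by simp
  then have "X2 * E (Y2 + W - X2) = W" using wW by (simp add: w_def mult_ac)
  then have "Y2 + W - X2 = Y2 + X2 * (E (Y2 + W - X2) - 1)" by (simp add: algebra_simps)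
  with eA show ?thesis using that ncw by simp
qed

text \<open>In terms of the flow: time 0 moves nothing, the first-order term in time is 1 / (1 - x),
  and time -e undoes time e. The first and the last are uniqueness statements for the functional
  equation, since the difference of two solutions times a unit is 0; the second compares the terms
  linear in e.\<close>

lemma flow_series_props:
  assumes "nc A" "A = Y2 + X2 * (E A - 1)"
  shows "A $ k $ 0 = 0" "A $ k $ 1 = 1" "sub A (X2 * E A) (- Y2) = - A"
proof -
  define a where "a = sub A X2 0"
  have a: "nc a" "a = X2 * (E a - 1)"
    using assms(1) arg_cong[OF assms(2), of "\<lambda>F. sub F X2 0"] by (simp_all add: a_def sub_add sub_mult sub_diff sub_E)
  obtain R where "E a - 1 = a * R" using E_minus_1_factor[OF a(1)] .
  then have "a * (1 - X2 * R) = 0" using a(2) by (simp add: algebra_simps)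
  then have "a = 0" by (rule unit_mult_eq_0[rotated]) simp
  then have A0: "A $ k $ 0 = 0" for k using sub_X0_nth[of A k 0] by (simp add: a_def)
  then show "A $ k $ 0 = 0" .
  define B where "B = PS (\<lambda>i j. A $ i $ (Suc j))"
  have AB: "A = Y2 * B"
  proof -
    have "A $ i $ j = (Y2 * B) $ i $ j" for i j
      using XY_power_mult_nth[of 0 1 B i j] A0 by (cases j) (auto simp: B_def)
    then show ?thesis by (simp add: ps2_eq_iff)
  qed
  obtain R where R: "E A = 1 + A + A ^ 2 * R" using E_decomp[OF assms(1)] .
  have "A = Y2 + X2 * (A + A ^ 2 * R)" using assms(2) R by (metis add.assoc add_diff_cancel_left')
  then have "Y2 * B = Y2 + X2 * (Y2 * B + (Y2 * B) ^ 2 * R)" by (simp only: AB)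
  also have "\<dots> = Y2 * (1 + X2 * (B + Y2 * B ^ 2 * R))" by (simp add: algebra_simps power2_eq_square)
  finally have "Y2 * B = Y2 * (1 + X2 * (B + Y2 * B ^ 2 * R))" .
  moreover have "Y2 \<noteq> 0" using Y2_nth[of 0 1] by auto
  ultimately have B: "B = 1 + X2 * (B + Y2 * B ^ 2 * R)" by simp
  \<comment> \<open>At y = 0 the equation for B becomes b = 1 + x b, whose solution is the geometric
    series.\<close>
  define b where "b = sub B X2 0"
  have b: "b = 1 + X2 * b"
    using arg_cong[OF B, of "\<lambda>F. sub F X2 0"] by (simp add: b_def sub_add sub_mult)
  have "b $ k $ 0 = 1" for k
  proof (induction k)
    case 0
    show ?case using arg_cong[OF b, of "\<lambda>F. F $ 0 $ 0"] by (simp add: X2_nth)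
  next
    case (Suc k)
    moreover have "(1 + X2 * b) $ Suc k $ 0 = b $ k $ 0"
      unfolding fps_add_nth using XY_power_mult_nth[of 1 0 b "Suc k" 0] by (simp del: fps_mult_nth_1')
    ultimately show ?case using arg_cong[OF b, of "\<lambda>F. F $ Suc k $ 0"] by simp
  qed
  then show "A $ k $ 1 = 1" using sub_X0_nth[of B k 0] by (simp add: b_def B_def)
  define G where "G = X2 * E A"
  \<comment> \<open>D measures the failure of the group law. Its two constituents satisfy the same
    functional equation, based at the moved point G and with time -e.\<close>
  define D where "D = sub A G (- Y2) + A"
  have ncs: "nc G" "nc D" "nc (sub A G (- Y2))" using assms(1) by (simp_all add: G_def D_def)
  have 1: "sub A G (- Y2) = - Y2 + G * (E (sub A G (- Y2)) - 1)"
    using arg_cong[OF assms(2), of "\<lambda>F. sub F G (- Y2)"] assms(1) ncs by (simp add: sub_add sub_mult sub_diff sub_E)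
  have 2: "- A = - Y2 + G * (E (- A) - 1)"
  proof -
    have "G * E (- A) = X2" using E_minus[OF assms(1)] by (simp add: G_def mult.assoc)
    then show ?thesis using arg_cong[OF assms(2), of uminus] by (simp add: algebra_simps G_def)
  qed
  have 3: "E (sub A G (- Y2)) = E D * E (- A)"
    using E_add[of D "- A"] ncs assms(1) by (simp add: D_def)
  obtain R' where R': "E D - 1 = D * R'" using E_minus_1_factor[OF ncs(2)] .
  have "D = G * (E (sub A G (- Y2)) - E (- A))"
  proof -
    have "D = sub A G (- Y2) - (- A)" by (simp add: D_def)
    also have "\<dots> = (- Y2 + G * (E (sub A G (- Y2)) - 1)) - (- Y2 + G * (E (- A) - 1))"
      by (rule arg_cong2[OF 1 2, of minus])
    finally show ?thesis by (simp add: algebra_simps)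
  qed
  also have "\<dots> = G * ((E D - 1) * E (- A))" unfolding 3 by (simp add: algebra_simps)
  finally have "D * (1 - G * R' * E (- A)) = 0" unfolding R' by (simp add: algebra_simps)
  then have "D = 0" by (rule unit_mult_eq_0[rotated]) (simp add: ncs)
  then show "sub A (X2 * E A) (- Y2) = - A" unfolding D_def G_def by (simp add: eq_neg_iff_add_eq_0)
qed

section \<open>The linearised conjugacy equation\<close>

definition fcn :: "complex fps \<Rightarrow> complex fps" where "fcn f = Abs_fps (\<lambda>n. cnj (f $ n))"

lemma fcn_nth [simp]: "fcn f $ n = cnj (f $ n)" by (simp add: fcn_def)

lemma fcn_simps [simp]: "fcn (f * g) = fcn f * fcn g" "fcn (f - g) = fcn f - fcn g" "fcn (f + g) = fcn f + fcn g" "fcn 1 = 1"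
  "fcn (fcn f) = f" "fcn (fps_shift n f) = fps_shift n (fcn f)" "fcn fps_X = fps_X" "fcn (- f) = - fcn f"
  by (auto simp: fps_eq_iff fps_mult_nth fps_X_def)

lemma fcn_power [simp]: "fcn (f ^ n) = fcn f ^ n" by (induction n) simp_all

lemma pp_cj [simp]: "pp n (cj F) = fcn (pp n F)" and pm_cj [simp]: "pm n (cj F) = fcn (pm n F)"
  and cj_iota [simp]: "cj (iota f) = iota (fcn f)"
  by (auto simp: fps_eq_iff ps2_eq_iff)

definition flowA :: ps2 where
  "flowA = (SOME A. (\<exists>f. expands f A) \<and> nc A \<and> A = Y2 + X2 * (E A - 1))"

lemma flowA: "\<exists>f. expands f flowA" "nc flowA" "flowA = Y2 + X2 * (E flowA - 1)"
proof -
  have "(\<exists>f. expands f flowA) \<and> nc flowA \<and> flowA = Y2 + X2 * (E flowA - 1)"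
    unfolding flowA_def by (rule someI_ex) (meson exists_flow_series)
  then show "\<exists>f. expands f flowA" "nc flowA" "flowA = Y2 + X2 * (E flowA - 1)" by auto
qed

locale model =
  fixes mu sg :: complex and s :: nat
  assumes mu: "norm mu = 1" and s: "s \<ge> 1" and sg: "sg = 1 \<or> sg = -1"
begin

lemma mu_cnj: "mu * cnj mu = 1" using complex_norm_square[of mu] mu by simp
lemma mu_nz [simp]: "mu \<noteq> 0" using mu by auto
lemma sg_simps [simp]: "sg * sg = 1" "cnj sg = sg" "sg \<noteq> 0" using sg by auto

text \<open>\<open>al\<close> is alpha(h) and \<open>al'\<close> its inverse, which is also its
  coefficientwise conjugate because mu has modulus 1 and \<open>w0\<close> is imaginary.
  \<open>a1\<close> and \<open>a2\<close> are the same two series in the single variable h.\<close>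

definition w0 :: ps2 where "w0 = cst (sg * \<i>) * hh ^ s"
definition al :: ps2 where "al = cst mu * E w0"
definition al' :: ps2 where "al' = cst (cnj mu) * E (- w0)"
definition a1 :: "complex fps" where "a1 = pp 0 al"
definition a2 :: "complex fps" where "a2 = pp 0 al'"

lemma nc_w0 [simp]: "nc w0" using s by (simp add: w0_def)

lemma w0_iota: "w0 = iota (fps_const (sg * \<i>) * fps_X ^ s)"
  by (simp add: w0_def iota_mult iota_const iota_power iota_X)

lemma E_iota: "f $ 0 = 0 \<Longrightarrow> iota (pp 0 (E (iota f))) = E (iota f)"
  unfolding E_def by (rule iota_sub[symmetric])

lemma iota_a: "iota a1 = al" "iota a2 = al'"
proof -
  have iota_cst: "iota (pp 0 (cst c * F)) = cst c * iota (pp 0 F)" for c F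
    by (auto simp: ps2_eq_iff)
  have "- w0 = iota (- (fps_const (sg * \<i>) * fps_X ^ s))" by (simp add: w0_iota iota_minus)
  moreover have "(fps_const (sg * \<i>) * fps_X ^ s) $ 0 = 0" using s by simp
  ultimately have "iota (pp 0 (E w0)) = E w0" "iota (pp 0 (E (- w0))) = E (- w0)"
    by (simp_all only: w0_iota E_iota fps_neg_nth minus_zero)
  then show "iota a1 = al" "iota a2 = al'" by (simp_all add: a1_def a2_def al_def al'_def iota_cst)
qed

lemma al_al': "al * al' = 1"
proof -
  have "al * al' = cst (mu * cnj mu) * (E w0 * E (- w0))" by (simp add: al_def al'_def cst_mult mult_ac)
  then show ?thesis by (simp add: mu_cnj E_minus)
qed

lemma a1_a2 [simp]: "a1 * a2 = 1" "a2 * a1 = 1"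
  using al_al' by (simp_all add: iota_mult iota_a mult.commute flip: iota_inj)

lemma cj_w0 [simp]: "cj w0 = - w0" by (simp add: w0_def cst_minus)

lemma cj_al [simp]: "cj al = al'" "cj al' = al" by (simp_all add: al_def al'_def cj_E)

lemma fcn_a [simp]: "fcn a1 = a2" "fcn a2 = a1"
  by (simp_all add: a1_def a2_def flip: pp_cj)

lemma al_power: "al ^ n = cst (mu ^ n) * E (of_nat n * w0)" "al' ^ n = cst (cnj mu ^ n) * E (of_nat n * - w0)"
  by (simp_all add: al_def al'_def power_mult_distrib cst_power E_power)

lemma of_nat_cst: "of_nat n = cst (of_nat n)"
  by (induction n) (simp_all add: cst_add)

lemma E_hh_nth: "E (cst c * hh ^ s) $ 0 $ 0 = 1" "E (cst c * hh ^ s) $ s $ s = c"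
proof -
  have nc: "nc (cst c * hh ^ s)" using s by simp
  obtain R where R: "E (cst c * hh ^ s) = 1 + cst c * hh ^ s + (cst c * hh ^ s) ^ 2 * R" using E_decomp[OF nc] .
  have "(cst c * hh ^ s) ^ 2 * R = cst (c ^ 2) * (hh ^ (s * 2) * R)"
    by (simp add: power_mult_distrib cst_power power_mult)
  then have "((cst c * hh ^ s) ^ 2 * R) $ i $ i = 0" if "i \<le> s" for i
    using that s by (simp only: cst_mult_nth hh_power_mult_nth) simp
  then show "E (cst c * hh ^ s) $ 0 $ 0 = 1" "E (cst c * hh ^ s) $ s $ s = c"
    using s unfolding R fps_add_nth by (simp_all only: order_refl zero_le) (simp_all add: hh_power_nth)
qed

text \<open>The divisor alpha^(-n) - alpha^n has constant term conj(mu)^n - mu^n, and its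
  coefficient at h^s is a nonzero multiple of conj(mu)^n + mu^n. Both cannot vanish since mu^n is
  nonzero, so the order in h is at most s, whatever the arithmetic of lambda.\<close>

lemma exists_V:
  assumes "n \<ge> 1" shows "\<exists>V. (a2 ^ n - a1 ^ n) * V = fps_X ^ s"
proof -
  let ?D = "a2 ^ n - a1 ^ n"
  have w: "of_nat n * w0 = cst (of_nat n * (sg * \<i>)) * hh ^ s" "of_nat n * - w0 = cst (- of_nat n * (sg * \<i>)) * hh ^ s"
    by (simp_all add: w0_def of_nat_cst cst_mult cst_minus mult_ac)
  have a: "a1 ^ n = pp 0 (al ^ n)" "a2 ^ n = pp 0 (al' ^ n)"
    by (simp_all flip: iota_a iota_power add: pp_iota)
  have D0: "?D $ 0 = cnj mu ^ n - mu ^ n" and Ds: "?D $ s = - (of_nat n * (sg * \<i>)) * (cnj mu ^ n + mu ^ n)"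
    unfolding a al_power w fps_sub_nth pp_nth add_0_right cst_mult_nth E_hh_nth by (simp_all add: algebra_simps)
  have "?D $ 0 \<noteq> 0 \<or> ?D $ s \<noteq> 0"
    unfolding D0 Ds using assms by auto
  then have "?D \<noteq> 0" "subdegree ?D \<le> s"
    by (auto intro: subdegree_leI)
  then have "?D dvd fps_X ^ s" by (simp add: fps_dvd_iff)
  then show ?thesis by (metis dvd_def)
qed

definition V :: "nat \<Rightarrow> complex fps" where "V n = (SOME V. (a2 ^ n - a1 ^ n) * V = fps_X ^ s)"

lemma V: "n \<ge> 1 \<Longrightarrow> (a2 ^ n - a1 ^ n) * V n = fps_X ^ s"
  unfolding V_def by (rule someI_ex[OF exists_V])

lemma fcn_V: assumes "n \<ge> 1" shows "fcn (V n) = - V n"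
proof -
  have D: "a2 ^ n - a1 ^ n \<noteq> 0" using V[OF assms] by auto
  have "(a1 ^ n - a2 ^ n) * fcn (V n) = fps_X ^ s" using arg_cong[OF V[OF assms], of fcn] by simp
  then have "(a2 ^ n - a1 ^ n) * fcn (V n) = (a2 ^ n - a1 ^ n) * (- V n)"
    using V[OF assms] by (metis (no_types) minus_diff_eq minus_mult_commute mult_minus_left minus_minus)
  with D show ?thesis by (metis mult_left_cancel)
qed

text \<open>Um and Up solve U_n + alpha^(-n) U_(-n) = p_n together with its complex conjugate, which is the
  equation u + u o tau_1 = p for real u.\<close>

definition Um :: "nat \<Rightarrow> ps2 \<Rightarrow> complex fps" where "Um n p = fps_shift s (pp n p - fcn (pp n p)) * V n"
definition Up :: "nat \<Rightarrow> ps2 \<Rightarrow> complex fps" where "Up n p = pp n p - a2 ^ n * Um n p"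

text \<open>On the diagonal u + u o tau_1' is 2u, so a real u takes half the real part of p; the
  imaginary part cannot be solved for and is recorded as \<open>kap\<close>.\<close>

definition Lam :: "ps2 \<Rightarrow> ps2" where
  "Lam p = PS (\<lambda>i j. if i < j then Um (j - i) p $ i else if j < i then Up (i - j) p $ j else of_real (Re (p $ i $ i)) / 2)"

definition kap :: "ps2 \<Rightarrow> complex fps" where "kap p = Abs_fps (\<lambda>k. of_real (Im (p $ k $ k)))"

lemma pp_Lam: "pp n (Lam p) = (if n = 0 then Abs_fps (\<lambda>k. of_real (Re (p $ k $ k)) / 2) else Up n p)"
  and pm_Lam: "pm n (Lam p) = (if n = 0 then Abs_fps (\<lambda>k. of_real (Re (p $ k $ k)) / 2) else Um n p)"
  by (auto simp: fps_eq_iff Lam_def)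

abbreviation sig :: "ps2 \<Rightarrow> ps2" where "sig \<equiv> tw a1 a2"

text \<open>The components at x^n agree by the definition of \<open>Up\<close>; those at y^n follow
  because p is invariant. The value of \<open>Um\<close> is dictated by reality, in
  \<open>Lam_real\<close>.\<close>

lemma Lam_eq:
  assumes "sig p = p" shows "Lam p + sig (Lam p) = p - cst \<i> * iota (kap p)"
proof (rule ps2_eq_ppI)
  have p0: "pm n p = a1 ^ n * pp n p" for n using pm_tw[of a1 a2 n p] assms by simp
  have diag: "Abs_fps (\<lambda>k. complex_of_real (Re (p $ k $ k)) / 2) + Abs_fps (\<lambda>k. of_real (Re (p $ k $ k)) / 2) = pp 0 p - fps_const \<i> * kap p"
    by (simp add: fps_eq_iff kap_def complex_eq_iff)
  have c: "cst \<i> * iota (kap p) = iota (fps_const \<i> * kap p)" by (simp add: iota_mult iota_const)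
  have aa: "a1 ^ n * (a2 ^ n * f) = f" for n f by (simp flip: mult.assoc power_mult_distrib)
  fix n
  show "pp n (Lam p + sig (Lam p)) = pp n (p - cst \<i> * iota (kap p))"
    unfolding c using diag by (auto simp: pp_tw pm_Lam pp_Lam pp_iota Up_def)
  show "pm n (Lam p + sig (Lam p)) = pm n (p - cst \<i> * iota (kap p))"
    unfolding c using diag p0[of n] p0[of 0] by (auto simp: pm_tw pm_Lam pp_Lam pm_iota Up_def right_diff_distrib aa)
qed

lemma pp_van: "van min k p \<Longrightarrow> m < k \<Longrightarrow> pp n p $ m = 0" "van min k p \<Longrightarrow> m < k \<Longrightarrow> pm n p $ m = 0"
  by (auto simp: van_def)

lemma van_minI:
  assumes "\<And>n m. m < k \<Longrightarrow> pp n F $ m = 0" "\<And>n m. m < k \<Longrightarrow> pm n F $ m = 0"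
  shows "van min k F"
  unfolding van_def
proof (intro allI impI)
  fix i j assume "min i j < k"
  then show "F $ i $ j = 0" using assms(1)[of j "i - j"] assms(2)[of i "j - i"] by (cases "i \<le> j") auto
qed

text \<open>Divisibility of p by h^s makes the shift in \<open>Um\<close> an exact division, so
  (alpha^(-n) - alpha^n) U_(-n) = p_n - conj p_n, which says that U_n is real. U_(-n) is real
  because numerator and divisor both change sign under conjugation.\<close>

lemma Lam_real:
  assumes "van min s p" shows "cj (Lam p) = Lam p"
proof (rule ps2_eq_ppI)
  fix n
  have Um: "fcn (Um n p) = Um n p" if "n \<ge> 1"
  proof -
    have "fcn (Um n p) = fps_shift s (fcn (pp n p) - pp n p) * (- V n)" using fcn_V[OF that] by (simp add: Um_def)
    also have "fps_shift s (fcn (pp n p) - pp n p) = - fps_shift s (pp n p - fcn (pp n p))" by (simp add: fps_eq_iff)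
    finally show ?thesis by (simp add: Um_def)
  qed
  have sh: "fps_X ^ s * fps_shift s (pp n p - fcn (pp n p)) = pp n p - fcn (pp n p)"
    using pp_van(1)[OF assms] by (auto simp: fps_eq_iff fps_X_power_mult_nth)
  have "pp n p - fcn (pp n p) = (a2 ^ n - a1 ^ n) * Um n p" if "n \<ge> 1"
  proof -
    have "(a2 ^ n - a1 ^ n) * Um n p = ((a2 ^ n - a1 ^ n) * V n) * fps_shift s (pp n p - fcn (pp n p))"
      by (simp only: Um_def mult_ac)
    then show ?thesis unfolding V[OF that] sh by (rule sym)
  qed
  then have Up: "fcn (Up n p) = Up n p" if "n \<ge> 1"
    using that Um by (simp add: Up_def algebra_simps)
  have 0: "fcn (Abs_fps (\<lambda>k. complex_of_real (Re (p $ k $ k)) / 2)) = Abs_fps (\<lambda>k. complex_of_real (Re (p $ k $ k)) / 2)"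
    by (simp add: fps_eq_iff)
  show "pp n (cj (Lam p)) = pp n (Lam p)" "pm n (cj (Lam p)) = pm n (Lam p)"
    using Um Up 0 by (simp_all add: pp_Lam pm_Lam Suc_le_eq)
qed

lemma Lam_van:
  assumes "van min (k + s) p" shows "van min k (Lam p)"
proof (rule van_minI)
  fix n m assume m: "m < k"
  have Um: "Um n p $ i = 0" if "i \<le> m" for i
    unfolding Um_def fps_mult_nth using pp_van[OF assms] m that by (auto intro!: sum.neutral)
  have "Up n p $ m = 0" unfolding Up_def fps_sub_nth fps_mult_nth using Um pp_van[OF assms, of m n] m by (auto intro!: sum.neutral)
  moreover have "p $ m $ m = 0" using assms m by (auto simp: van_def)
  ultimately show "pp n (Lam p) $ m = 0" "pm n (Lam p) $ m = 0" using Um by (simp_all add: pp_Lam pm_Lam)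
qed

lemma Lam_diff: "Lam (p - r) = Lam p - Lam r"
proof -
  have Um: "Um n (p - r) = Um n p - Um n r" for n
  proof -
    have "fps_shift s (pp n (p - r) - fcn (pp n (p - r))) = fps_shift s (pp n p - fcn (pp n p)) - fps_shift s (pp n r - fcn (pp n r))"
      by (simp add: fps_eq_iff)
    then show ?thesis unfolding Um_def by (simp only: left_diff_distrib)
  qed
  then have "Up n (p - r) = Up n p - Up n r" for n by (simp only: Up_def right_diff_distrib pp_simps) simp
  with Um show ?thesis by (simp add: ps2_eq_iff Lam_def diff_divide_distrib)
qed

text \<open>The degree bound min - s compensates the division by h^s: coefficient i of the shifted
  series is coefficient i + s of p, of degree at most i.\<close>

lemma Lam_tp:
  assumes p: "\<And>i j. tp (min i j - s) (\<lambda>t. p t $ i $ j)" shows "cls 1 (\<lambda>t. Lam (p t))"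
proof -
  have Re: "tp m (\<lambda>t. complex_of_real (Re (p t $ i $ i)) / 2)" if "i - s \<le> m" for i m
  proof -
    have e: "complex_of_real (Re z) / 2 = 1 / 4 * (z + cnj z)" for z by (simp add: complex_eq_iff)
    show ?thesis unfolding e using tp_mono[OF p[of i i], of m] that by (intro tp_cmult tp_add tp_cnj) simp_all
  qed
  have Um: "tp m (\<lambda>t. Um n (p t) $ k)" if "k \<le> m" for n k m
    unfolding Um_def fps_mult_nth
  proof (rule tp_sum)
    fix i assume "i \<in> {0..k}"
    then have "tp m (\<lambda>t. p t $ (i + s + n) $ (i + s))" using p[of "i + s + n" "i + s"] that by (auto intro: tp_mono)
    then show "tp m (\<lambda>t. fps_shift s (pp n (p t) - fcn (pp n (p t))) $ i * V n $ (k - i))"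
      unfolding mult.commute[of _ "V n $ (k - i)"] by (auto intro!: tp_cmult tp_diff tp_cnj simp: add_ac)
  qed
  have Up: "tp k (\<lambda>t. Up n (p t) $ k)" for n k
    unfolding Up_def fps_sub_nth fps_mult_nth
    using p[of "k + n" k] by (auto intro!: tp_diff tp_sum tp_cmult Um intro: tp_mono)
  show ?thesis unfolding cls_def Lam_def
  proof (intro allI)
    fix i j
    show "tp (min i j div 1) (\<lambda>t. PS (\<lambda>i j. if i < j then Um (j - i) (p t) $ i else if j < i then Up (i - j) (p t) $ j
       else complex_of_real (Re (p t $ i $ i)) / 2) $ i $ j)"
      using Um Up Re by (cases i j rule: linorder_cases) auto
  qed
qed

lemma tp_tw:
  assumes F: "\<And>i j. tp (b (min i j)) (\<lambda>t. F t $ i $ j)" and b: "mono (b :: nat \<Rightarrow> nat)"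
  shows "tp (b (min i j)) (\<lambda>t. sig (F t) $ i $ j)"
proof -
  have mon: "tp (b k) (\<lambda>t. F t $ i $ j)" if "min i j \<le> k" for i j k
    using F[of i j] monoD[OF b that] by (rule tp_mono)
  have "tp (b k) (\<lambda>t. pm n (sig (F t)) $ k)" "tp (b k) (\<lambda>t. pp n (sig (F t)) $ k)" for n k
    unfolding pm_tw[OF a1_a2(1)] pp_tw[OF a1_a2(1)] fps_mult_nth by (auto intro!: tp_sum tp_cmult mon)
  from this(1)[of i "j - i"] this(2)[of j "i - j"] show ?thesis by (cases "i \<le> j") (auto simp: min_def)
qed

end

section \<open>The formal conjugacy\<close>

text \<open>Bookkeeping for the exponent s + 1: one power of t per h^(s + 1) implies the bound m - s
  required by \<open>Lam_tp\<close>, with equality at m = s + 1.\<close>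

lemma div_Suc_add_le:
  fixes m :: nat assumes "Suc s \<le> m" shows "m div Suc s + s \<le> m"
proof -
  define d where "d = m div Suc s"
  have "Suc s div Suc s \<le> d" unfolding d_def using assms by (rule div_le_mono)
  then have "1 \<le> d" by simp
  then have "s * 1 \<le> s * d" by (rule mult_le_mono2)
  moreover have "Suc s * d \<le> m" unfolding d_def by (rule times_div_less_eq_dividend)
  ultimately show ?thesis unfolding d_def[symmetric] mult_Suc mult_1_right by linarith
qed

context model begin

text \<open>The flow is run for the time i t h^(s + 1). As g_t preserves h, this time is constant
  along the map, and the group law of the flow makes g_(-t) the inverse of g_t, with no inverse
  function theorem.\<close>

definition eps :: "real \<Rightarrow> ps2" where "eps t = cst (\<i> * of_real t) * hh ^ Suc s"
definition aa :: "real \<Rightarrow> ps2" where "aa t = sub flowA X2 (eps t)"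
definition g1 :: "real \<Rightarrow> ps2" where "g1 t = X2 * E (aa t)"
definition g2 :: "real \<Rightarrow> ps2" where "g2 t = Y2 * E (- aa t)"

lemma nc_fam [simp]: "nc (eps t)" "nc (aa t)" "nc (g1 t)" "nc (g2 t)"
  by (simp_all add: eps_def aa_def g1_def g2_def flowA(2))

lemma g1_g2: "g1 t * g2 t = hh"
  using E_minus[of "aa t"] by (simp add: g1_def g2_def hh_def mult_ac)

lemma sub_g_hh: "sub hh (g1 t) (g2 t) = hh"
proof -
  have "sub hh (g1 t) (g2 t) = g1 t * g2 t" by (simp add: hh_def sub_mult)
  then show ?thesis by (simp add: g1_g2)
qed

lemma sub_aa_g: "sub (aa (- t)) (g1 t) (g2 t) = - aa t"
proof -
  have e: "sub (eps (- t)) (g1 t) (g2 t) = - eps t"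
  proof -
    have "sub (eps (- t)) (g1 t) (g2 t) = cst (\<i> * of_real (- t)) * sub hh (g1 t) (g2 t) ^ Suc s"
      unfolding eps_def by (simp only: sub_mult sub_power sub_cst nc_fam)
    then show ?thesis unfolding sub_g_hh by (simp add: eps_def cst_minus)
  qed
  have "sub (aa (- t)) (g1 t) (g2 t) = sub flowA (sub X2 (g1 t) (g2 t)) (sub (eps (- t)) (g1 t) (g2 t))"
    unfolding aa_def by (rule sub_assoc) simp_all
  also have "\<dots> = sub flowA (X2 * E (aa t)) (- eps t)" unfolding e by (simp add: g1_def)
  also have "\<dots> = sub (sub flowA (X2 * E flowA) (- Y2)) X2 (eps t)"
    by (simp add: sub_assoc sub_mult sub_E sub_minus flowA(2) aa_def)
  also have "\<dots> = - aa t"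
    unfolding flow_series_props(3)[OF flowA(2,3)] by (simp add: aa_def sub_minus)
  finally show ?thesis .
qed

lemma g_inverse: "sub (g1 (- t)) (g1 t) (g2 t) = X2" "sub (g2 (- t)) (g1 t) (g2 t) = Y2"
proof -
  have "sub (g1 (- t)) (g1 t) (g2 t) = g1 t * E (- aa t)"
    unfolding g1_def[of "- t"] by (simp add: sub_mult sub_E sub_aa_g)
  also have "\<dots> = X2" using E_minus[of "aa t"] by (simp add: g1_def mult.assoc)
  finally show "sub (g1 (- t)) (g1 t) (g2 t) = X2" .
  have "sub (g2 (- t)) (g1 t) (g2 t) = g2 t * E (aa t)"
    unfolding g2_def[of "- t"] by (simp add: sub_mult sub_E sub_minus sub_aa_g)
  also have "\<dots> = Y2" using E_minus[of "aa t"] by (simp add: g2_def mult_ac)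
  finally show "sub (g2 (- t)) (g1 t) (g2 t) = Y2" .
qed

lemma sub_g_g: "sub (sub F (g1 t) (g2 t)) (g1 (- t)) (g2 (- t)) = F"
  using g_inverse[of "- t"] by (simp add: sub_assoc)

lemma flowA_factor: "flowA = Y2 * PS (\<lambda>i j. flowA $ i $ Suc j)"
proof -
  have "flowA $ i $ j = (Y2 * PS (\<lambda>i j. flowA $ i $ Suc j)) $ i $ j" for i j
    using XY_power_mult_nth[of 0 1 "PS (\<lambda>i j. flowA $ i $ Suc j)" i j] flow_series_props(1)[OF flowA(2,3)]
    by (cases j) auto
  then show ?thesis unfolding ps2_eq_iff by blast
qed

definition Bt :: "real \<Rightarrow> ps2" where "Bt t = sub (PS (\<lambda>i j. flowA $ i $ Suc j)) X2 (eps t)"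

lemma aa_factor: "aa t = eps t * Bt t"
  unfolding aa_def Bt_def by (subst flowA_factor) (simp add: sub_mult)

lemma van_eps: "van min (Suc s) (eps t)"
proof -
  have "van min (Suc s) (hh ^ Suc s)" by (auto simp: van_def hh_power_nth simp del: power_Suc)
  then show ?thesis unfolding eps_def by (rule van_mult2[OF weight_min])
qed

lemma van_aa: "van min (Suc s) (aa t)"
  unfolding aa_factor by (rule van_mult1[OF weight_min van_eps])

lemma cls_eps: "cls (Suc s) eps"
  unfolding cls_def eps_def
  by (auto simp: hh_power_nth simp del: power_Suc intro!: tp_mult[of 1 _ 0] tp_cmult tp_of_real)

lemma cls_aa: "cls (Suc s) aa"
  unfolding aa_def by (intro cls_sub cls_eps cls_const)

text \<open>The factor picked up by x^k y^l under g_t. It is 1 modulo h^(s + 1), so composition with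
  g_t is close to the identity.\<close>

definition ee :: "nat \<Rightarrow> nat \<Rightarrow> real \<Rightarrow> ps2" where "ee k l t = E (aa t) ^ k * E (- aa t) ^ l"

lemma cls_ee: "cls (Suc s) (ee k l)"
  unfolding ee_def by (intro cls_mult cls_power cls_E cls_minus cls_aa)

lemma van_ee: "van min (Suc s) (ee k l t - 1)"
proof -
  have m: "van min n (F * G - 1)" if "van min n (F - 1)" "van min n (G - 1)" for F G n
  proof -
    have "F * G - 1 = F * (G - 1) + (F - 1)" by (simp add: algebra_simps)
    then show ?thesis using that by (simp only: van_add van_mult2[OF weight_min])
  qed
  have e: "van min (Suc s) (E u - 1)" if "nc u" "van min (Suc s) u" for u
    by (rule E_minus_1_factor[OF that(1)]) (simp add: van_mult1 that(2))
  have p: "van min (Suc s) (F ^ n - 1)" if "van min (Suc s) (F - 1)" for F n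
    using that by (induction n) (simp_all add: m)
  show ?thesis unfolding ee_def by (intro m p e) (simp_all add: van_aa van_minus)
qed

lemma g_power: "g1 t ^ k * g2 t ^ l = X2 ^ k * Y2 ^ l * ee k l t"
  by (simp add: g1_def g2_def ee_def power_mult_distrib mult_ac)

lemma sub_g_diff_nth:
  "(sub F (g1 t) (g2 t) - F) $ i $ j =
     (\<Sum>(k,l)\<in>{(k,l). k + l \<le> i + j}. F $ k $ l * (X2 ^ k * Y2 ^ l * (ee k l t - 1)) $ i $ j)"
proof -
  have "F $ i $ j = sub F X2 Y2 $ i $ j" by simp
  then have "(sub F (g1 t) (g2 t) - F) $ i $ j =
    (\<Sum>(k,l)\<in>{(k,l). k + l \<le> i + j}. F $ k $ l * (g1 t ^ k * g2 t ^ l) $ i $ j - F $ k $ l * (X2 ^ k * Y2 ^ l) $ i $ j)"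
    by (simp only: fps_sub_nth sub_nth[of F] case_prod_unfold sum_subtractf)
  also have "\<dots> = (\<Sum>(k,l)\<in>{(k,l). k + l \<le> i + j}. F $ k $ l * (X2 ^ k * Y2 ^ l * (ee k l t - 1)) $ i $ j)"
    unfolding g_power right_diff_distrib fps_sub_nth mult_1_right by simp
  finally show ?thesis .
qed

lemma van_XY: "van min (min k l) (X2 ^ k * Y2 ^ l)"
  by (auto simp: van_def XY_power_nth)

text \<open>Monomial by monomial, composition with g_t differs from the identity by an extra h^(s +
  1). Against the loss of h^s in \<open>Lam_van\<close> one power of h remains, which is the
  contraction in \<open>TT_contracts\<close>.\<close>

lemma van_sub_g_diff:
  assumes "van min m F" shows "van min (m + Suc s) (sub F (g1 t) (g2 t) - F)"
  unfolding van_def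
proof (intro allI impI)
  fix i j assume ij: "min i j < m + Suc s"
  show "(sub F (g1 t) (g2 t) - F) $ i $ j = 0"
    unfolding sub_g_diff_nth
  proof (intro sum.neutral, clarify)
    fix k l
    show "F $ k $ l * (X2 ^ k * Y2 ^ l * (ee k l t - 1)) $ i $ j = 0"
    proof (cases "min k l < m")
      case True
      then show ?thesis using assms by (simp add: van_def)
    next
      case False
      have "van min (min k l + Suc s) (X2 ^ k * Y2 ^ l * (ee k l t - 1))"
        by (rule van_mult[OF weight_min van_XY van_ee])
      then show ?thesis using False ij unfolding van_def by simp
    qed
  qed
qed

text \<open>The coefficient of x^k y^l has degree at most min k l in t, the factor \<open>ee\<close>
  adds x div (s + 1), and a nonzero contribution needs x >= s + 1. Then
  \<open>div_Suc_add_le\<close> bounds the total by min i j - s.\<close>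

lemma tp_sub_g_diff:
  assumes "cls 1 F" shows "tp (min i j - s) (\<lambda>t. (sub (F t) (g1 t) (g2 t) - F t) $ i $ j)"
  unfolding sub_g_diff_nth case_prod_unfold
proof (rule tp_sum)
  fix p :: "nat \<times> nat"
  obtain k l where p: "p = (k, l)" by fastforce
  define x where "x = min (i - k) (j - l)"
  show "tp (min i j - s) (\<lambda>t. F t $ fst p $ snd p * (X2 ^ fst p * Y2 ^ snd p * (ee (fst p) (snd p) t - 1)) $ i $ j)"
  proof (cases "k \<le> i \<and> l \<le> j \<and> Suc s \<le> x")
    case True
    have "tp (x div Suc s) (\<lambda>t. (ee k l t - 1) $ (i - k) $ (j - l))"
      using cls_diff[OF cls_ee cls_const] unfolding cls_def x_def by blast
    moreover have "tp (min k l) (\<lambda>t. F t $ k $ l)" using assms by (simp add: cls_def)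
    moreover have "min k l + x div Suc s \<le> min i j - s"
    proof -
      have "x div Suc s + s \<le> x" using True by (intro div_Suc_add_le) simp
      moreover have "min k l + x \<le> min i j" using True by (auto simp: x_def)
      ultimately show ?thesis by linarith
    qed
    ultimately show ?thesis using True unfolding p fst_conv snd_conv XY_power_mult_nth
      by (simp only: if_True conj_absorb simp_thms) (rule tp_mult)
  next
    case False
    have "(X2 ^ k * Y2 ^ l * (ee k l t - 1)) $ i $ j = 0" for t
      using False van_ee[of k l t] unfolding XY_power_mult_nth by (auto simp: van_def x_def)
    then show ?thesis by (simp add: p)
  qed
qed

definition SS :: "ps2 \<Rightarrow> ps2" where "SS F = F + sig F"

text \<open>The equation for b = a_t + u o g_t, rearranged: u o g_t is split into u and a small
  correction, and everything except u + u o tau_1' and the diagonal term is moved to the right-hand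
  side.\<close>

definition pf :: "real \<Rightarrow> ps2 \<Rightarrow> ps2" where
  "pf t u = - SS (aa t) - SS (sub u (g1 t) (g2 t) - u)"

definition TT :: "real \<Rightarrow> ps2 \<Rightarrow> ps2" where "TT t u = Lam (pf t u)"

lemma van_SS: "van min k F \<Longrightarrow> van min k (SS F)"
  unfolding SS_def by (intro van_add van_min_tw) simp_all

lemma van_pf: "van min (Suc s) (pf t u)"
  unfolding pf_def
  using van_sub_g_diff[of 0 u t] by (intro van_diff[OF van_minus[OF van_SS[OF van_aa]]] van_SS) simp_all

lemma sig_pf: "sig (pf t u) = pf t u"
  by (simp add: pf_def SS_def tw_tw algebra_simps)

lemma TT_contracts: "van min k (u - v) \<Longrightarrow> van min (Suc k) (TT t u - TT t v)"
proof -
  assume *: "van min k (u - v)"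
  have "pf t u - pf t v = - SS (sub (u - v) (g1 t) (g2 t) - (u - v))"
    by (simp add: pf_def SS_def sub_diff)
  then have "van min (Suc k + s) (pf t u - pf t v)"
    using van_minus[OF van_SS[OF van_sub_g_diff[OF *, of t]]] by simp
  then show ?thesis unfolding TT_def by (simp only: Lam_van flip: Lam_diff)
qed

lemma exists_uu: "\<exists>u. u = TT t u \<and> (\<forall>N. van min N (u - (TT t ^^ N) 0))"
proof (rule contraction_fixpoint[of min "TT t"])
  show "van min (Suc k) (TT t u - TT t v)" if "van min k (u - v)" for u v k
    using that by (rule TT_contracts)
  fix u assume "u = TT t u" "\<And>N. van min N (u - (TT t ^^ N) 0)"
  then show ?thesis by (intro exI[of _ u] conjI allI)
qed

definition uu :: "real \<Rightarrow> ps2" where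
  "uu t = (SOME u. u = TT t u \<and> (\<forall>N. van min N (u - (TT t ^^ N) 0)))"

lemma uu_fix: "uu t = TT t (uu t)" and uu_approx: "van min N (uu t - (TT t ^^ N) 0)"
  using someI_ex[OF exists_uu[of t], folded uu_def] by (rule conjunct1, rule conjunct2[THEN spec])

lemma uu_real: "cj (uu t) = uu t"
proof -
  have "cj (TT t (uu t)) = TT t (uu t)"
    unfolding TT_def by (rule Lam_real[OF van_mono[OF van_pf]]) simp
  then show ?thesis by (simp flip: uu_fix)
qed

lemma van_uu: "van min 1 (uu t)"
  by (subst uu_fix, unfold TT_def, rule Lam_van) (use van_pf in simp)

lemma nc_uu [simp]: "nc (uu t)" using van_uu by (simp add: van_def nc_def)

lemma tp_pf:
  assumes "cls 1 u" shows "tp (min i j - s) (\<lambda>t. pf t (u t) $ i $ j)"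
proof -
  have mono: "mono (\<lambda>k. k - s)" by (auto intro!: monoI)
  have aa: "tp (min i j - s) (\<lambda>t. aa t $ i $ j)" for i j
  proof (cases "Suc s \<le> min i j")
    case True
    define m where "m = min i j"
    have "m div Suc s \<le> m - s" using div_Suc_add_le[of s m] True unfolding m_def by linarith
    then show ?thesis using cls_aa unfolding cls_def m_def by (blast intro: tp_mono)
  next
    case False
    then have "aa t $ i $ j = 0" for t using van_aa[of t] by (auto simp: van_def)
    then show ?thesis by simp
  qed
  have SS: "tp (min i j - s) (\<lambda>t. SS (F t) $ i $ j)" if "\<And>i j. tp (min i j - s) (\<lambda>t. F t $ i $ j)" for F i j
    using tp_tw[OF that mono, of i j] that[of i j] unfolding SS_def fps_add_nth by (rule_tac tp_add)
  show ?thesis unfolding pf_def fps_sub_nth fps_neg_nth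
    by (intro tp_diff tp_minus SS aa tp_sub_g_diff[OF assms])
qed

lemma cls_iter: "cls 1 (\<lambda>t. (TT t ^^ N) 0)"
proof (induction N)
  case (Suc N)
  then have "cls 1 (\<lambda>t. Lam (pf t ((TT t ^^ N) 0)))" by (intro Lam_tp tp_pf)
  then show ?case by (simp only: funpow.simps comp_apply TT_def[symmetric])
qed simp

text \<open>A coefficient with min i j = m agrees with that of iterate m + 1, and every iterate of 0
  depends polynomially on t with the required degrees.\<close>

lemma cls_uu: "cls 1 uu"
  unfolding cls_def
proof (intro allI)
  fix i j
  have "uu t $ i $ j = (TT t ^^ Suc (min i j)) 0 $ i $ j" for t
    using uu_approx[of "Suc (min i j)" t] unfolding van_def by (metis eq_iff_diff_eq_0 fps_sub_nth lessI)
  then show "tp (min i j div 1) (\<lambda>t. uu t $ i $ j)" using cls_iter[of "Suc (min i j)"] unfolding cls_def by simp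
qed

lemma aa_0 [simp]: "aa 0 = 0"
  by (simp add: aa_factor eps_def)

lemma g_0 [simp]: "g1 0 = X2" "g2 0 = Y2" by (simp_all add: g1_def g2_def)

lemma uu_0 [simp]: "uu 0 = 0"
proof -
  have "Lam 0 = 0" using Lam_diff[of 0 0] by simp
  then have "TT 0 0 = 0" by (simp add: TT_def pf_def SS_def)
  then have "(TT 0 ^^ N) 0 = 0" for N by (induction N) simp_all
  then show ?thesis using uu_approx[of _ 0] van_all_imp_0[of min "uu 0"] by simp
qed

definition kp :: "real \<Rightarrow> complex fps" where "kp t = kap (pf t (uu t))"
definition bb :: "real \<Rightarrow> ps2" where "bb t = aa t + sub (uu t) (g1 t) (g2 t)"

lemma nc_bb [simp]: "nc (bb t)" by (simp add: bb_def)

lemma bb_eq: "bb t + sig (bb t) = - (cst \<i> * iota (kp t))"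
proof -
  have "bb t + sig (bb t) = (uu t + sig (uu t)) - pf t (uu t)"
    by (simp add: bb_def pf_def SS_def algebra_simps)
  also have "uu t + sig (uu t) = pf t (uu t) - cst \<i> * iota (kp t)"
    using Lam_eq[OF sig_pf, of t "uu t"] unfolding TT_def[symmetric] uu_fix[symmetric] kp_def .
  finally show ?thesis by simp
qed

text \<open>\<open>kpr\<close> is the relative change of h^s that the rescaling has to produce:
  \<open>w0\<close> times it is -i times \<open>kp\<close>. As Psi turns h into h eta^2, eta is the
  2s-th root of 1 + \<open>kpr\<close>, given by the binomial series.\<close>

definition kpr :: "real \<Rightarrow> complex fps" where "kpr t = fps_const (- sg) * fps_shift s (kp t)"
definition eta :: "real \<Rightarrow> ps2" where "eta t = iota (fps_binomial (1 / (2 * of_nat s)) oo kpr t)"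
definition nk :: "real \<Rightarrow> ps2" where "nk t = iota (fps_const (- \<i>) * kp t)"
definition Psi1 :: "real \<Rightarrow> ps2" where "Psi1 t = X2 * (E (uu t) * eta t)"
definition Psi2 :: "real \<Rightarrow> ps2" where "Psi2 t = Y2 * (E (- uu t) * eta t)"

lemma nc_Psi [simp]: "nc (Psi1 t)" "nc (Psi2 t)" by (simp_all add: Psi1_def Psi2_def)

lemma kp_low: "k \<le> s \<Longrightarrow> kp t $ k = 0"
  using van_pf[of t "uu t"] by (simp add: kp_def kap_def van_def)

lemma kpr_0 [simp]: "kpr t $ 0 = 0" by (simp add: kpr_def kp_low)

lemma nc_nk [simp]: "nc (nk t)" by (simp add: nk_def kp_low)

lemma bb_eq': "sig (bb t) = nk t - bb t"
proof -
  have "nk t = - (cst \<i> * iota (kp t))" by (simp add: nk_def iota_mult iota_const cst_minus)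
  then show ?thesis using bb_eq[of t] by (simp add: algebra_simps)
qed

lemma eta_power: "eta t ^ (2 * s) = 1 + iota (kpr t)"
proof -
  have "(fps_binomial (1 / (2 * of_nat s) :: complex) oo kpr t) ^ (2 * s) = (fps_binomial (1 / (2 * of_nat s)) ^ (2 * s)) oo kpr t"
    by (simp add: fps_compose_power)
  also have "fps_binomial (1 / (2 * of_nat s) :: complex) ^ (2 * s) = 1 + fps_X"
    using s by (simp add: fps_binomial_power fps_binomial_1)
  also have "(1 + fps_X) oo kpr t = 1 + kpr t" by (simp add: fps_compose_add_distrib)
  finally show ?thesis by (simp add: eta_def iota_add flip: iota_power)
qed

lemma w0_kpr: "w0 * iota (kpr t) = nk t"
proof -
  have "fps_X ^ s * fps_shift s (kp t) = kp t"
    using kp_low[of _ t] by (auto simp: fps_eq_iff fps_X_power_mult_nth)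
  then have "(fps_const (sg * \<i>) * fps_X ^ s) * kpr t = fps_const (- \<i>) * kp t"
  proof -
    have "(fps_const (sg * \<i>) * fps_X ^ s) * kpr t = (fps_const (sg * \<i>) * fps_const (- sg)) * (fps_X ^ s * fps_shift s (kp t))"
      by (simp only: kpr_def mult_ac)
    moreover have "sg * \<i> * - sg = - \<i>" by (simp add: mult_ac)
    ultimately show ?thesis using \<open>fps_X ^ s * fps_shift s (kp t) = kp t\<close> by (simp only: fps_const_mult)
  qed
  then show ?thesis unfolding w0_iota nk_def by (simp flip: iota_mult)
qed

lemma Psi_prod: "Psi1 t * Psi2 t = hh * eta t ^ 2"
proof -
  have "Psi1 t * Psi2 t = hh * eta t ^ 2 * (E (uu t) * E (- uu t))"
    by (simp add: Psi1_def Psi2_def hh_def power2_eq_square mult_ac)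
  then show ?thesis by (simp add: E_minus)
qed

lemma sub_w0_Psi: "sub w0 (Psi1 t) (Psi2 t) = w0 + nk t"
proof -
  have "sub w0 (Psi1 t) (Psi2 t) = cst (sg * \<i>) * (Psi1 t * Psi2 t) ^ s"
    by (simp add: w0_def hh_def sub_mult sub_power)
  also have "\<dots> = w0 * eta t ^ (2 * s)" 
    unfolding Psi_prod w0_def power_mult[of "eta t" 2 s] power_mult_distrib by (simp only: mult.assoc)
  also have "\<dots> = w0 + nk t" unfolding eta_power by (simp add: algebra_simps w0_kpr)
  finally show ?thesis .
qed

lemma sub_al_Psi: "sub al (Psi1 t) (Psi2 t) = al * E (nk t)" "sub al' (Psi1 t) (Psi2 t) = al' * E (- nk t)"
proof -
  show "sub al (Psi1 t) (Psi2 t) = al * E (nk t)"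
    by (simp add: al_def sub_mult sub_E sub_w0_Psi E_add mult_ac)
  have "- w0 - nk t = - w0 + - nk t" by simp
  then have "E (- w0 - nk t) = E (- w0) * E (- nk t)" by (simp only: E_add nc_simps nc_w0 nc_nk)
  then show "sub al' (Psi1 t) (Psi2 t) = al' * E (- nk t)"
    by (simp add: al'_def sub_mult sub_E sub_minus sub_w0_Psi mult_ac)
qed

lemma sub_iota_g: "sub (iota f) (g1 t) (g2 t) = iota f"
  by (rule sub_iota) (simp_all add: g1_g2)

lemma sub_Psi_g: "sub (Psi1 t) (g1 t) (g2 t) = X2 * (E (bb t) * eta t)"
  "sub (Psi2 t) (g1 t) (g2 t) = Y2 * (E (- bb t) * eta t)"
proof -
  show "sub (Psi1 t) (g1 t) (g2 t) = X2 * (E (bb t) * eta t)"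
    by (simp add: Psi1_def sub_mult sub_E eta_def sub_iota_g bb_def E_add) (simp add: g1_def mult_ac)
  have "- bb t = - aa t + - sub (uu t) (g1 t) (g2 t)" by (simp add: bb_def)
  then have "E (- bb t) = E (- aa t) * E (- sub (uu t) (g1 t) (g2 t))" by (simp only: E_add nc_simps nc_fam nc_sub nc_uu)
  then show "sub (Psi2 t) (g1 t) (g2 t) = Y2 * (E (- bb t) * eta t)"
    by (simp add: Psi2_def sub_mult sub_E sub_minus eta_def sub_iota_g) (simp add: g2_def mult_ac)
qed

lemma sub_alE_g: "sub (al * E (nk t)) (g1 t) (g2 t) = al * E (nk t)" "sub (al' * E (- nk t)) (g1 t) (g2 t) = al' * E (- nk t)"
  unfolding iota_a[symmetric] nk_def using kp_low[of 0 t]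
  by (simp_all add: sub_mult sub_iota_g sub_E iota_minus[symmetric] del: iota_minus)

text \<open>In the first identity both sides are al y eta times exp(nk - bb): on the left
  \<open>sig\<close> turns \<open>bb\<close> into nk - bb, on the right alpha at h eta^2 contributes
  exp(nk) and the second component of Psi o g_t contributes exp(-bb). The second identity is its
  mirror image.\<close>

lemma sig_Psi_g: "sig (sub (Psi1 t) (g1 t) (g2 t)) = sub (sub (al * Y2) (Psi1 t) (Psi2 t)) (g1 t) (g2 t)"
  "sig (sub (Psi2 t) (g1 t) (g2 t)) = sub (sub (al' * X2) (Psi1 t) (Psi2 t)) (g1 t) (g2 t)"
proof -
  have m: "- (nk t - bb t) = - nk t + bb t" "nk t - bb t = nk t + - bb t" by simp_all
  have E: "E (nk t - bb t) = E (nk t) * E (- bb t)" "E (- (nk t - bb t)) = E (- nk t) * E (bb t)"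
    unfolding m(1) by (simp_all only: m(2) E_add nc_simps nc_bb nc_nk)
  have "sub (sub (al * Y2) (Psi1 t) (Psi2 t)) (g1 t) (g2 t) = (al * E (nk t)) * sub (Psi2 t) (g1 t) (g2 t)"
    by (simp only: sub_mult[of "Psi1 t" "Psi2 t"] nc_Psi sub_al_Psi sub_Y2 sub_mult[of "g1 t" "g2 t" "al * E (nk t)"] nc_fam sub_alE_g)
  then show "sig (sub (Psi1 t) (g1 t) (g2 t)) = sub (sub (al * Y2) (Psi1 t) (Psi2 t)) (g1 t) (g2 t)"
    unfolding sub_Psi_g by (simp add: bb_eq' E eta_def iota_a mult_ac)
  have "sub (sub (al' * X2) (Psi1 t) (Psi2 t)) (g1 t) (g2 t) = (al' * E (- nk t)) * sub (Psi1 t) (g1 t) (g2 t)"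
    by (simp only: sub_mult[of "Psi1 t" "Psi2 t"] nc_Psi sub_al_Psi sub_X2 sub_mult[of "g1 t" "g2 t" "al' * E (- nk t)"] nc_fam sub_alE_g)
  moreover have "sig (- bb t) = - (nk t - bb t)" by (simp add: bb_eq')
  ultimately show "sig (sub (Psi2 t) (g1 t) (g2 t)) = sub (sub (al' * X2) (Psi1 t) (Psi2 t)) (g1 t) (g2 t)"
    unfolding sub_Psi_g by (simp del: minus_diff_eq tw_simps(3) add: E eta_def iota_a mult_ac)
qed

section \<open>The conjugated involution and reality of the conjugacy\<close>

definition T1 :: "real \<Rightarrow> ps2" where "T1 t = sub (sig (g1 t)) (g1 (- t)) (g2 (- t))"
definition T2 :: "real \<Rightarrow> ps2" where "T2 t = sub (sig (g2 t)) (g1 (- t)) (g2 (- t))"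

lemma nc_T [simp]: "nc (T1 t)" "nc (T2 t)" by (simp_all add: T1_def T2_def)

lemma sub_T: "sub F (T1 t) (T2 t) = sub (sig (sub F (g1 t) (g2 t))) (g1 (- t)) (g2 (- t))"
  unfolding T1_def T2_def tw_def by (simp add: sub_assoc)

lemma Psi_conjugates:
  "sub (Psi1 t) (T1 t) (T2 t) = sub (al * Y2) (Psi1 t) (Psi2 t)"
  "sub (Psi2 t) (T1 t) (T2 t) = sub (al' * X2) (Psi1 t) (Psi2 t)"
  unfolding sub_T sig_Psi_g sub_g_g by simp_all

lemma T_involution: "sub (T1 t) (T1 t) (T2 t) = X2" "sub (T2 t) (T1 t) (T2 t) = Y2"
proof -
  have "sub (T1 t) (g1 t) (g2 t) = sig (g1 t)" "sub (T2 t) (g1 t) (g2 t) = sig (g2 t)"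
    unfolding T1_def T2_def using sub_g_g[of _ "- t"] by simp_all
  then show "sub (T1 t) (T1 t) (T2 t) = X2" "sub (T2 t) (T1 t) (T2 t) = Y2"
    unfolding sub_T[of "T1 t"] sub_T[of "T2 t"] by (simp_all add: tw_tw g_inverse[of "- t", simplified])
qed

lemma cj_kp: "fcn (kp t) = kp t" by (simp add: fps_eq_iff kp_def kap_def)

lemma cj_eta: "cj (eta t) = eta t"
proof -
  have k: "fcn (kpr t ^ n) = kpr t ^ n" for n
  proof -
    have "fcn (fps_const (- sg)) = fps_const (- sg)" by (simp add: fps_eq_iff)
    then show ?thesis using cj_kp[of t] by (simp add: kpr_def)
  qed
  have "cnj ((fps_binomial (1 / (2 * of_nat s)) oo kpr t) $ n) = (fps_binomial (1 / (2 * of_nat s)) oo kpr t) $ n" for n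
  proof -
    have "cnj ((kpr t ^ i) $ n) = (kpr t ^ i) $ n" for i using arg_cong[OF k[of i], of "\<lambda>f. f $ n"] unfolding fcn_nth .
    moreover have "cnj (1 / (2 * of_nat s) gchoose i) = (1 / (2 * of_nat s) gchoose i)" for i
      by (simp add: gbinomial_prod_rev)
    ultimately show ?thesis by (simp add: fps_compose_nth)
  qed
  then show ?thesis by (simp add: eta_def fps_eq_iff iota_inj)
qed

text \<open>Real coefficients mean that Psi commutes with rho; conjugating
  \<open>Psi_conjugates\<close> then gives the relation for the second involution.\<close>

lemma cj_Psi: "cj (Psi1 t) = Psi1 t" "cj (Psi2 t) = Psi2 t"
  by (simp_all add: Psi1_def Psi2_def cj_E cj_eta uu_real)

lemma cls_kpr: "cls 1 (\<lambda>t. iota (kpr t))"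
  unfolding cls_def
proof (intro allI)
  fix i j
  have e: "complex_of_real (Im z) = (- \<i> / 2) * (z - cnj z)" for z by (simp add: complex_eq_iff)
  have "tp i (\<lambda>t. kpr t $ i)"
  proof -
    have "kpr t $ i = - sg * ((- \<i> / 2) * (pf t (uu t) $ (i + s) $ (i + s) - cnj (pf t (uu t) $ (i + s) $ (i + s))))" for t
      unfolding e[symmetric] by (simp add: kpr_def kp_def kap_def)
    moreover have "tp i (\<lambda>t. pf t (uu t) $ (i + s) $ (i + s))" using tp_pf[OF cls_uu, of "i + s" "i + s"] by simp
    ultimately show ?thesis by (simp only:) (intro tp_cmult tp_diff tp_cnj)
  qed
  then show "tp (min i j div 1) (\<lambda>t. iota (kpr t) $ i $ j)" by (cases "i = j") simp_all
qed

lemma cls_eta: "cls 1 eta"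
  unfolding cls_def
proof (intro allI)
  fix i j
  show "tp (min i j div 1) (\<lambda>t. eta t $ i $ j)"
  proof (cases "i = j")
    case True
    have "tp i (\<lambda>t. (kpr t ^ n) $ i)" for n
      using cls_power[OF cls_kpr, of n, unfolded cls_def, rule_format, of i i] by (simp flip: iota_power)
    then show ?thesis using True by (auto simp: eta_def fps_compose_nth intro!: tp_sum tp_cmult)
  qed (simp add: eta_def)
qed

lemma cls_Psi1: "cls 1 Psi1"
  unfolding Psi1_def by (intro cls_mult cls_const cls_E cls_uu cls_eta)

end

section \<open>Divergence of the formal conjugacy\<close>

text \<open>The derivative at t = 0 is taken coefficient by coefficient, so it makes sense for
  divergent series.\<close>

definition jet :: "(real \<Rightarrow> ps2) \<Rightarrow> ps2 \<Rightarrow> bool" where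
  "jet F F' \<longleftrightarrow> (\<forall>i j. ((\<lambda>t. F t $ i $ j) has_vector_derivative F' $ i $ j) (at 0))"

lemma jet_const: "jet (\<lambda>t. F) 0" by (simp add: jet_def)

lemma jet_add: "jet F F' \<Longrightarrow> jet G G' \<Longrightarrow> jet (\<lambda>t. F t + G t) (F' + G')"
  unfolding jet_def by (auto intro!: has_vector_derivative_add)

lemma jet_mult:
  assumes "jet F F'" "jet G G'" shows "jet (\<lambda>t. F t * G t) (F 0 * G' + F' * G 0)"
  unfolding jet_def
proof (intro allI)
  fix i j
  have "((\<lambda>t. \<Sum>k\<le>i. \<Sum>l\<le>j. F t $ k $ l * G t $ (i - k) $ (j - l)) has_vector_derivative
    (\<Sum>k\<le>i. \<Sum>l\<le>j. F 0 $ k $ l * G' $ (i - k) $ (j - l) + F' $ k $ l * G 0 $ (i - k) $ (j - l))) (at 0)"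
    using assms unfolding jet_def by (intro has_vector_derivative_sum has_vector_derivative_mult) auto
  then show "((\<lambda>t. (F t * G t) $ i $ j) has_vector_derivative (F 0 * G' + F' * G 0) $ i $ j) (at 0)"
    unfolding fps_add_nth ps2_mult_nth by (simp add: sum.distrib)
qed

lemma jet_unique: "jet F F' \<Longrightarrow> jet F F'' \<Longrightarrow> F' = F''"
  unfolding jet_def ps2_eq_iff by (metis vector_derivative_at)

lemma jet_cj: "jet F F' \<Longrightarrow> jet (\<lambda>t. cj (F t)) (cj F')"
  unfolding jet_def by (auto intro!: has_vector_derivative_cnj)

lemma tp_jet:
  assumes "tp d f" obtains p where "degree p \<le> d" "\<And>t. f t = poly p (of_real t)" "(f has_vector_derivative coeff p 1) (at 0)"
proof -
  obtain p where p: "degree p \<le> d" "\<And>t. f t = poly p (of_real t)" using assms unfolding tp_def by blast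
  have "(poly p has_field_derivative poly (pderiv p) (of_real 0)) (at (of_real 0))" by (rule poly_DERIV)
  then have "((poly p \<circ> of_real) has_vector_derivative (1 * poly (pderiv p) (of_real 0))) (at 0)"
    by (intro field_vector_diff_chain_at[of of_real 1, simplified]) (auto intro!: derivative_eq_intros has_vector_derivative_of_real)
  moreover have "f = poly p \<circ> of_real" using p(2) by (auto simp: fun_eq_iff)
  moreover have "poly (pderiv p) 0 = coeff p 1" by (simp add: poly_0_coeff_0 coeff_pderiv)
  ultimately show ?thesis using that p by simp
qed

lemma cls_jet: assumes "cls q F" obtains F' where "jet F F'"
proof -
  have "\<exists>c. ((\<lambda>t. F t $ i $ j) has_vector_derivative c) (at 0)" for i j
    using assms unfolding cls_def by (meson tp_jet)
  then obtain c where "\<And>i j. ((\<lambda>t. F t $ i $ j) has_vector_derivative c i j) (at 0)" by metis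
  then show ?thesis by (intro that[of "PS c"]) (simp add: jet_def)
qed

lemma jet_power_0:
  assumes "jet u u'" "u 0 = 0" shows "jet (\<lambda>t. u t ^ k) (if k = 1 then u' else 0)"
proof (induction k)
  case 0
  show ?case using jet_const[of 1] by simp
next
  case (Suc k)
  have "jet (\<lambda>t. u t * u t ^ k) (u 0 * (if k = 1 then u' else 0) + u' * u 0 ^ k)" by (rule jet_mult[OF assms(1) Suc])
  then show ?case using assms(2) by (cases k) auto
qed

lemma jet_E:
  assumes u: "jet u u'" "u 0 = 0" and nc: "\<And>t. nc (u t)" shows "jet (\<lambda>t. E (u t)) u'"
  unfolding jet_def
proof (intro allI)
  fix i j
  have u00: "u' $ 0 $ 0 = 0"
  proof -
    have "((\<lambda>t. u t $ 0 $ 0) has_vector_derivative u' $ 0 $ 0) (at 0)" using u(1) by (simp add: jet_def)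
    moreover have "(\<lambda>t. u t $ 0 $ 0) = (\<lambda>t. 0)" using nc by (simp add: nc_def)
    ultimately show ?thesis by (metis has_vector_derivative_const vector_derivative_at)
  qed
  have "((\<lambda>t. \<Sum>p\<in>{(k,l). k + l \<le> i + j}. Eser $ fst p $ snd p * (u t ^ fst p * 0 ^ snd p) $ i $ j) has_vector_derivative
     (\<Sum>p\<in>{(k,l). k + l \<le> i + j}. Eser $ fst p $ snd p * ((if fst p = 1 then u' else 0) * 0 ^ snd p) $ i $ j)) (at 0)"
  proof (intro has_vector_derivative_sum has_vector_derivative_mult_right)
    fix p :: "nat \<times> nat"
    have "jet (\<lambda>t. u t ^ fst p * 0 ^ snd p) (u 0 ^ fst p * 0 + (if fst p = 1 then u' else 0) * 0 ^ snd p)"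
      by (intro jet_mult[where G = "\<lambda>t. 0 ^ snd p"] jet_power_0 u jet_const)
    then show "((\<lambda>t. (u t ^ fst p * 0 ^ snd p) $ i $ j) has_vector_derivative ((if fst p = 1 then u' else 0) * 0 ^ snd p) $ i $ j) (at 0)"
      by (simp add: jet_def)
  qed
  also have "(\<Sum>p\<in>{(k,l). k + l \<le> i + j}. Eser $ fst p $ snd p * ((if fst p = 1 then u' else 0) * 0 ^ snd p) $ i $ j) =
     (\<Sum>p\<in>{(k,l). k + l \<le> i + j}. if p = (1, 0) then u' $ i $ j else 0)"
    by (intro sum.cong) (auto simp: Eser_def power_0_left)
  also have "\<dots> = u' $ i $ j" using u00 by (subst sum.delta) (auto simp: not_less_eq_eq)
  finally show "((\<lambda>t. E (u t) $ i $ j) has_vector_derivative u' $ i $ j) (at 0)"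
    unfolding E_def sub_nth case_prod_unfold .
qed

lemma fcn_const: "fcn (fps_const c) = fps_const (cnj c)" and fcn_0: "fcn 0 = 0"
  by (simp_all add: fps_eq_iff)

context model begin

lemma jet_sig: assumes "jet F F'" shows "jet (\<lambda>t. sig (F t)) (sig F')"
proof -
  have d: "((\<lambda>t. F t $ i $ j) has_vector_derivative F' $ i $ j) (at 0)" for i j using assms by (simp add: jet_def)
  have *: "((\<lambda>t. pm n (sig (F t)) $ k) has_vector_derivative pm n (sig F') $ k) (at 0)"
    "((\<lambda>t. pp n (sig (F t)) $ k) has_vector_derivative pp n (sig F') $ k) (at 0)" for n k
    unfolding pm_tw[OF a1_a2(1)] pp_tw[OF a1_a2(1)] fps_mult_nth pp_nth pm_nth
    by (intro has_vector_derivative_sum has_vector_derivative_mult_right d)+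
  show ?thesis unfolding jet_def
  proof (intro allI)
    fix i j
    show "((\<lambda>t. sig (F t) $ i $ j) has_vector_derivative sig F' $ i $ j) (at 0)"
      using *(1)[of "j - i" i] *(2)[of "i - j" j] by (cases "i \<le> j") auto
  qed
qed

text \<open>F vanishes at t = 0, so the motion of g_t enters only at second order.\<close>

lemma jet_sub_g:
  assumes F: "jet F F'" "F 0 = 0" shows "jet (\<lambda>t. sub (F t) (g1 t) (g2 t)) F'"
  unfolding jet_def
proof (intro allI)
  fix i j
  have cg: "cls (Suc s) (\<lambda>t. g1 t ^ k * g2 t ^ l)" for k l
    unfolding g_power by (intro cls_mult cls_const cls_ee)
  have "((\<lambda>t. \<Sum>p\<in>{(k,l). k + l \<le> i + j}. F t $ fst p $ snd p * (g1 t ^ fst p * g2 t ^ snd p) $ i $ j) has_vector_derivative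
     (\<Sum>p\<in>{(k,l). k + l \<le> i + j}. F' $ fst p $ snd p * (X2 ^ fst p * Y2 ^ snd p) $ i $ j)) (at 0)"
  proof (intro has_vector_derivative_sum)
    fix p :: "nat \<times> nat"
    obtain G' where G': "jet (\<lambda>t. g1 t ^ fst p * g2 t ^ snd p) G'" using cls_jet[OF cg] .
    have "((\<lambda>t. F t $ fst p $ snd p * (g1 t ^ fst p * g2 t ^ snd p) $ i $ j) has_vector_derivative
       (F 0 $ fst p $ snd p * G' $ i $ j + F' $ fst p $ snd p * (g1 0 ^ fst p * g2 0 ^ snd p) $ i $ j)) (at 0)"
      using F(1) G' unfolding jet_def by (intro has_vector_derivative_mult) auto
    then show "((\<lambda>t. F t $ fst p $ snd p * (g1 t ^ fst p * g2 t ^ snd p) $ i $ j) has_vector_derivative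
       F' $ fst p $ snd p * (X2 ^ fst p * Y2 ^ snd p) $ i $ j) (at 0)" using F(2) by simp
  qed
  also have "(\<Sum>p\<in>{(k,l). k + l \<le> i + j}. F' $ fst p $ snd p * (X2 ^ fst p * Y2 ^ snd p) $ i $ j) = F' $ i $ j"
    using sub_nth[of F' X2 Y2 i j] by (simp add: case_prod_unfold)
  finally show "((\<lambda>t. sub (F t) (g1 t) (g2 t) $ i $ j) has_vector_derivative F' $ i $ j) (at 0)"
    unfolding sub_nth case_prod_unfold .
qed

lemma jet_diag:
  assumes "jet F F'" "\<And>t. F t $ i $ j = 0" shows "F' $ i $ j = 0"
proof -
  have "((\<lambda>t. F t $ i $ j) has_vector_derivative F' $ i $ j) (at 0)" using assms(1) by (simp add: jet_def)
  then show ?thesis using assms(2) by simp (metis has_vector_derivative_const vector_derivative_at)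
qed

text \<open>Differentiating \<open>bb_eq\<close> at t = 0 shows that b' + b' o tau_1' is a series in
  h, where b' = a' + u' and a' = i h^(s + 1) / (1 - x). Its y^n component and the conjugate of that
  give two linear equations for the two components of the real series u'; eliminating the one at x^n
  leaves the small divisor.\<close>

lemma linear_response:
  obtains u' where "jet uu u'" "\<And>n. n \<ge> 1 \<Longrightarrow> (a1 ^ n - a2 ^ n) * pm n u' = fps_const (2 * \<i>) * fps_X ^ Suc s"
proof -
  obtain u' where u': "jet uu u'" using cls_jet[OF cls_uu] .
  have u'r: "cj u' = u'" using jet_cj[OF u'] u' by (simp add: uu_real jet_unique)
  define a' where "a' = cst \<i> * hh ^ Suc s * Bt 0"
  have ja: "jet aa a'"
  proof -
    have "((\<lambda>t. \<i> * of_real t * c) has_vector_derivative \<i> * c) (at 0)" for c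
    proof -
      have "((\<lambda>t. t *\<^sub>R (\<i> * c)) has_vector_derivative 1 *\<^sub>R (\<i> * c)) (at 0)"
        by (simp add: has_vector_derivative_def bounded_linear_imp_has_derivative bounded_linear_scaleR_left)
      then show ?thesis by (simp add: scaleR_conv_of_real mult_ac)
    qed
    then have "jet eps (cst \<i> * hh ^ Suc s)" unfolding jet_def eps_def by simp
    moreover have "cls (Suc s) Bt" unfolding Bt_def by (intro cls_sub cls_eps cls_const)
    then obtain B' where "jet Bt B'" by (rule cls_jet)
    ultimately have "jet (\<lambda>t. eps t * Bt t) (eps 0 * B' + cst \<i> * hh ^ Suc s * Bt 0)" by (rule jet_mult)
    moreover have "eps 0 = 0" by (simp add: eps_def)
    ultimately show ?thesis by (simp add: a'_def flip: aa_factor)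
  qed
  have "jet bb (a' + u')"
    unfolding bb_def by (intro jet_add ja jet_sub_g u') simp
  then have "jet (\<lambda>t. bb t + sig (bb t)) ((a' + u') + sig (a' + u'))" by (intro jet_add jet_sig)
  then have J: "jet nk ((a' + u') + sig (a' + u'))" by (simp add: bb_eq')
  have pm0: "pm n ((a' + u') + sig (a' + u')) = 0" if "n \<ge> 1" for n
  proof (rule fps_ext)
    fix k
    show "pm n ((a' + u') + sig (a' + u')) $ k = 0 $ k"
      unfolding pm_nth fps_zero_nth by (rule jet_diag[OF J]) (use that in \<open>simp add: nk_def\<close>)
  qed
  have B0: "Bt 0 $ i $ j = (if j = 0 then 1 else 0)" for i j
    using flow_series_props(2)[OF flowA(2,3), of i] unfolding Bt_def eps_def by (simp add: sub_X0_nth)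
  have a'_nth: "a' $ i $ j = (if j = Suc s \<and> Suc s \<le> i then \<i> else 0)" for i j
    unfolding a'_def mult.assoc cst_mult_nth hh_power_mult_nth B0 by auto
  \<comment> \<open>All x^n occur in a' with the same component i h^(s + 1), and no y^n occurs, so
    the right-hand side of the response is the same for every n.\<close>
  have pa: "pm n a' = 0" "pp n a' = fps_const \<i> * fps_X ^ Suc s" if "n \<ge> 1" for n
    using that by (auto simp: fps_eq_iff a'_nth simp del: power_Suc)
  have "(a1 ^ n - a2 ^ n) * pm n u' = fps_const (2 * \<i>) * fps_X ^ Suc s" if n: "n \<ge> 1" for n
  proof -
    let ?X = "fps_const \<i> * fps_X ^ Suc s :: complex fps"
    have 1: "pm n u' + a1 ^ n * (?X + pp n u') = 0"
      using pm0[OF n] by (simp only: pp_simps pm_tw[OF a1_a2(1)] pa[OF n] add_0_left)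
    have r: "fcn (pm n u') = pm n u'" "fcn (pp n u') = pp n u'" by (simp_all add: u'r flip: pm_cj pp_cj)
    have X: "fcn ?X = - ?X" by (simp add: fcn_const flip: fps_const_neg del: power_Suc)
    have 2: "pm n u' + a2 ^ n * (- ?X + pp n u') = 0"
      using arg_cong[OF 1, of fcn] unfolding fcn_0 fcn_simps(3)[of "pm n u'"] fcn_simps(1)[of "a1 ^ n"] fcn_simps(3)[of ?X] by (simp only: fcn_power fcn_a r X)
    have aa: "a1 ^ n * a2 ^ n = 1" by (simp flip: power_mult_distrib)
    have 3: "a2 ^ n * pm n u' + (a1 ^ n * a2 ^ n) * (?X + pp n u') = 0"
      using arg_cong[OF 1, of "\<lambda>f. a2 ^ n * f"] by (simp only: distrib_left mult_ac mult_zero_left mult_zero_right)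
    have 4: "a1 ^ n * pm n u' + (a1 ^ n * a2 ^ n) * (- ?X + pp n u') = 0"
      using arg_cong[OF 2, of "\<lambda>f. a1 ^ n * f"] by (simp only: distrib_left mult_ac mult_zero_left mult_zero_right)
    have "(a1 ^ n - a2 ^ n) * pm n u' = ?X + ?X"
    proof -
      have "(f - g) * w = (f * w + 1 * (- z + p)) - (g * w + 1 * (z + p)) + (z + z)" for f g w z p :: "complex fps"
        by (simp add: algebra_simps)
      from this[of "a1 ^ n" "a2 ^ n" "pm n u'" ?X "pp n u'"] show ?thesis
        unfolding 3[unfolded aa] 4[unfolded aa] by simp
    qed
    also have "\<dots> = fps_const (2 * \<i>) * fps_X ^ Suc s" by (simp add: fps_eq_iff del: power_Suc)
    finally show ?thesis .
  qed
  then show ?thesis using that u' by blast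
qed

lemma expands_al: "expands (\<lambda>z. mu * exp (sg * \<i> * (fst z * snd z) ^ s)) al"
  "expands (\<lambda>z. cnj mu * exp (- (sg * \<i> * (fst z * snd z) ^ s))) al'"
  unfolding al_def al'_def w0_def hh_def using s
  by (intro expands_mult expands_cst expands_E expands_minus expands_power expands_fst expands_snd; simp)+

text \<open>eta is a series in h, so its derivative has no off-diagonal coefficients; away from x
  times a series in h, the derivative of \<open>Psi1\<close> is that of x u.\<close>

lemma Psi1_jet:
  assumes "jet uu u'" obtains P' where "jet Psi1 P'" "\<And>k n. n \<ge> 1 \<Longrightarrow> P' $ Suc k $ (k + n) = u' $ k $ (k + n)"
proof -
  obtain e' where e': "jet eta e'" using cls_jet[OF cls_eta] .
  have "kap 0 = 0" by (simp add: kap_def fps_eq_iff)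
  then have "kpr 0 = 0" by (simp add: kpr_def kp_def pf_def SS_def)
  then have eta0: "eta 0 = 1" by (simp add: eta_def)
  have "jet (\<lambda>t. E (uu t) * eta t) (E (uu 0) * e' + u' * eta 0)"
    by (intro jet_mult jet_E assms e') simp_all
  then have "jet (\<lambda>t. X2 * (E (uu t) * eta t)) (X2 * (E (uu 0) * e' + u' * eta 0) + 0 * (E (uu 0) * eta 0))"
    by (intro jet_mult[where F = "\<lambda>t. X2"] jet_const)
  then have J: "jet Psi1 (X2 * (e' + u'))" unfolding Psi1_def by (simp add: eta0)
  have "(X2 * (e' + u')) $ Suc k $ (k + n) = u' $ k $ (k + n)" if "n \<ge> 1" for k n
  proof -
    have "e' $ k $ (k + n) = 0" using that by (intro jet_diag[OF e']) (simp add: eta_def)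
    then show ?thesis using XY_power_mult_nth[of 1 0 "e' + u'" "Suc k" "k + n"] by (simp del: fps_mult_nth_1')
  qed
  with J show ?thesis using that by blast
qed

end

text \<open>h^k has degree 2k, so the terms are at most K^m ((r K)^2)^k, with ratio at most 1/4. The
  number m enters only through a constant factor, hence the radius is independent of it.\<close>

lemma absc_iota_geometric:
  assumes "K \<ge> 1" "\<And>k. norm (f $ k) \<le> K ^ (2 * k + m)" "0 \<le> r" "r * K \<le> 1 / 2"
  shows "absc r (iota f)"
proof -
  have "(\<lambda>k. norm (f $ k) * r ^ (2 * k)) summable_on UNIV"
  proof (rule summable_on_comparison_test)
    have "summable (\<lambda>k. (1 / 4 :: real) ^ k)" by (intro summable_geometric) simp
    then have "(\<lambda>k. (1 / 4 :: real) ^ k) summable_on UNIV"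
      by (intro norm_summable_imp_summable_on) simp
    then show "(\<lambda>k. K ^ m * (1 / 4) ^ k) summable_on UNIV" by (rule summable_on_cmult_right)
    fix k
    have "norm (f $ k) * r ^ (2 * k) \<le> K ^ (2 * k + m) * r ^ (2 * k)"
      using assms(2,3) by (intro mult_right_mono) auto
    also have "\<dots> = K ^ m * ((r * K) ^ 2) ^ k" 
      unfolding power_add power_mult_distrib power_mult by (simp only: mult_ac)
    also have "\<dots> \<le> K ^ m * ((1 / 2) ^ 2) ^ k"
      using assms by (intro mult_left_mono power_mono) auto
    finally show "norm (f $ k) * r ^ (2 * k) \<le> K ^ m * (1 / 4) ^ k" by (simp add: power2_eq_square)
  qed (use assms in auto)
  then have "((\<lambda>k. norm (f $ k) * r ^ (2 * k)) has_sum infsum (\<lambda>k. norm (f $ k) * r ^ (2 * k)) UNIV) UNIV"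
    by (rule has_sum_infsum)
  then have "((\<lambda>(i,j). norm (iota f $ i $ j) * r ^ (i + j)) has_sum infsum (\<lambda>k. norm (f $ k) * r ^ (2 * k)) UNIV) ((\<lambda>k. (k, k)) ` UNIV)"
    by (subst has_sum_reindex) (auto simp: inj_on_def o_def mult_2)
  then have "((\<lambda>(i,j). norm (iota f $ i $ j) * r ^ (i + j)) has_sum infsum (\<lambda>k. norm (f $ k) * r ^ (2 * k)) UNIV) UNIV"
    by (rule has_sum_cong_neutral[THEN iffD1, rotated -1]) (auto split: if_splits)
  then show ?thesis unfolding absc_def by (rule has_sum_imp_summable)
qed

lemma closed_coeff_bound:
  assumes "cls 1 F" shows "closed {t. \<forall>i j. norm (F t $ i $ j) \<le> b i j}"
proof -
  have "continuous_on UNIV (\<lambda>t. F t $ i $ j)" for i j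
  proof -
    obtain p where "\<And>t. F t $ i $ j = poly p (of_real t)" using assms unfolding cls_def tp_def by blast
    then show ?thesis by (auto intro!: continuous_intros)
  qed
  then have "closed {t. norm (F t $ i $ j) \<le> b i j}" for i j
    by (intro closed_Collect_le continuous_intros)
  then show ?thesis by (intro closed_Collect_all)
qed

text \<open>The exponent i + j + 1 lets one constant K serve both as inverse radius and as factor,
  so convergent series form a countable union over integers K, as a Baire argument needs.\<close>

definition geom_bounded :: "ps2 \<Rightarrow> bool" where
  "geom_bounded F \<longleftrightarrow> (\<exists>K. \<forall>i j. norm (F $ i $ j) \<le> K ^ (i + j + 1))"

lemma absc_imp_geom_bounded:
  assumes "absc r F" "r > 0" shows "geom_bounded F"
proof -
  define K where "K = max 1 (max (nrm r F) (1 / r))"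
  have "norm (F $ i $ j) \<le> K ^ (i + j + 1)" for i j
  proof -
    have "norm (F $ i $ j) * r ^ (i + j) \<le> nrm r F" using assms by (intro absc_coeff_le) auto
    then have "norm (F $ i $ j) \<le> nrm r F * (1 / r) ^ (i + j)"
      using assms(2) by (simp add: field_simps)
    also have "\<dots> \<le> K * K ^ (i + j)"
      using assms(2) nrm_nonneg[of r F] by (intro mult_mono power_mono) (auto simp: K_def)
    finally show ?thesis by simp
  qed
  then show ?thesis unfolding geom_bounded_def by blast
qed

context model begin

text \<open>With mu = exp(i theta) and h^s = sg d one has alpha^n = exp(i n (theta + d)), which
  equals alpha^(-n) when n (theta + d) is a multiple of pi. Some d in (0, pi/n] does this. The point
  is taken on the line x = y, where h = x^2.\<close>

lemma zero_near_0:
  assumes "r > 0"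
  obtains n x where "n \<ge> 1" "x \<noteq> 0" "norm x \<le> r" "mu ^ n * exp (of_nat n * (sg * \<i> * (x * x) ^ s)) = cnj mu ^ n * exp (- (of_nat n * (sg * \<i> * (x * x) ^ s)))"
proof -
  define th where "th = Arg mu"
  have th: "mu = exp (\<i> * of_real th)" using Arg_eq[of mu] mu by (simp add: th_def)
  obtain n :: nat where n: "n \<ge> 1" "pi / n \<le> r ^ (2 * s)"
  proof -
    have pos: "r ^ (2 * s) > 0" using assms by simp
    obtain n :: nat where "pi / r ^ (2 * s) < n" using reals_Archimedean2 by blast
    moreover have "0 < pi / r ^ (2 * s)" using pos by simp
    ultimately have "0 < real n" by linarith
    then have "n \<ge> 1" "pi / n \<le> r ^ (2 * s)"
      using \<open>pi / r ^ (2 * s) < n\<close> pos by (simp_all add: field_simps)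
    then show ?thesis using that by blast
  qed
  \<comment> \<open>Adding 1 to the floor keeps d strictly positive, hence x nonzero, even when
    mu^(2n) = 1.\<close>
  define k where "k = \<lfloor>n * th / pi\<rfloor> + 1"
  define d where "d = pi * k / n - th"
  have npi: "real n > 0" using n(1) by simp
  have "n * th / pi < k" "k \<le> n * th / pi + 1" unfolding k_def by linarith+
  then have "0 < pi * k - n * th" "pi * k - n * th \<le> pi" by (simp_all add: field_simps)
  moreover have "d = (pi * k - n * th) / n" using npi by (simp add: d_def field_simps)
  ultimately have d: "d > 0" "d \<le> pi / n" using npi by (auto intro!: divide_right_mono)
  obtain x where x: "x ^ (2 * s) = sg * of_real d"
    using exists_complex_root[of "2 * s" "sg * of_real d"] s by (metis mult_eq_0_iff not_one_le_zero zero_neq_numeral)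
  have xs: "(x * x) ^ s = sg * of_real d" using x by (simp add: power_mult power2_eq_square)
  have "norm sg = 1" using sg by auto
  then have "norm x ^ (2 * s) = d" using arg_cong[OF x, of norm] d by (simp add: norm_power norm_mult)
  then have "norm x ^ (2 * s) \<le> r ^ (2 * s)" using d n by simp
  then have "norm x \<le> r" using s assms by (simp add: power_mono_iff)
  have sgd: "sg * \<i> * (x * x) ^ s = \<i> * of_real d"
  proof -
    have "sg * \<i> * (sg * of_real d) = (sg * sg) * (\<i> * of_real d)" by (simp only: mult_ac)
    then show ?thesis unfolding xs by simp
  qed
  have nd: "of_nat n * (\<i> * of_real th) + of_nat n * (\<i> * of_real d) = \<i> * of_real (pi * k)"
  proof -
    have "real n * th + real n * d = pi * k" using npi by (simp add: d_def right_diff_distrib)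
    then have "\<i> * of_real (real n * th + real n * d) = \<i> * of_real (pi * k)" by (simp only:)
    then show ?thesis by (simp add: algebra_simps)
  qed
  have m1: "mu ^ n = exp (of_nat n * (\<i> * of_real th))" unfolding th by (simp add: exp_of_nat_mult)
  have m2: "cnj mu ^ n = exp (- (of_nat n * (\<i> * of_real th)))"
  proof -
    have "cnj mu ^ n = cnj (mu ^ n)" by simp
    also have "\<dots> = exp (- (of_nat n * (\<i> * of_real th)))" unfolding m1 by (simp add: exp_cnj)
    finally show ?thesis .
  qed
  have "mu ^ n * exp (of_nat n * (\<i> * of_real d)) = exp (\<i> * of_real (pi * k))"
    unfolding m1 nd[symmetric] by (simp add: exp_add)
  also have "\<dots> = exp (- (\<i> * of_real (pi * k)))"
    unfolding exp_eq by (intro exI[of _ k]) (simp add: algebra_simps)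
  also have "\<dots> = cnj mu ^ n * exp (- (of_nat n * (\<i> * of_real d)))"
    unfolding m2 nd[symmetric] by (simp flip: exp_add)
  finally have "mu ^ n * exp (of_nat n * (sg * \<i> * (x * x) ^ s)) = cnj mu ^ n * exp (- (of_nat n * (sg * \<i> * (x * x) ^ s)))"
    unfolding sgd .
  moreover have "x \<noteq> 0" using x d s by (auto simp: power_0_left)
  ultimately show ?thesis using that n(1) \<open>norm x \<le> r\<close> by blast
qed

theorem exists_divergent: "\<exists>t. \<not> geom_bounded (Psi1 t)"
proof (rule ccontr)
  assume "\<not> ?thesis"
  then have conv: "geom_bounded (Psi1 t)" for t by blast
  define A where "A m = {t. \<forall>i j. norm (Psi1 t $ i $ j) \<le> real m ^ (i + j + 1)}" for m
  have "closed (A m)" for m unfolding A_def by (rule closed_coeff_bound[OF cls_Psi1])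
  moreover have "(\<Union>m. A m) = UNIV"
  proof -
    have "\<exists>m. t \<in> A m" for t
    proof -
      obtain K where K: "\<And>i j. norm (Psi1 t $ i $ j) \<le> K ^ (i + j + 1)" using conv[of t] unfolding geom_bounded_def by blast
      obtain m :: nat where m: "\<bar>K\<bar> \<le> real m" using real_arch_simple by blast
      have "norm (Psi1 t $ i $ j) \<le> real m ^ (i + j + 1)" for i j
      proof -
        have "norm (Psi1 t $ i $ j) \<le> \<bar>K ^ (i + j + 1)\<bar>" using K[of i j] by linarith
        also have "\<dots> \<le> real m ^ (i + j + 1)" unfolding power_abs by (rule power_mono[OF m]) simp
        finally show ?thesis .
      qed
      then show ?thesis unfolding A_def by blast
    qed
    then show ?thesis by blast
  qed
  ultimately obtain m c r where r: "r > 0" "{c - r..c + r} \<subseteq> A m" by (rule Baire_interval)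
  obtain u' where u': "jet uu u'" "\<And>n. n \<ge> 1 \<Longrightarrow> (a1 ^ n - a2 ^ n) * pm n u' = fps_const (2 * \<i>) * fps_X ^ Suc s"
    using linear_response by blast
  obtain P' where P': "jet Psi1 P'" "\<And>k n. n \<ge> 1 \<Longrightarrow> P' $ Suc k $ (k + n) = u' $ k $ (k + n)"
    using Psi1_jet[OF u'(1)] by blast
  define B where "B = 1 + 2 * (1 + \<bar>c\<bar>) / r"
  define K where "K = max 1 (real m * B)"
  have B1: "B \<ge> 1" using r by (simp add: B_def)
  have bound: "norm (P' $ i $ j) \<le> K ^ (i + j + 1)" for i j
  proof -
    have "tp (min i j) (\<lambda>t. Psi1 t $ i $ j)" using cls_Psi1 by (simp add: cls_def)
    then obtain p where p: "degree p \<le> min i j" "\<And>t. Psi1 t $ i $ j = poly p (of_real t)"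
      "((\<lambda>t. Psi1 t $ i $ j) has_vector_derivative coeff p 1) (at 0)" by (rule tp_jet) blast
    have "P' $ i $ j = coeff p 1" using P'(1) p(3) unfolding jet_def by (metis vector_derivative_at)
    \<comment> \<open>The degree is at most min i j, hence at most i + j + 1: the Bernstein factor
      is geometric in the order of the coefficient and can be absorbed into K.\<close>
    also have "norm (coeff p 1) \<le> real m ^ (i + j + 1) * (1 + 2 * (1 + \<bar>c\<bar>) / r) ^ (i + j + 1)"
    proof (rule coeff_1_bound)
      show "degree p \<le> i + j + 1" using p(1) by linarith
      fix t assume "\<bar>t - c\<bar> \<le> r"
      then have "t \<in> A m" using r(2) by (auto simp: abs_le_iff subset_iff)
      then show "norm (poly p (of_real t)) \<le> real m ^ (i + j + 1)" unfolding A_def p(2)[symmetric] by blast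
    qed (use r in auto)
    also have "\<dots> = (real m * B) ^ (i + j + 1)" by (simp only: B_def power_mult_distrib)
    also have "\<dots> \<le> K ^ (i + j + 1)" using B1 by (intro power_mono) (auto simp: K_def)
    finally show ?thesis .
  qed
  have K1: "K \<ge> 1" by (simp add: K_def)
  have pm_bound: "norm (pm n u' $ k) \<le> K ^ (2 * k + (n + 2))" if "n \<ge> 1" for n k
    using bound[of "Suc k" "k + n"] P'(2)[OF that, of k] by (simp add: mult_2 add_ac)
  obtain r1 where r1: "r1 > 0" "\<And>q. 0 \<le> q \<Longrightarrow> q \<le> r1 \<Longrightarrow> absc q al"
    "\<And>x y. norm x \<le> r1 \<Longrightarrow> norm y \<le> r1 \<Longrightarrow> mu * exp (sg * \<i> * (fst (x, y) * snd (x, y)) ^ s) = val al x y"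
    by (rule expandsE[OF expands_al(1)]) blast
  obtain r2 where r2: "r2 > 0" "\<And>q. 0 \<le> q \<Longrightarrow> q \<le> r2 \<Longrightarrow> absc q al'"
    "\<And>x y. norm x \<le> r2 \<Longrightarrow> norm y \<le> r2 \<Longrightarrow> cnj mu * exp (- (sg * \<i> * (fst (x, y) * snd (x, y)) ^ s)) = val al' x y"
    by (rule expandsE[OF expands_al(2)]) blast
  \<comment> \<open>q is fixed before n. The bound for the y^n component depends on n only through a
    constant factor, so all these series converge on one polydisc, and n is then chosen so that the
    divisor has a zero inside it.\<close>
  define q where "q = min (min r1 r2) (1 / (2 * K))"
  have q: "q > 0" "q \<le> r1" "q \<le> r2" using r1(1) r2(1) K1 by (auto simp: q_def)
  have "q * K \<le> 1 / (2 * K) * K" using K1 by (intro mult_right_mono) (auto simp: q_def)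
  then have qK: "q * K \<le> 1 / 2" using K1 by simp
  obtain n x where n: "n \<ge> 1" and x: "x \<noteq> 0" "norm x \<le> q"
    and eq: "mu ^ n * exp (of_nat n * (sg * \<i> * (x * x) ^ s)) = cnj mu ^ n * exp (- (of_nat n * (sg * \<i> * (x * x) ^ s)))"
    using zero_near_0[OF q(1)] by blast
  define W where "W = iota (pm n u')"
  have W: "absc q W" unfolding W_def using K1 pm_bound[OF n] q qK by (intro absc_iota_geometric[of K _ "n + 2"]) auto
  have al: "absc q al" "absc q al'" using r1(2) r2(2) q by auto
  have v: "val (al ^ n) x x = val (al' ^ n) x x"
  proof -
    have "val (al ^ n) x x = (mu * exp (sg * \<i> * (x * x) ^ s)) ^ n"
      using val_power[OF al(1) x(2) x(2)] r1(3)[of x x] x q by simp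
    also have "\<dots> = mu ^ n * exp (of_nat n * (sg * \<i> * (x * x) ^ s))" by (simp add: power_mult_distrib exp_of_nat_mult)
    also have "\<dots> = cnj mu ^ n * exp (of_nat n * - (sg * \<i> * (x * x) ^ s))" using eq by simp
    also have "\<dots> = (cnj mu * exp (- (sg * \<i> * (x * x) ^ s))) ^ n" by (simp only: power_mult_distrib exp_of_nat_mult)
    also have "\<dots> = val (al' ^ n) x x"
      using val_power[OF al(2) x(2) x(2)] r2(3)[of x x] x q by simp
    finally show ?thesis .
  qed
  have "al ^ n * W - al' ^ n * W = iota ((a1 ^ n - a2 ^ n) * pm n u')"
    by (simp add: W_def iota_mult iota_diff iota_power iota_a left_diff_distrib)
  also have "\<dots> = cst (2 * \<i>) * hh ^ Suc s" unfolding u'(2)[OF n] by (simp only: iota_mult iota_const iota_power iota_X)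
  finally have eqW: "al ^ n * W = al' ^ n * W + cst (2 * \<i>) * (X2 ^ Suc s * Y2 ^ Suc s)"
    by (simp add: algebra_simps hh_def power_mult_distrib)
  have q0: "0 \<le> q" using q by simp
  note pw = absc_power(1)[OF al(1) q0, of n] absc_power(1)[OF al(2) q0, of n]
  \<comment> \<open>At (x, x) the values of al^n and al'^n coincide, so the two terms with W cancel
    and 2 i x^(2s + 2) = 0 is left.\<close>
  have "val (al ^ n) x x * val W x x = val (al' ^ n) x x * val W x x + 2 * \<i> * (x ^ Suc s * x ^ Suc s)"
    using arg_cong[OF eqW, of "\<lambda>F. val F x x"]
    by (simp only: val_mult[OF pw(1) W x(2) x(2)] val_add[OF absc_mult(1)[OF pw(2) W q0] absc_monom x(2) x(2)]
        val_mult[OF pw(2) W x(2) x(2)] val_monom)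
  then show False using v x(1) by simp
qed

end

section \<open>Formal automorphisms of the model\<close>

text \<open>(x U)^k (y W)^l - x^k y^l = x^k y^l (U^k W^l - 1), and the last factor has no constant
  term.\<close>

lemma sub_diff_tangent:
  assumes U: "U $ 0 $ 0 = 1" "W $ 0 $ 0 = 1" and F: "dv m F"
  shows "dv (Suc m) (sub F (X2 * U) (Y2 * W) - F)"
  unfolding van_def
proof (intro allI impI)
  fix i j assume ij: "i + j < Suc m"
  have "F $ i $ j = sub F X2 Y2 $ i $ j" by simp
  then have "(sub F (X2 * U) (Y2 * W) - F) $ i $ j =
    (\<Sum>(k,l)\<in>{(k,l). k + l \<le> i + j}. F $ k $ l * ((X2 * U) ^ k * (Y2 * W) ^ l) $ i $ j - F $ k $ l * (X2 ^ k * Y2 ^ l) $ i $ j)"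
    by (simp only: fps_sub_nth sub_nth[of F] case_prod_unfold sum_subtractf)
  also have "\<dots> = 0"
  proof (intro sum.neutral, clarify)
    fix k l
    show "F $ k $ l * ((X2 * U) ^ k * (Y2 * W) ^ l) $ i $ j - F $ k $ l * (X2 ^ k * Y2 ^ l) $ i $ j = 0"
    proof (cases "k + l < m")
      case True
      then show ?thesis using F by (simp add: van_def)
    next
      case False
      have "nc (U ^ k * W ^ l - 1)" using U by (simp add: fps_nth_power_0 nc_def)
      then have "dv 1 (U ^ k * W ^ l - 1)" by (simp only: nc_iff)
      moreover have "dv (k + l) (X2 ^ k * Y2 ^ l)" by (rule dv_power_mult) simp_all
      ultimately have "dv (k + l + 1) (X2 ^ k * Y2 ^ l * (U ^ k * W ^ l - 1))" by (rule_tac van_mult[OF weight_plus])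
      then have "(X2 ^ k * Y2 ^ l * (U ^ k * W ^ l - 1)) $ i $ j = 0" using False ij unfolding van_def by simp
      moreover have "X2 ^ k * Y2 ^ l * (U ^ k * W ^ l - 1) = (X2 * U) ^ k * (Y2 * W) ^ l - X2 ^ k * Y2 ^ l"
        by (simp add: power_mult_distrib algebra_simps)
      ultimately show ?thesis by (simp flip: right_diff_distrib)
    qed
  qed
  finally show "(sub F (X2 * U) (Y2 * W) - F) $ i $ j = 0" .
qed

text \<open>Replaces composition with the inverse map: Q is the fixed point of Q -> F - (Q o G - Q),
  where G is the given map, and this is a contraction in the degree filtration.\<close>

lemma sub_tangent_surj:
  assumes "U $ 0 $ 0 = 1" "W $ 0 $ 0 = 1" obtains Q where "sub Q (X2 * U) (Y2 * W) = F"
proof (rule contraction_fixpoint[of "(+)" "\<lambda>Q. F - (sub Q (X2 * U) (Y2 * W) - Q)"])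
  fix u v k assume "dv k (u - v)"
  from van_minus[OF sub_diff_tangent[OF assms this]]
  show "dv (Suc k) (F - (sub u (X2 * U) (Y2 * W) - u) - (F - (sub v (X2 * U) (Y2 * W) - v)))"
    by (simp add: sub_diff algebra_simps)
next
  fix Q assume "Q = F - (sub Q (X2 * U) (Y2 * W) - Q)"
  then show ?thesis using that by (simp add: algebra_simps)
qed

lemma sub_tangent_inj:
  assumes U: "U $ 0 $ 0 = 1" "W $ 0 $ 0 = 1" and eq: "sub P (X2 * U) (Y2 * W) = sub Q (X2 * U) (Y2 * W)" shows "P = Q"
proof -
  have s0: "sub (P - Q) (X2 * U) (Y2 * W) = 0" using eq by (simp add: sub_diff)
  have "dv k (P - Q)" for k
  proof (induction k)
    case (Suc k)
    from van_minus[OF sub_diff_tangent[OF U Suc]] show ?case unfolding s0 by simp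
  qed simp
  then show ?thesis using van_all_imp_0[of "(+)" "P - Q"] by simp
qed

lemma sub_linear_part:
  assumes "nc G" "nc H"
  shows "sub F G H $ 1 $ 0 = F $ 1 $ 0 * G $ 1 $ 0 + F $ 0 $ 1 * H $ 1 $ 0"
    and "sub F G H $ 0 $ 1 = F $ 1 $ 0 * G $ 0 $ 1 + F $ 0 $ 1 * H $ 0 $ 1"
proof -
  have S: "{(k,l). k + l \<le> (1::nat)} = {(0,0), (1,0), (0,1)}" by auto
  show "sub F G H $ 1 $ 0 = F $ 1 $ 0 * G $ 1 $ 0 + F $ 0 $ 1 * H $ 1 $ 0"
    "sub F G H $ 0 $ 1 = F $ 1 $ 0 * G $ 0 $ 1 + F $ 0 $ 1 * H $ 0 $ 1"
    by (simp_all only: sub_nth add_0_left add_0_right S) simp_all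
qed

lemma X2_iota_nth: "(X2 * iota f) $ i $ j = (if i = Suc j then f $ j else 0)"
  and Y2_iota_nth: "(Y2 * iota f) $ i $ j = (if j = Suc i then f $ i else 0)"
proof -
  have "(X2 ^ 1 * Y2 ^ 0 * iota f) $ i $ j = (if i = Suc j then f $ j else 0)"
    unfolding XY_power_mult_nth by (cases i) auto
  then show "(X2 * iota f) $ i $ j = (if i = Suc j then f $ j else 0)" by simp
  have "(X2 ^ 0 * Y2 ^ 1 * iota f) $ i $ j = (if j = Suc i then f $ i else 0)"
    unfolding XY_power_mult_nth by (cases j) auto
  then show "(Y2 * iota f) $ i $ j = (if j = Suc i then f $ i else 0)" by simp
qed

text \<open>Differentiation gives m q^(m - 1) q' = 0 up to a nonzero constant, and q is
  nonzero.\<close>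

lemma fps_const_of_power_const:
  fixes q :: "complex fps"
  assumes "fps_const c * q ^ m = fps_const d" "d \<noteq> 0" "m \<ge> 1" shows "q = fps_const (q $ 0)" "q $ 0 \<noteq> 0"
proof -
  have "c * (q $ 0) ^ m = d" using arg_cong[OF assms(1), of "\<lambda>f. f $ 0"] by (simp add: fps_nth_power_0)
  then have c: "c \<noteq> 0" and q0: "q $ 0 \<noteq> 0" using assms(2,3) by (auto simp: power_0_left)
  show "q $ 0 \<noteq> 0" by (rule q0)
  have "fps_deriv (fps_const c * q ^ m) = 0" unfolding assms(1) by simp
  then have "fps_const c * (fps_const (of_nat m) * fps_deriv q * q ^ (m - 1)) = 0"
    by (simp add: fps_deriv_power)
  then have "fps_deriv q = 0" using c q0 assms(3) by auto
  then show "q = fps_const (q $ 0)" by (simp only: fps_deriv_eq_0_iff)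
qed

lemma geom_bounded_cmult:
  assumes "geom_bounded (cst c * F)" "c \<noteq> 0" shows "geom_bounded F"
proof -
  obtain K where K: "\<And>i j. norm (c * F $ i $ j) \<le> K ^ (i + j + 1)" using assms(1) unfolding geom_bounded_def by auto
  define M where "M = max 1 (1 / norm c)"
  have "norm (F $ i $ j) \<le> (\<bar>K\<bar> * M) ^ (i + j + 1)" for i j
  proof -
    have "norm (F $ i $ j) = norm (c * F $ i $ j) * (1 / norm c)" using assms(2) by (simp add: norm_mult)
    also have "\<dots> \<le> \<bar>K\<bar> ^ (i + j + 1) * M ^ (i + j + 1)"
    proof (intro mult_mono)
      have "norm (c * F $ i $ j) \<le> \<bar>K ^ (i + j + 1)\<bar>" using K[of i j] by linarith
      then show "norm (c * F $ i $ j) \<le> \<bar>K\<bar> ^ (i + j + 1)" by (simp only: power_abs)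
      have "M ^ 1 \<le> M ^ (i + j + 1)" by (rule power_increasing) (auto simp: M_def)
      then show "1 / norm c \<le> M ^ (i + j + 1)" by (simp add: M_def)
    qed auto
    finally show ?thesis by (simp only: power_mult_distrib)
  qed
  then show ?thesis unfolding geom_bounded_def by blast
qed

context model begin

lemma E_uu_eta: "(E (uu t) * eta t) $ 0 $ 0 = 1" "(E (- uu t) * eta t) $ 0 $ 0 = 1"
  by (simp_all add: eta_def E_nth_0)

text \<open>Comparing constant terms gives mu^2 = c; after cancelling it, injectivity of
  \<open>E\<close> allows the exponents to be compared.\<close>

lemma aq_eq:
  assumes Z: "nc Z" and wq: "wq = cst (sg * \<i>) * Z ^ s"
    and eq: "cst (mu ^ 2) * E (2 * wq) = cst c * E (2 * (cst d * w0))" and c: "c \<noteq> 0"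
  shows "wq = cst d * w0"
proof -
  have nc: "nc wq" using Z s by (simp add: wq)
  have "mu ^ 2 = c" using arg_cong[OF eq, of "\<lambda>F. F $ 0 $ 0"] nc by (simp add: E_nth_0)
  then have "cst (inverse c) * (cst c * E (2 * wq)) = cst (inverse c) * (cst c * E (2 * (cst d * w0)))" using eq by simp
  then have "E (2 * wq) = E (2 * (cst d * w0))" using c by (simp flip: mult.assoc cst_mult)
  moreover have "nc (2 * wq)" "nc (2 * (cst d * w0))" using nc by (simp_all only: nc_simps nc_w0)
  ultimately have "2 * wq = 2 * (cst d * w0)" using E_inj by blast
  moreover have two: "2 = cst 2" using of_nat_cst[of 2] by simp
  ultimately have "cst 2 * wq = cst 2 * (cst d * w0)" by (simp only: two)
  then show ?thesis unfolding ps2_eq_iff cst_mult_nth by simp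
qed

lemma D_nz: "n \<ge> 1 \<Longrightarrow> a2 ^ n - a1 ^ n \<noteq> 0"
  using V[of n] by auto

text \<open>A formal map commuting with both model involutions either scales the coordinates or
  exchanges them with scaling. In both cases one component is a multiple of x, which is the form in
  which the result is used.\<close>

lemma commuting_imp_linear:
  assumes ncQ: "nc Q1" "nc Q2"
    and c1: "sig Q1 = sub (al * Y2) Q1 Q2" "sig Q2 = sub (al' * X2) Q1 Q2"
    and c2: "tw a2 a1 Q1 = sub (al' * Y2) Q1 Q2" "tw a2 a1 Q2 = sub (al * X2) Q1 Q2"
    and lin: "Q1 $ 1 $ 0 \<noteq> 0 \<or> Q1 $ 0 $ 1 \<noteq> 0"
  shows "\<exists>c. c \<noteq> 0 \<and> (Q1 = cst c * X2 \<or> Q2 = cst c * X2)"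
proof -
  define Z where "Z = Q1 * Q2"
  define wq where "wq = cst (sg * \<i>) * Z ^ s"
  define aq where "aq = cst mu * E wq"
  define aq' where "aq' = cst (cnj mu) * E (- wq)"
  have ncZ: "nc Z" "nc wq" using ncQ s by (simp_all add: Z_def wq_def)
  have "sub w0 Q1 Q2 = wq" using ncQ by (simp add: w0_def hh_def sub_mult sub_power wq_def Z_def)
  then have sal: "sub al Q1 Q2 = aq" "sub al' Q1 Q2 = aq'"
    using ncQ by (simp_all add: al_def al'_def sub_mult sub_E sub_minus aq_def aq'_def)
  have aqaq: "aq * aq' = 1"
  proof -
    have "aq * aq' = cst (mu * cnj mu) * (E wq * E (- wq))" by (simp add: aq_def aq'_def cst_mult mult_ac)
    then show ?thesis by (simp add: mu_cnj E_minus ncZ)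
  qed
  have s1: "sig Q1 = aq * Q2" "sig Q2 = aq' * Q1" and s2: "tw a2 a1 Q1 = aq' * Q2" "tw a2 a1 Q2 = aq * Q1"
    using c1 c2 ncQ by (simp_all add: sub_mult sal)
  have sZ: "sig Z = Z" "tw a2 a1 Z = Z"
  proof -
    have "sig Z = (aq * aq') * Z" "tw a2 a1 Z = (aq * aq') * Z" by (simp_all add: Z_def s1 s2 mult_ac)
    then show "sig Z = Z" "tw a2 a1 Z = Z" by (simp_all add: aqaq)
  qed
  \<comment> \<open>Z is invariant under both involutions, so its y^n component is alpha^n times and
    also alpha^(-n) times its x^n component. These factors differ for n >= 1, hence Z is a series in
    h.\<close>
  have ppZ: "pp n Z = 0" "pm n Z = 0" if "n \<ge> 1" for n
  proof -
    have 1: "pm n Z = a1 ^ n * pp n Z" "pm n Z = a2 ^ n * pp n Z"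
      using pm_tw[of a1 a2 n Z] pm_tw[of a2 a1 n Z] sZ by simp_all
    then have "(a2 ^ n - a1 ^ n) * pp n Z = 0" by (simp add: left_diff_distrib)
    then show "pp n Z = 0" using D_nz[OF that] by simp
    then show "pm n Z = 0" using 1 by simp
  qed
  have Zi: "Z = iota (pp 0 Z)"
  proof (rule ps2_eq_ppI)
    fix n
    have "pm 0 Z = pp 0 Z" by (simp add: fps_eq_iff)
    then show "pp n Z = pp n (iota (pp 0 Z))" "pm n Z = pm n (iota (pp 0 Z))"
      using ppZ[of n] by (cases "n = 0"; simp add: pp_iota pm_iota)+
  qed
  obtain b1 b2 where b: "aq = iota b1" "aq' = iota b2"
  proof -
    have "wq = iota (fps_const (sg * \<i>) * pp 0 Z ^ s)"
      unfolding wq_def by (subst Zi) (simp add: iota_mult iota_const iota_power)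
    moreover from this have "(fps_const (sg * \<i>) * pp 0 Z ^ s) $ 0 = 0" using ncZ(2) by simp
    ultimately obtain f where f: "wq = iota f" "f $ 0 = 0" by blast
    then have "E wq = iota (pp 0 (E wq))" "E (- wq) = iota (pp 0 (E (- wq)))"
      using E_iota[of f] E_iota[of "- f"] by (simp_all add: iota_minus)
    then have "aq = iota (fps_const mu * pp 0 (E wq))" "aq' = iota (fps_const (cnj mu) * pp 0 (E (- wq)))"
      by (simp_all only: aq_def aq'_def iota_mult iota_const)
    then show ?thesis using that by blast
  qed
  have Q2eq: "aq' * sig Q1 = aq * tw a2 a1 Q1"
    using aqaq by (simp add: s1 s2 mult.commute[of aq'] flip: mult.assoc)
  have aq2: "aq ^ 2 = cst (mu ^ 2) * E (2 * wq)"
    using E_power[OF ncZ(2), of 2] by (simp add: aq_def power_mult_distrib cst_power)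
  \<comment> \<open>A nonzero x^n component of Q1 forces alpha(Z)^2 = alpha(h)^(2n) up to constants,
    and in \<open>M\<close> a nonzero y^n component forces the exponent -2n. As \<open>wq\<close> is
    a single multiple of \<open>w0\<close>, Q1 has only one nonzero component, which its linear part
    identifies.\<close>
  have P: "wq = cst (of_nat n) * w0" if "pp n Q1 \<noteq> 0" for n
  proof -
    have "b2 * (a1 ^ n * pp n Q1) = b1 * (a2 ^ n * pp n Q1)"
      using arg_cong[OF Q2eq, of "pm n"] by (simp add: b pm_tw)
    then have "b2 * a1 ^ n = b1 * a2 ^ n" using that by (simp flip: mult.assoc)
    then have e: "aq' * al ^ n = aq * al' ^ n" by (simp add: b iota_a[symmetric] flip: iota_power iota_mult)
    have "aq ^ 2 = aq * (aq * al' ^ n) * al ^ n"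
    proof -
      have "al' ^ n * al ^ n = 1" using al_al' by (simp add: mult.commute flip: power_mult_distrib)
      then show ?thesis by (simp add: power2_eq_square mult.assoc)
    qed
    also have "\<dots> = (aq * aq') * (al ^ n * al ^ n)" unfolding e[symmetric] by (simp only: mult_ac)
    also have "\<dots> = cst (mu ^ (2 * n)) * E (2 * (cst (of_nat n) * w0))"
    proof -
      have "al ^ n * al ^ n = cst (mu ^ n * mu ^ n) * (E (of_nat n * w0) * E (of_nat n * w0))"
        by (simp add: al_power cst_mult mult_ac)
      also have "E (of_nat n * w0) * E (of_nat n * w0) = E (2 * (cst (of_nat n) * w0))"
        unfolding mult_2 of_nat_cst by (rule E_add[symmetric]) (simp_all only: nc_simps nc_w0)
      finally show ?thesis by (simp only: aqaq mult_2 power_add mult_1_left)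
    qed
    finally show ?thesis unfolding aq2 by (rule aq_eq[OF ncZ(1) wq_def]) simp
  qed
  have M: "wq = cst (- of_nat n) * w0" if "pm n Q1 \<noteq> 0" for n
  proof -
    have "b2 * (a2 ^ n * pm n Q1) = b1 * (a1 ^ n * pm n Q1)"
      using arg_cong[OF Q2eq, of "pp n"] by (simp add: b pp_tw)
    then have "b2 * a2 ^ n = b1 * a1 ^ n" using that by (simp flip: mult.assoc)
    then have e: "aq' * al' ^ n = aq * al ^ n" by (simp add: b iota_a[symmetric] flip: iota_power iota_mult)
    have "aq ^ 2 = aq * (aq * al ^ n) * al' ^ n"
    proof -
      have "al ^ n * al' ^ n = 1" using al_al' by (simp flip: power_mult_distrib)
      then show ?thesis by (simp add: power2_eq_square mult.assoc)
    qed
    also have "\<dots> = (aq * aq') * (al' ^ n * al' ^ n)" unfolding e[symmetric] by (simp only: mult_ac)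
    also have "\<dots> = cst (cnj mu ^ (2 * n)) * E (2 * (cst (- of_nat n) * w0))"
    proof -
      have "al' ^ n * al' ^ n = cst (cnj mu ^ n * cnj mu ^ n) * (E (of_nat n * - w0) * E (of_nat n * - w0))"
        by (simp add: al_power cst_mult mult_ac)
      also have "E (of_nat n * - w0) * E (of_nat n * - w0) = E (2 * (cst (- of_nat n) * w0))"
        unfolding of_nat_cst cst_minus mult_minus_right[of "cst (of_nat n)" w0] mult_minus_left[of "cst (of_nat n)" w0] mult_2 by (rule E_add[symmetric]) (simp_all only: nc_simps nc_w0)
      finally show ?thesis by (simp only: aqaq mult_2 power_add mult_1_left)
    qed
    finally show ?thesis unfolding aq2 by (rule aq_eq[OF ncZ(1) wq_def]) simp
  qed
  have w0nz: "cst c * w0 = cst d * w0 \<longleftrightarrow> c = d" for c d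
  proof -
    have "w0 $ s $ s = sg * \<i>" by (simp add: w0_def hh_power_nth)
    then have "c = d" if "cst c * w0 = cst d * w0"
      using arg_cong[OF that, of "\<lambda>F. F $ s $ s"] by simp
    then show ?thesis by blast
  qed
  have hs: "Z ^ s = cst c * hh ^ s" if "wq = cst c * w0" for c
  proof -
    have "cst (sg * \<i>) * Z ^ s = cst (sg * \<i>) * (cst c * hh ^ s)" using that by (simp add: wq_def w0_def mult_ac)
    moreover have "cst (sg * \<i>) \<noteq> 0" using cst_nth[of "sg * \<i>" 0 0] by (metis (no_types) fps_zero_nth sg_simps(3) complex_i_not_zero no_zero_divisors)
    ultimately show ?thesis by simp
  qed
  have hnz: "hh ^ s \<noteq> 0" using hh_power_nth[of s s s] by (metis fps_zero_nth zero_neq_one)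
  from lin show ?thesis
  proof
    assume "Q1 $ 1 $ 0 \<noteq> 0"
    then have "pp 1 Q1 \<noteq> 0" by (metis One_nat_def add_0 fps_zero_nth pp_nth)
    then have w1: "wq = cst 1 * w0" using P[of 1] by simp
    have pp0: "pp n Q1 = 0" if "n \<noteq> 1" for n
      using P[of n] w1 w0nz[of 1 "of_nat n"] that by (metis of_nat_1_eq_iff)
    have pm0: "pm n Q1 = 0" for n
    proof (rule ccontr)
      assume "pm n Q1 \<noteq> 0"
      then have "1 = - complex_of_nat n" using M[of n] w1 w0nz by metis
      then have "Re 1 = Re (- complex_of_nat n)" by simp
      then show False by simp
    qed
    define q where "q = pp 1 Q1"
    have Q1: "Q1 = X2 * iota q"
      by (rule ps2_eq_ppI) (auto simp: fps_eq_iff X2_iota_nth q_def pm0[unfolded fps_eq_iff, simplified] pp0[unfolded fps_eq_iff, simplified])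
    have "aq = al" using w1 by (simp add: aq_def al_def)
    then have "al * Q2 = al * (Y2 * iota q)" using s1(1) by (auto simp: Q1 iota_a mult_ac)
    moreover have "al \<noteq> 0" using al_al' by auto
    ultimately have Q2: "Q2 = Y2 * iota q" by simp
    \<comment> \<open>Here Z = h q^2, so Z^s = h^s leaves q^(2s) = 1 and q is constant.\<close>
    have "hh ^ s * iota (q ^ (2 * s)) = Z ^ s"
      unfolding Z_def Q1 Q2 hh_def power_mult[of q] iota_power power_mult_distrib by (simp add: power2_eq_square power_mult_distrib mult_ac)
    also have "\<dots> = hh ^ s * 1" using hs[OF w1] by simp
    finally have "iota (q ^ (2 * s)) = iota 1" using hnz by auto
    then have "q ^ (2 * s) = 1" by (simp only: iota_inj)
    then have "fps_const 1 * q ^ (2 * s) = fps_const 1" by simp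
    from fps_const_of_power_const[OF this] s have "q = fps_const (q $ 0)" "q $ 0 \<noteq> 0" by simp_all
    then have "Q1 = cst (q $ 0) * X2" using Q1 by (metis iota_const mult.commute)
    with \<open>q $ 0 \<noteq> 0\<close> show ?thesis by blast
  next
    assume "Q1 $ 0 $ 1 \<noteq> 0"
    then have "pm 1 Q1 \<noteq> 0" by (metis One_nat_def add_0 fps_zero_nth pm_nth)
    then have w1: "wq = cst (- 1) * w0" using M[of 1] by simp
    have pm0: "pm n Q1 = 0" if "n \<noteq> 1" for n
    proof (rule ccontr)
      assume "pm n Q1 \<noteq> 0"
      then have "- 1 = - complex_of_nat n" using M[of n] w1 w0nz by metis
      then show False using that by simp
    qed
    have pp0: "pp n Q1 = 0" for n
    proof (rule ccontr)
      assume "pp n Q1 \<noteq> 0"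
      then have "- 1 = complex_of_nat n" using P[of n] w1 w0nz by metis
      then have "Re (- 1) = Re (complex_of_nat n)" by simp
      then show False by simp
    qed
    define q where "q = pm 1 Q1"
    have Q1: "Q1 = Y2 * iota q"
      by (rule ps2_eq_ppI) (auto simp: fps_eq_iff Y2_iota_nth q_def pm0[unfolded fps_eq_iff, simplified] pp0[unfolded fps_eq_iff, simplified])
    have "Q2 = (aq * aq') * Q2" by (simp add: aqaq)
    also have "\<dots> = aq' * sig Q1" by (simp add: s1 mult_ac)
    also have "\<dots> = (aq' * al') * (X2 * iota q)" by (simp add: Q1 iota_a mult_ac)
    also have "aq' * al' = cst (cnj mu ^ 2) * (E w0 * E (- w0))"
      using w1 by (simp add: aq'_def al'_def cst_minus power2_eq_square cst_mult mult_ac)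
    finally have Q2: "Q2 = cst (cnj mu ^ 2) * (X2 * iota q)" by (simp add: E_minus)
    have "hh ^ s * iota (fps_const ((cnj mu ^ 2) ^ s) * q ^ (2 * s)) = Z ^ s"
      unfolding Z_def Q1 Q2 hh_def power_mult[of q] iota_power iota_mult iota_const power_mult_distrib
      by (simp add: power2_eq_square power_mult_distrib cst_power cst_mult mult_ac)
    also have "\<dots> = hh ^ s * cst (- 1)" using hs[OF w1] by simp
    finally have "iota (fps_const ((cnj mu ^ 2) ^ s) * q ^ (2 * s)) = cst (- 1)"
      by (rule mult_left_cancel[OF hnz, THEN iffD1])
    then have "fps_const ((cnj mu ^ 2) ^ s) * q ^ (2 * s) = fps_const (- 1)" by (simp only: iota_inj flip: iota_const)
    from fps_const_of_power_const[OF this] s have q: "q = fps_const (q $ 0)" "q $ 0 \<noteq> 0" by simp_all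
    then have "Q2 = cst (cnj mu ^ 2 * (q $ 0)) * X2" using Q2 by (metis cst_mult iota_const mult.assoc mult.commute)
    with q(2) show ?thesis by (metis complex_cnj_zero_iff mu_nz mult_eq_0_iff power_not_zero)
  qed
qed

text \<open>Q = F o Psi^(-1) commutes with the model involutions, so
  \<open>commuting_imp_linear\<close> applies and a component of F = Q o Psi is a nonzero multiple
  of \<open>Psi1\<close>. The growth bound for F thus passes to \<open>Psi1\<close>.\<close>

lemma conjugacy_imp_Psi1_bounded:
  assumes nc: "nc F1" "nc F2"
    and c1: "sub F1 (T1 t) (T2 t) = sub (al * Y2) F1 F2" "sub F2 (T1 t) (T2 t) = sub (al' * X2) F1 F2"
    and c2: "sub F1 (cj (T1 t)) (cj (T2 t)) = sub (al' * Y2) F1 F2" "sub F2 (cj (T1 t)) (cj (T2 t)) = sub (al * X2) F1 F2"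
    and lin: "F1 $ 1 $ 0 \<noteq> 0 \<or> F1 $ 0 $ 1 \<noteq> 0"
    and gb: "geom_bounded F1" "geom_bounded F2"
  shows "geom_bounded (Psi1 t)"
proof -
  note U = E_uu_eta[of t]
  let ?S = "\<lambda>F. sub F (Psi1 t) (Psi2 t)"
  obtain Q1 where Q1: "?S Q1 = F1" using sub_tangent_surj[OF U] unfolding Psi1_def Psi2_def by blast
  obtain Q2 where Q2: "?S Q2 = F2" using sub_tangent_surj[OF U] unfolding Psi1_def Psi2_def by blast
  have inj: "P = Q" if "?S P = ?S Q" for P Q using sub_tangent_inj[OF U] that unfolding Psi1_def Psi2_def by blast
  have const: "?S P $ 0 $ 0 = P $ 0 $ 0" for P
    using sub_diff_tangent[OF U, of 0 P] unfolding Psi1_def Psi2_def by (simp add: van_def)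
  have ncQ: "nc Q1" "nc Q2" using nc Q1 Q2 const[of Q1] const[of Q2] by (simp_all add: nc_def)
  have P2: "sub (Psi1 t) (cj (T1 t)) (cj (T2 t)) = sub (al' * Y2) (Psi1 t) (Psi2 t)"
    "sub (Psi2 t) (cj (T1 t)) (cj (T2 t)) = sub (al * X2) (Psi1 t) (Psi2 t)"
    using arg_cong[OF Psi_conjugates(1), of cj t] arg_cong[OF Psi_conjugates(2), of cj t] by (simp_all add: cj_sub cj_Psi)
  have S1: "?S (sig Q) = sub (?S Q) (T1 t) (T2 t)" for Q
    unfolding tw_def iota_a by (simp add: sub_assoc Psi_conjugates)
  have S2: "?S (tw a2 a1 Q) = sub (?S Q) (cj (T1 t)) (cj (T2 t))" for Q
    unfolding tw_def iota_a by (simp add: sub_assoc P2)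
  have C: "?S (sub F Q1 Q2) = sub F F1 F2" for F using ncQ by (simp add: sub_assoc Q1 Q2)
  have com: "sig Q1 = sub (al * Y2) Q1 Q2" "sig Q2 = sub (al' * X2) Q1 Q2"
    "tw a2 a1 Q1 = sub (al' * Y2) Q1 Q2" "tw a2 a1 Q2 = sub (al * X2) Q1 Q2"
    by (rule inj, simp only: S1 S2 C Q1 Q2 c1 c2)+
  have "dv 2 (?S Q1 - Q1)"
    using sub_diff_tangent[OF U, of 1 Q1] ncQ(1) unfolding Psi1_def Psi2_def nc_iff by (simp add: numeral_2_eq_2)
  then have "F1 $ 1 $ 0 = Q1 $ 1 $ 0" "F1 $ 0 $ 1 = Q1 $ 0 $ 1" unfolding Q1 van_def by auto
  with lin have "Q1 $ 1 $ 0 \<noteq> 0 \<or> Q1 $ 0 $ 1 \<noteq> 0" by simp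
  from commuting_imp_linear[OF ncQ com this] obtain c where c: "c \<noteq> 0" "Q1 = cst c * X2 \<or> Q2 = cst c * X2" by blast
  then have "F1 = cst c * Psi1 t \<or> F2 = cst c * Psi1 t" using Q1 Q2 by (auto simp: sub_mult)
  then show ?thesis using gb geom_bounded_cmult[OF _ c(1)] by blast
qed

end

section \<open>The triple of involutions\<close>

definition expands2 :: "(C2 \<Rightarrow> C2) \<Rightarrow> ps2 \<Rightarrow> ps2 \<Rightarrow> bool" where
  "expands2 f F G \<longleftrightarrow> expands (\<lambda>z. fst (f z)) F \<and> expands (\<lambda>z. snd (f z)) G"

lemma expands2_comp:
  assumes "expands2 f F F'" "expands2 g G G'" "nc G" "nc G'"
  shows "expands2 (f \<circ> g) (sub F G G') (sub F' G G')"
  using assms expands_comp[of "\<lambda>z. fst (f z)" F "\<lambda>z. fst (g z)" G "\<lambda>z. snd (g z)" G']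
    expands_comp[of "\<lambda>z. snd (f z)" F' "\<lambda>z. fst (g z)" G "\<lambda>z. snd (g z)" G']
  by (simp add: expands2_def)

lemma expands2_id: "expands2 id X2 Y2"
  using expands_fst expands_snd by (simp add: expands2_def)

lemma expands2_cj: "expands2 f F G \<Longrightarrow> expands2 (cnj2 \<circ> f \<circ> cnj2) (cj F) (cj G)"
  using expands_cj[of "\<lambda>z. fst (f z)" F] expands_cj[of "\<lambda>z. snd (f z)" G]
  by (simp add: expands2_def cnj2_def[of "f _"])

lemma expands2_holo_germ: "expands2 f F G \<Longrightarrow> holo_germ f"
  unfolding expands2_def expands_def holo_germ_def by blast

lemma holo_germ_expands2: "holo_germ f \<Longrightarrow> \<exists>F G. expands2 f F G"
  unfolding expands2_def expands_def holo_germ_def by (metis cf_PS)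

lemma expands2_at_0: "expands2 f F G \<Longrightarrow> nc F \<Longrightarrow> nc G \<Longrightarrow> f 0 = 0"
  unfolding expands2_def nc_def by (metis expands_at_0 prod.collapse zero_prod_def)

lemma expands2_nc: "expands2 f F G \<Longrightarrow> f 0 = 0 \<Longrightarrow> nc F \<and> nc G"
  unfolding expands2_def by (elim conjE, intro conjI; erule expands_nc) simp_all

lemma expands2_germ_eq: "expands2 f F G \<Longrightarrow> expands2 g F G \<Longrightarrow> germ_eq f g"
  unfolding expands2_def germ_eq_def
  by (elim conjE, drule (1) expands_eventually_eq, drule (1) expands_eventually_eq) (auto elim: eventually_elim2 simp: prod_eq_iff)

lemma expands2_unique:
  assumes "expands2 f F G" "expands2 g F' G'" "germ_eq f g" shows "F = F'" "G = G'"
proof -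
  have "\<forall>\<^sub>F z in nhds 0. fst (f z) = fst (g z)" "\<forall>\<^sub>F z in nhds 0. snd (f z) = snd (g z)"
    using assms(3) unfolding germ_eq_def by (auto elim: eventually_mono)
  then show "F = F'" "G = G'" using assms(1,2) expands_unique unfolding expands2_def by blast+
qed

text \<open>Uniqueness of expansions determines the choice made in \<open>taylor\<close>.\<close>

lemma taylor_expands: "expands f F \<Longrightarrow> taylor f = cf F"
proof -
  assume F: "expands f F"
  then have "has_ps_expansion f (taylor f)" unfolding taylor_def expands_def by (rule someI[of "has_ps_expansion f"])
  then have "expands f (PS (taylor f))" by (simp add: expands_def)
  then have "PS (taylor f) = F" using F by (rule expands_unique')
  then show ?thesis by (metis cf_PS)
qed

lemma taylor_map_expands2: "expands2 f F G \<Longrightarrow> taylor_map f = (cf F, cf G)"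
  unfolding taylor_map_def expands2_def by (simp add: taylor_expands)

lemma fcomp_cf: "fcomp (cf F, cf F') (cf G, cf G') = (cf (sub F G G'), cf (sub F' G G'))"
  by (simp add: fcomp_def sub_def)

lemma fconj_cf: "fconj (cf F, cf G) = (cf (cj F), cf (cj G))"
  by (simp add: fconj_def cf_def fun_eq_iff)

lemma linear_part_X2_mult: "(X2 * F) $ 1 $ 0 = F $ 0 $ 0" "(X2 * F) $ 0 $ 1 = 0"
  and linear_part_Y2_mult: "(Y2 * F) $ 1 $ 0 = 0" "(Y2 * F) $ 0 $ 1 = F $ 0 $ 0"
  using XY_power_mult_nth[of 1 0 F 1 0] XY_power_mult_nth[of 1 0 F 0 1]
    XY_power_mult_nth[of 0 1 F 1 0] XY_power_mult_nth[of 0 1 F 0 1] by simp_all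

context model begin

lemma expands2_tau1: "expands2 (tau1_model mu s sg) (al * Y2) (al' * X2)"
  and expands2_tau2: "expands2 (tau2_model mu s sg) (al' * Y2) (al * X2)"
proof -
  have inv: "inverse (mu * exp w) = cnj mu * exp (- w)" for w
    using mu_cnj by (simp add: exp_minus inverse_unique)
  show "expands2 (tau1_model mu s sg) (al * Y2) (al' * X2)" "expands2 (tau2_model mu s sg) (al' * Y2) (al * X2)"
    unfolding expands2_def tau1_model_def tau2_model_def Let_def alpha_def fst_conv snd_conv inv
    by (intro conjI expands_mult expands_al expands_fst expands_snd)+
qed

definition flowf :: "C2 \<Rightarrow> complex" where "flowf = (SOME f. expands f flowA)"

lemma expands_flowf: "expands flowf flowA"
  unfolding flowf_def by (rule someI_ex[OF flowA(1)])

definition gmap :: "real \<Rightarrow> C2 \<Rightarrow> C2" where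
  "gmap t z = (let a = flowf (fst z, \<i> * of_real t * (fst z * snd z) ^ Suc s) in (fst z * exp a, snd z * exp (- a)))"

lemma expands2_gmap: "expands2 (gmap t) (g1 t) (g2 t)"
proof -
  have "expands (\<lambda>z. \<i> * of_real t * (fst z * snd z) ^ Suc s) (eps t)"
    unfolding eps_def hh_def by (intro expands_mult expands_cst expands_power expands_fst expands_snd)
  then have "expands (\<lambda>z. flowf (fst z, \<i> * of_real t * (fst z * snd z) ^ Suc s)) (aa t)"
    unfolding aa_def by (intro expands_comp expands_flowf expands_fst) simp_all
  then show ?thesis
    unfolding expands2_def gmap_def g1_def g2_def Let_def fst_conv snd_conv
    by (intro conjI expands_mult expands_fst expands_snd expands_E expands_minus) simp_all
qed

definition t1 :: "real \<Rightarrow> C2 \<Rightarrow> C2" where "t1 t = gmap t \<circ> tau1_model mu s sg \<circ> gmap (- t)"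
definition t2 :: "real \<Rightarrow> C2 \<Rightarrow> C2" where "t2 t = cnj2 \<circ> t1 t \<circ> cnj2"

lemma expands2_t1: "expands2 (t1 t) (T1 t) (T2 t)"
proof -
  have "expands2 (gmap t \<circ> tau1_model mu s sg) (sig (g1 t)) (sig (g2 t))"
    unfolding tw_def iota_a by (intro expands2_comp expands2_gmap expands2_tau1) simp_all
  then show ?thesis unfolding t1_def T1_def T2_def by (intro expands2_comp expands2_gmap) simp_all
qed

lemma expands2_t2: "expands2 (t2 t) (cj (T1 t)) (cj (T2 t))"
  unfolding t2_def by (rule expands2_cj[OF expands2_t1])

text \<open>g_t is tangent to the identity, so the linear part is that of tau_1': antidiagonal with
  entries mu and conj mu, of product 1, whence the eigenvalues 1 and -1.\<close>

lemma T_linear_part: "T1 t $ 1 $ 0 = 0" "T1 t $ 0 $ 1 = mu" "T2 t $ 1 $ 0 = cnj mu" "T2 t $ 0 $ 1 = 0"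
proof -
  have g: "g1 t $ 1 $ 0 = 1" "g1 t $ 0 $ 1 = 0" "g2 t $ 1 $ 0 = 0" "g2 t $ 0 $ 1 = 1" for t
    unfolding g1_def g2_def linear_part_X2_mult linear_part_Y2_mult by (simp_all add: E_nth_0)
  have al: "al $ 0 $ 0 = mu" "al' $ 0 $ 0 = cnj mu" by (simp_all add: al_def al'_def E_nth_0)
  have m: "(al * Y2) $ 1 $ 0 = 0" "(al * Y2) $ 0 $ 1 = mu" "(al' * X2) $ 1 $ 0 = cnj mu" "(al' * X2) $ 0 $ 1 = 0"
    unfolding mult.commute[of al] mult.commute[of al'] linear_part_X2_mult linear_part_Y2_mult al by simp_all
  show "T1 t $ 1 $ 0 = 0" "T1 t $ 0 $ 1 = mu" "T2 t $ 1 $ 0 = cnj mu" "T2 t $ 0 $ 1 = 0"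
    unfolding T1_def T2_def tw_def iota_a
    by (simp_all only: sub_linear_part[OF nc_fam(3,4)] sub_linear_part[of "al * Y2" "al' * X2"] nc_simps g m) simp_all
qed

lemma reflection_t1: "holo_reflection (t1 t)" and reflection_t2: "holo_reflection (t2 t)"
proof -
  have id1: "expands2 (t1 t \<circ> t1 t) X2 Y2"
    using expands2_comp[OF expands2_t1 expands2_t1, of t t] by (simp add: T_involution)
  have eig: "eigvals2 0 a b 0 = {1, -1}" if "a * b = 1" for a b
  proof -
    have "(0 - m) * (0 - m) - a * b = 0 \<longleftrightarrow> m = 1 \<or> m = -1" for m
      using that by (simp add: square_eq_1_iff)
    then show ?thesis unfolding eigvals2_def by auto
  qed
  show "holo_reflection (t1 t)"
    unfolding holo_reflection_def taylor_map_expands2[OF expands2_t1] lin_eigvals_def fst_conv snd_conv cf_def T_linear_part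
    using expands2_holo_germ[OF expands2_t1] expands2_at_0[OF expands2_t1] expands2_germ_eq[OF id1 expands2_id] eig[of mu "cnj mu"] mu_cnj
    by simp
  have id2: "expands2 (t2 t \<circ> t2 t) X2 Y2"
  proof -
    have "sub (cj (T1 t)) (cj (T1 t)) (cj (T2 t)) = X2" "sub (cj (T2 t)) (cj (T1 t)) (cj (T2 t)) = Y2"
      using T_involution[of t] by (simp_all flip: cj_sub)
    then show ?thesis using expands2_comp[OF expands2_t2 expands2_t2, of t t] by simp
  qed
  show "holo_reflection (t2 t)"
    unfolding holo_reflection_def taylor_map_expands2[OF expands2_t2] lin_eigvals_def fst_conv snd_conv cf_def cj_nth T_linear_part
    using expands2_holo_germ[OF expands2_t2] expands2_at_0[OF expands2_t2] expands2_germ_eq[OF id2 expands2_id] eig[of "cnj mu" mu] mu_cnj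
    by (simp add: mult.commute)
qed

lemma cnj2_cnj2: "cnj2 \<circ> cnj2 = id" by (auto simp: cnj2_def)

lemma MW_triple_t: "MW_triple (t1 t) (t2 t) cnj2"
  unfolding MW_triple_def antiholo_involution_def cnj2_cnj2
  using reflection_t1 reflection_t2 expands2_holo_germ[OF expands2_id]
  by (simp add: t2_def germ_eq_def) (simp add: cnj2_def zero_prod_def)

text \<open>For rho = rho' = \<open>cnj2\<close> the map \<open>r \<circ> cnj2\<close> is the
  identity, so the relation for rho says that Psi has real coefficients.\<close>

lemma formally_equiv_t: "formally_equiv (t1 t) (t2 t) cnj2 (tau1_model mu s sg) (tau2_model mu s sg) cnj2"
  unfolding formally_equiv_def cnj2_cnj2 taylor_map_expands2[OF expands2_t1] taylor_map_expands2[OF expands2_t2]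
    taylor_map_expands2[OF expands2_tau1] taylor_map_expands2[OF expands2_tau2] taylor_map_expands2[OF expands2_id]
proof (intro exI[of _ "(cf (Psi1 t), cf (Psi2 t))"] conjI)
  have "Psi1 t $ 1 $ 0 = 1" "Psi1 t $ 0 $ 1 = 0" "Psi2 t $ 1 $ 0 = 0" "Psi2 t $ 0 $ 1 = 1"
    unfolding Psi1_def Psi2_def linear_part_X2_mult linear_part_Y2_mult E_uu_eta by simp_all
  then show "formal_diffeo (cf (Psi1 t), cf (Psi2 t))"
    using nc_Psi[of t] by (simp add: formal_diffeo_def lin_det_def cf_def nc_def)
  show "fcomp (cf (Psi1 t), cf (Psi2 t)) (cf (T1 t), cf (T2 t)) = fcomp (cf (al * Y2), cf (al' * X2)) (cf (Psi1 t), cf (Psi2 t))"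
    by (simp add: fcomp_cf Psi_conjugates)
  show "fcomp (cf (Psi1 t), cf (Psi2 t)) (cf (cj (T1 t)), cf (cj (T2 t))) = fcomp (cf (al' * Y2), cf (al * X2)) (cf (Psi1 t), cf (Psi2 t))"
    using arg_cong[OF Psi_conjugates(1), of cj t] arg_cong[OF Psi_conjugates(2), of cj t]
    by (simp add: fcomp_cf cj_sub cj_Psi)
  show "fcomp (cf (Psi1 t), cf (Psi2 t)) (cf X2, cf Y2) = fcomp (cf X2, cf Y2) (fconj (cf (Psi1 t), cf (Psi2 t)))"
    by (simp add: fcomp_cf fconj_cf cj_Psi)
qed

lemma analytically_equiv_imp_bounded:
  assumes "analytically_equiv (t1 t) (t2 t) cnj2 (tau1_model mu s sg) (tau2_model mu s sg) cnj2"
  shows "geom_bounded (Psi1 t)"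
proof -
  obtain f where f: "holo_diffeo_germ f" "germ_eq (f \<circ> t1 t) (tau1_model mu s sg \<circ> f)" "germ_eq (f \<circ> t2 t) (tau2_model mu s sg \<circ> f)"
    using assms unfolding analytically_equiv_def by blast
  obtain g where g: "holo_germ f" "f 0 = 0" "holo_germ g" "g 0 = 0" "germ_eq (g \<circ> f) id"
    using f(1) unfolding holo_diffeo_germ_def by blast
  obtain F1 F2 where F: "expands2 f F1 F2" using holo_germ_expands2[OF g(1)] by blast
  obtain G1 G2 where G: "expands2 g G1 G2" using holo_germ_expands2[OF g(3)] by blast
  have nc: "nc F1" "nc F2" using expands2_nc[OF F g(2)] by auto
  \<comment> \<open>The Jacobian of f has a left inverse, so its first row cannot vanish.\<close>
  have lin: "F1 $ 1 $ 0 \<noteq> 0 \<or> F1 $ 0 $ 1 \<noteq> 0"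
  proof -
    have "sub G1 F1 F2 = X2" "sub G2 F1 F2 = Y2"
      using expands2_unique[OF expands2_comp[OF G F nc] expands2_id g(5)] by auto
    then have "G1 $ 1 $ 0 * F1 $ 1 $ 0 + G1 $ 0 $ 1 * F2 $ 1 $ 0 = 1" "G1 $ 1 $ 0 * F1 $ 0 $ 1 + G1 $ 0 $ 1 * F2 $ 0 $ 1 = 0"
      "G2 $ 1 $ 0 * F1 $ 0 $ 1 + G2 $ 0 $ 1 * F2 $ 0 $ 1 = 1"
      using sub_linear_part[OF nc, of G1] sub_linear_part[OF nc, of G2] by (simp_all add: X2_nth Y2_nth)
    then show ?thesis by auto
  qed
  have gb: "geom_bounded F1" "geom_bounded F2"
    using F absc_imp_geom_bounded unfolding expands2_def expands_iff by blast+
  note u1 = expands2_unique[OF expands2_comp[OF F expands2_t1 nc_T] expands2_comp[OF expands2_tau1 F nc] f(2)]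
  have ncT: "nc (cj (T1 t))" "nc (cj (T2 t))" by simp_all
  note u2 = expands2_unique[OF expands2_comp[OF F expands2_t2 ncT] expands2_comp[OF expands2_tau2 F nc] f(3)]
  show ?thesis by (rule conjugacy_imp_Psi1_bounded[OF nc u1 u2 lin gb])
qed

end

theorem mainTheorem9:
  fixes lam mu sg :: complex and s :: nat
  assumes "norm lam = 1" and "mu ^ 2 = lam" and "s \<ge> 1" and "sg = 1 \<or> sg = -1"
  shows "\<exists>t1 t2 r. MW_triple t1 t2 r
     \<and> formally_equiv t1 t2 r (tau1_model mu s sg) (tau2_model mu s sg) cnj2
     \<and> \<not> analytically_equiv t1 t2 r (tau1_model mu s sg) (tau2_model mu s sg) cnj2"
proof -
  have "norm mu ^ 2 = 1" using assms(1,2) by (metis norm_power)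
  then have "norm mu = 1" using norm_ge_zero[of mu] by (auto simp: power2_eq_1_iff)
  then interpret model mu sg s using assms(3,4) by unfold_locales
  obtain t where "\<not> geom_bounded (Psi1 t)" using exists_divergent by blast
  then show ?thesis
    using MW_triple_t[of t] formally_equiv_t[of t] analytically_equiv_imp_bounded[of t] by blast
qed

end
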